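(* Fix $\alpha>0$. Let $\xi_0,\xi_1,\ldots$ be nondegenerate i.i.d. complex-valued random variables with $\mathbb{E}\log(1+|\xi_0|)<\infty$. Consider each of the following three random analytic functions: $$\mathbf{F}_n(z)=\begin{cases}\displaystyle\sum_{k=0}^n\xi_k\Bigl(\frac{n(n-1)\cdots(n-k+1)}{k!}\Bigr)^{\alpha}z^k & \text{(elliptic case, } z\in\mathbb{C}),\\[2mm] \displaystyle\sum_{k=0}^\infty\xi_k\Bigl(\frac{n^k}{k!}\Bigr)^{\alpha}z^k & \text{(flat case, } z\in\mathbb{C}),\\[2mm] \displaystyle\sum_{k=0}^\infty\xi_k\Bigl(\frac{n(n+1)\cdots(n+k-1)}{k!}\Bigr)^{\alpha}z^k & \text{(hyperbolic case, } z\in\mathbb{D}).\end{cases}$$ In each case, as $n\to\infty$ (with $n\in\mathbb{N}$), the sequence of random measures $\frac1n\mu_{\mathbf{F}_n}$ (on $\mathbb{C}$ in the elliptic and flat cases, on $\mathbb{D}$ in the hyperbolic case) converges in probability to the deterministic measure having the following density $\rho_\alpha$ with respect to Lebesgue measure: $$\rho_\alpha(z)=\begin{cases}\dfrac{1}{2\pi\alpha}|z|^{(1/\alpha)-2}\bigl(1+|z|^{1/\alpha}\bigr)^{-2} & \text{(elliptic case, } z\in\mathbb{C}),\\[2mm] \dfrac1{2\pi\alpha}|z|^{(1/\alpha)-2} & \text{(flat case, } z\in\mathbb{C}),\\[2mm] \dfrac1{2\pi\alpha}|z|^{(1/\alpha)-2}\bigl(1-|z|^{1/\alpha}\bigr)^{-2}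 & \text{(hyperbolic case, } z\in\mathbb{D}).\end{cases}$$
   Context: $\mathbb{D}=\{z\in\mathbb{C}:|z|<1\}$. "Nondegenerate" means not a.s. constant. The series in the flat and hyperbolic cases converge a.s. on the indicated domains. For a function $G$ analytic in a domain $D$ and not identically zero, $\mu_G=\sum_{z\in D: G(z)=0}n_G(z)\,\delta(z)$, where $n_G(z)$ is the multiplicity of the zero $z$ and $\delta(z)$ is the unit mass at $z$; if $G\equiv 0$, then $\mu_G=0$. Locally finite measures on a locally compact metric space $X$ are endowed with the vague topology (convergence of integrals of continuous compactly supported functions). Random measures $\nu_n$ converge to $\nu$ in probability if $\int_X\varphi\,d\nu_n\to\int_X\varphi\,d\nu$ in probability for every continuous compactly supported $\varphi:X\to\mathbb{R}$. *)

theory Defs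
  imports "HOL-Probability.Probability" "HOL-Complex_Analysis.Complex_Analysis"
begin

section \<open>Random measures and convergence in probability\<close>

text \<open>
  The metric space \<open>X\<close> is a subset of an ambient type, with the subspace topology. Measures on
  \<open>X\<close> have the \<open>\<sigma>\<close>-algebra of \<^term>\<open>restrict_space borel X\<close>, so functions on \<open>X\<close>
  are total functions whose values outside \<open>X\<close> are irrelevant.
\<close>

definition test_function :: "'b::metric_space set \<Rightarrow> ('b \<Rightarrow> real) \<Rightarrow> bool" where
  "test_function X \<phi> \<longleftrightarrow>
     continuous_on X \<phi> \<and> (\<exists>K. compact K \<and> K \<subseteq> X \<and> (\<forall>x\<in>X - K. \<phi> x = 0))"

definition locally_finite_measure :: "'b::metric_space set \<Rightarrow> 'b measure \<Rightarrow> bool" where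
  "locally_finite_measure X \<mu> \<longleftrightarrow>
     sets \<mu> = sets (restrict_space borel X) \<and>
     (\<forall>K. compact K \<and> K \<subseteq> X \<longrightarrow> emeasure \<mu> K < \<infinity>)"

text \<open>
  The second conjunct is measurability of \<open>\<nu>\<close> as a map into the locally finite measures with
  the Borel \<open>\<sigma>\<close>-algebra of the vague topology, which is generated by the maps
  \<open>\<mu> \<mapsto> \<integral>\<phi> d\<mu>\<close>.
\<close>

definition random_measure ::
    "'a measure \<Rightarrow> 'b::metric_space set \<Rightarrow> ('a \<Rightarrow> 'b measure) \<Rightarrow> bool" where
  "random_measure M X \<nu> \<longleftrightarrow>
     (\<forall>\<omega>\<in>space M. locally_finite_measure X (\<nu> \<omega>)) \<and>
     (\<forall>\<phi>. test_function X \<phi> \<longrightarrow> (\<lambda>\<omega>. integral\<^sup>L (\<nu> \<omega>) \<phi>) \<in> borel_measurable M)"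

definition tendsto_in_prob :: "'a measure \<Rightarrow> (nat \<Rightarrow> 'a \<Rightarrow> real) \<Rightarrow> ('a \<Rightarrow> real) \<Rightarrow> bool" where
  "tendsto_in_prob M Y Z \<longleftrightarrow>
     (\<forall>n. Y n \<in> borel_measurable M) \<and> Z \<in> borel_measurable M \<and>
     (\<forall>\<epsilon>>0. (\<lambda>n. measure M {\<omega>\<in>space M. \<bar>Y n \<omega> - Z \<omega>\<bar> > \<epsilon>}) \<longlonglongrightarrow> 0)"

definition random_measures_tendsto_in_prob ::
    "'a measure \<Rightarrow> 'b::metric_space set \<Rightarrow> (nat \<Rightarrow> 'a \<Rightarrow> 'b measure) \<Rightarrow> ('a \<Rightarrow> 'b measure) \<Rightarrow> bool" where
  "random_measures_tendsto_in_prob M X \<nu> \<nu>' \<longleftrightarrow>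
     (\<forall>n. random_measure M X (\<nu> n)) \<and> random_measure M X \<nu>' \<and>
     (\<forall>\<phi>. test_function X \<phi> \<longrightarrow>
        tendsto_in_prob M (\<lambda>n \<omega>. integral\<^sup>L (\<nu> n \<omega>) \<phi>) (\<lambda>\<omega>. integral\<^sup>L (\<nu>' \<omega>) \<phi>))"

section \<open>Zeros of analytic functions\<close>

text \<open>
  For \<open>G\<close> not analytic in \<open>D\<close> the value is the zero measure by convention. For the random
  functions below this can only happen on the null set of \<open>\<omega>\<close> for which the power series does
  not converge in the whole of \<open>D\<close>.
\<close>

definition zero_measure :: "complex set \<Rightarrow> (complex \<Rightarrow> complex) \<Rightarrow> complex measure" where
  "zero_measure D G =
     (if G analytic_on D \<and> (\<exists>z\<in>D. G z \<noteq> 0)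
      then distr (point_measure {z\<in>D. G z = 0} (\<lambda>z. of_nat (nat (zorder G z))))
             (restrict_space borel D) (\<lambda>z. z)
      else null_measure (restrict_space borel D))"

definition lebesgue_density_measure :: "complex set \<Rightarrow> (complex \<Rightarrow> real) \<Rightarrow> complex measure" where
  "lebesgue_density_measure D \<rho> = density (restrict_space lborel D) (\<lambda>z. ennreal (\<rho> z))"

section \<open>The three random analytic functions\<close>

text \<open>
  The argument \<open>x\<close> is a realisation of the sequence of random coefficients. The real powers have
  nonnegative bases in the ranges of summation used.
\<close>

definition elliptic_fun :: "real \<Rightarrow> nat \<Rightarrow> (nat \<Rightarrow> complex) \<Rightarrow> complex \<Rightarrow> complex" where
  "elliptic_fun \<alpha> n x z =
     (\<Sum>k\<le>n. x k * of_real (((\<Prod>i<k. real n - real i) / fact k) powr \<alpha>) * z ^ k)"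

definition flat_fun :: "real \<Rightarrow> nat \<Rightarrow> (nat \<Rightarrow> complex) \<Rightarrow> complex \<Rightarrow> complex" where
  "flat_fun \<alpha> n x z = (\<Sum>k. x k * of_real ((real n ^ k / fact k) powr \<alpha>) * z ^ k)"

definition hyperbolic_fun :: "real \<Rightarrow> nat \<Rightarrow> (nat \<Rightarrow> complex) \<Rightarrow> complex \<Rightarrow> complex" where
  "hyperbolic_fun \<alpha> n x z =
     (\<Sum>k. x k * of_real (((\<Prod>i<k. real n + real i) / fact k) powr \<alpha>) * z ^ k)"

section \<open>The limiting densities\<close>

definition elliptic_density :: "real \<Rightarrow> complex \<Rightarrow> real" where
  "elliptic_density \<alpha> z =
     1 / (2 * pi * \<alpha>) * norm z powr (1 / \<alpha> - 2) / (1 + norm z powr (1 / \<alpha>)) ^ 2"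

definition flat_density :: "real \<Rightarrow> complex \<Rightarrow> real" where
  "flat_density \<alpha> z = 1 / (2 * pi * \<alpha>) * norm z powr (1 / \<alpha> - 2)"

definition hyperbolic_density :: "real \<Rightarrow> complex \<Rightarrow> real" where
  "hyperbolic_density \<alpha> z =
     1 / (2 * pi * \<alpha>) * norm z powr (1 / \<alpha> - 2) / (1 - norm z powr (1 / \<alpha>)) ^ 2"

end

theory Submission
  imports Defs "HOL-Real_Asymp.Real_Asymp"
begin

text \<open>
  Write \<open>b n k\<close> for the product quotient under the power \<open>\<alpha>\<close>. In all three cases
  \<open>\<Sum>k. b n k * s ^ k = exp (n * L s)\<close> with \<open>L s = - ln (1 - \<sigma> * s) / \<sigma>\<close> for \<open>\<sigma> = -1, 0, 1\<close>
  (\<open>L s = s\<close> for \<open>\<sigma> = 0\<close>), and \<open>ln \<bar>F n\<bar> / n\<close> converges locally in \<open>L\<^sup>1\<close> and in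
  probability to the radial function \<open>P z = \<alpha> * L (\<bar>z\<bar> powr (1 / \<alpha>))\<close>.

  The upper bound is uniform on compact sets and follows from \<open>\<bar>\<xi> k\<bar> \<le> C * exp (\<epsilon> * k)\<close>
  (Borel-Cantelli). A lower bound at a single point \<open>z\<close> is enough, because \<open>ln \<bar>F n\<bar>\<close> is
  subharmonic: together with the upper bound it makes the mean of \<open>P - ln \<bar>F n\<bar> / n\<close> over a small
  disc around \<open>z\<close> small, and finitely many discs cover a compact set. At a fixed \<open>z\<close> one finds, for
  every \<open>N\<close>, \<open>N\<close> terms of the series that are not much smaller than \<open>exp (n * P z)\<close> and whose sizes
  differ pairwise by exponential factors. If the whole sum is tiny, then each of the corresponding
  \<open>\<xi> k\<close>, taken in the order of decreasing size, lies in a small disc determined by the previous ones,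
  which has probability at most \<open>q ^ N\<close> for some \<open>q < 1\<close>.

  Convergence of potentials gives convergence of zeros through Jensen's formula: the mean of
  \<open>ln \<bar>z - a\<bar>\<close> over the circle of radius \<open>r\<close> around \<open>w\<close> is \<open>ln (max r \<bar>w - a\<bar>)\<close>, so the difference
  of the means over two circles is a continuous compactly supported function of \<open>a\<close>. Convolutions
  with these functions approximate every test function; no Laplacian is needed.
\<close>

section \<open>Circle means of logarithmic potentials\<close>

text \<open>Only a logarithmic moment and nondegeneracy are available: no density, no variance, no
  asymptotics of single coefficients. Hence the lower bound holds in probability and at fixed points
  only, with an arbitrarily small \<open>q ^ N\<close> in place of a rate, and everything uniform
  must come from subharmonicity. In the difference of two circle means the far field cancels, which
  leaves a nonnegative bump of radius \<open>s\<close>; divided by its mass it is an approximate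
  identity. Its error is multiplied by the number of zeros per \<open>n\<close>, which is not known
  beforehand and is first bounded by testing with a fixed cut-off. The limit measure is matched
  without derivatives in the plane: rotation invariance makes its potential equal to
  \<open>P\<close> up to a constant, and differences of circle means ignore constants. Since the
  notion of convergence includes measurability for every \<open>n\<close>, realisations with
  divergent series or constant functions have to be covered as well; the values that HOL gives to
  divergent sums and to \<open>ln 0\<close> enter there.\<close>

lemma nn_integral_lborel_shift:
  fixes c :: complex
  assumes [measurable]: "f \<in> borel_measurable borel"
  shows "(\<integral>\<^sup>+x. f (c + x) \<partial>lborel) = (\<integral>\<^sup>+x. f x \<partial>lborel)"
  by (subst (2) lborel_distr_plus[of c, symmetric], subst nn_integral_distr) auto

lemma nn_integral_lborel_shift_diff:
  fixes c :: complex
  assumes "f \<in> borel_measurable borel"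
  shows "(\<integral>\<^sup>+x. f (x - c) \<partial>lborel) = (\<integral>\<^sup>+x. f x \<partial>lborel)"
  using nn_integral_lborel_shift[OF assms, of "-c"] by simp

text \<open>
  Integrating the product of the indicators of \<open>c * x \<in> A\<close> and \<open>\<bar>y - c * x\<bar> \<le> 1\<close> in both orders
  compares the rotated measure with Lebesgue measure, since the unit disc is rotation invariant.
\<close>

lemma lborel_distr_rotation:
  fixes c :: complex
  assumes c: "norm c = 1"
  shows "distr lborel borel ((*) c) = lborel"
proof (rule measure_eqI)
  fix A assume "A \<in> sets (distr lborel borel ((*) c))"
  then have A[measurable]: "A \<in> sets borel" by simp
  let ?g = "indicator (cball 0 1) :: complex \<Rightarrow> ennreal"
  let ?A = "indicator A :: complex \<Rightarrow> ennreal"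
  have [measurable]: "(*) c \<in> borel_measurable borel" by simp
  have [measurable]: "cball 0 1 \<in> sets (borel :: complex measure)" by (simp add: borel_closed)
  have c0: "c \<noteq> 0" using c by auto
  have B: "emeasure lborel (cball (0::complex) 1) = ennreal pi"
    by (simp add: emeasure_cball unit_ball_vol_2)
  have "(\<integral>\<^sup>+x. ?A (c*x) \<partial>lborel) * emeasure lborel (cball (0::complex) 1)
      = (\<integral>\<^sup>+x. ?A (c*x) * (\<integral>\<^sup>+y. ?g (y - c*x) \<partial>lborel) \<partial>lborel)"
    by (subst nn_integral_lborel_shift_diff) (auto simp: nn_integral_multc)
  also have "\<dots> = (\<integral>\<^sup>+x. (\<integral>\<^sup>+y. ?A (c*x) * ?g (y - c*x) \<partial>lborel) \<partial>lborel)"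
    by (intro nn_integral_cong nn_integral_cmult[symmetric]) auto
  also have "\<dots> = (\<integral>\<^sup>+y. (\<integral>\<^sup>+x. ?A (c*x) * ?g (y - c*x) \<partial>lborel) \<partial>lborel)"
    by (rule lborel_pair.Fubini'[symmetric]) measurable
  also have "\<dots> = (\<integral>\<^sup>+y. (\<integral>\<^sup>+x. ?A (y + c*x) * ?g x \<partial>lborel) \<partial>lborel)"
  proof (rule nn_integral_cong)
    \<comment> \<open>Translation by \<open>y / c\<close> turns \<open>c * x\<close> into
      \<open>y + c * x\<close>; the remaining disc indicator depends only on
      \<open>norm (c * x) = norm x\<close>.\<close>
    fix y :: complex
    have "(\<integral>\<^sup>+x. ?A (c*x) * ?g (y - c*x) \<partial>lborel) =
      (\<integral>\<^sup>+x. ?A (c*(y/c + x)) * ?g (y - c*(y/c + x)) \<partial>lborel)"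
      by (rule nn_integral_lborel_shift[symmetric]) measurable
    also have "\<dots> = (\<integral>\<^sup>+x. ?A (y + c*x) * ?g x \<partial>lborel)"
      using c c0 by (intro nn_integral_cong) (auto simp: algebra_simps norm_mult indicator_def)
    finally show "(\<integral>\<^sup>+x. ?A (c*x) * ?g (y - c*x) \<partial>lborel) = (\<integral>\<^sup>+x. ?A (y + c*x) * ?g x \<partial>lborel)" .
  qed
  also have "\<dots> = (\<integral>\<^sup>+x. (\<integral>\<^sup>+y. ?A (y + c*x) * ?g x \<partial>lborel) \<partial>lborel)"
    by (rule lborel_pair.Fubini') measurable
  also have "\<dots> = (\<integral>\<^sup>+x. (\<integral>\<^sup>+y. ?A (c*x + y) \<partial>lborel) * ?g x \<partial>lborel)"
    by (intro nn_integral_cong) (simp add: nn_integral_multc add.commute)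
  also have "\<dots> = emeasure lborel A * emeasure lborel (cball (0::complex) 1)"
    by (subst nn_integral_lborel_shift) (auto simp: nn_integral_cmult)
  \<comment> \<open>The disc has area \<open>pi\<close>, finite and nonzero, so the factor
    cancels.\<close>
  finally have "(\<integral>\<^sup>+x. ?A (c*x) \<partial>lborel) = emeasure lborel A"
    unfolding B using ennreal_mult_divide_eq[of "ennreal pi"] by (metis ennreal_eq_0_iff ennreal_neq_top linorder_not_less pi_gt_zero)
  moreover have "emeasure (distr lborel borel ((*) c)) A = (\<integral>\<^sup>+x. ?A (c*x) \<partial>lborel)"
    by (subst nn_integral_indicator[symmetric], simp, subst nn_integral_distr) auto
  ultimately show "emeasure (distr lborel borel ((*) c)) A = emeasure lborel A" by simp
qed simp

section \<open>Radial integrals over the plane\<close>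

lemma distr_lborel_norm:
  "distr lborel borel (norm :: complex \<Rightarrow> real) =
   density lborel (\<lambda>t. ennreal (2 * pi * t) * indicator {0..} t)" (is "?M = ?N")
proof (rule measure_eqI_generator_eq[where E="range atMost" and \<Omega>=UNIV and A="\<lambda>i. {..real i}"])
  show "Int_stable (range (atMost :: real \<Rightarrow> real set))" by (auto simp: Int_stable_def)
  show "sets ?M = sigma_sets UNIV (range atMost)" "sets ?N = sigma_sets UNIV (range atMost)"
    by (simp_all add: borel_eq_atMost)
  show "(\<Union>i. {..real i}) = UNIV" using real_arch_simple by auto
  have vim: "norm -` {..a} = cball (0::complex) a" for a by auto
  have eM: "emeasure ?M {..a} = (if a \<ge> 0 then ennreal (pi * a\<^sup>2) else 0)" for a
    by (subst emeasure_distr) (auto simp: vim emeasure_cball unit_ball_vol_2)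
  show "emeasure ?M {..real i} \<noteq> \<infinity>" for i by (simp add: eM)
  \<comment> \<open>On the half-lines \<open>{..a}\<close> the area of a disc is compared with the
    primitive \<open>pi * t\<^sup>2\<close>; both sides are 0 for \<open>a < 0\<close>.\<close>
  fix X assume "X \<in> range (atMost :: real \<Rightarrow> real set)"
  then obtain a where X: "X = {..a}" by auto
  have "emeasure ?N {..a} = (\<integral>\<^sup>+t. ennreal (2 * pi * t) * indicator {0..a} t \<partial>lborel)"
    by (subst emeasure_density) (auto intro!: nn_integral_cong simp: indicator_def)
  also have "\<dots> = (if a \<ge> 0 then ennreal (pi * a\<^sup>2) else 0)"
  proof (cases "a \<ge> 0")
    case True
    have "(\<integral>\<^sup>+t. ennreal (2 * pi * t) * indicator {0..a} t \<partial>lborel) = ennreal (pi * a\<^sup>2 - pi * 0\<^sup>2)"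
      using True by (intro nn_integral_FTC_Icc) (auto intro!: derivative_eq_intros)
    then show ?thesis using True by simp
  qed auto
  finally show "emeasure ?M X = emeasure ?N X" by (simp add: X eM)
qed auto

lemma nn_integral_lborel_norm:
  fixes f :: "real \<Rightarrow> ennreal"
  assumes [measurable]: "f \<in> borel_measurable borel"
  shows "(\<integral>\<^sup>+z. f (norm (z::complex)) \<partial>lborel) = (\<integral>\<^sup>+t. ennreal (2 * pi * t) * indicator {0..} t * f t \<partial>lborel)"
proof -
  have "(\<integral>\<^sup>+z. f (norm (z::complex)) \<partial>lborel) = (\<integral>\<^sup>+t. f t \<partial>distr lborel borel (norm :: complex \<Rightarrow> real))"
    by (subst nn_integral_distr) auto
  then show ?thesis unfolding distr_lborel_norm by (simp add: nn_integral_density)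
qed

lemma
  fixes f :: "real \<Rightarrow> real"
  assumes [measurable]: "f \<in> borel_measurable borel"
  shows integral_lborel_norm: "(\<integral>z. f (norm (z::complex)) \<partial>lborel) = (\<integral>t. 2 * pi * t * indicator {0..} t * f t \<partial>lborel)"
    and integrable_lborel_norm: "integrable lborel (\<lambda>z::complex. f (norm z)) \<longleftrightarrow> integrable lborel (\<lambda>t. 2 * pi * t * indicator {0..} t * f t)"
proof -
  have *: "density lborel (\<lambda>t. ennreal (2 * pi * t) * indicator {0..} t) = density lborel (\<lambda>t. ennreal (2 * pi * t * indicator {0..} t))"
    by (intro density_cong) (auto simp: indicator_def)
  have "(\<integral>z. f (norm (z::complex)) \<partial>lborel) = (\<integral>t. f t \<partial>distr lborel borel (norm :: complex \<Rightarrow> real))"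
    by (subst integral_distr) auto
  then show "(\<integral>z. f (norm (z::complex)) \<partial>lborel) = (\<integral>t. 2 * pi * t * indicator {0..} t * f t \<partial>lborel)"
    unfolding distr_lborel_norm * by (subst (asm) integral_density) (auto simp: indicator_def)
  have "integrable lborel (\<lambda>z::complex. f (norm z)) \<longleftrightarrow> integrable (distr lborel borel (norm :: complex \<Rightarrow> real)) f"
    by (subst integrable_distr_eq) auto
  then show "integrable lborel (\<lambda>z::complex. f (norm z)) \<longleftrightarrow> integrable lborel (\<lambda>t. 2 * pi * t * indicator {0..} t * f t)"
    unfolding distr_lborel_norm * by (subst (asm) integrable_density) (auto simp: indicator_def)
qed

text \<open>Circles are parametrised by \<open>[0, 1]\<close> as in \<^const>\<open>circlepath\<close>.\<close>

definition circ :: "real measure" where "circ = density lborel (\<lambda>t. ennreal (indicator {0..1} t))"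

definition turn :: "real \<Rightarrow> complex" where "turn t = cis (2 * pi * t)"

lemma norm_turn [simp]: "norm (turn t) = 1" by (simp add: turn_def)
lemma turn_nonzero [simp]: "turn t \<noteq> 0" by (simp add: turn_def)
lemma continuous_turn [continuous_intros]: "continuous_on S f \<Longrightarrow> continuous_on S (\<lambda>x. turn (f x))"
  unfolding turn_def by (intro continuous_intros)
lemma measurable_turn [measurable]: "turn \<in> borel_measurable borel"
  by (intro borel_measurable_continuous_onI continuous_intros)
lemma sets_circ [measurable_cong, simp]: "sets circ = sets borel" by (simp add: circ_def)
lemma space_circ [simp]: "space circ = UNIV" by (simp add: circ_def)
lemma prob_space_circ: "prob_space circ"
  by (rule prob_spaceI) (simp add: circ_def emeasure_density ennreal_indicator)

interpretation circ: prob_space circ by (rule prob_space_circ)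
lemma prob_circ_UNIV [simp]: "measure circ UNIV = 1"
  using circ.prob_space by simp

interpretation circ_lborel: pair_sigma_finite circ "lborel :: complex measure" ..

text \<open>Connects \<open>circ\<close>, where Fubini is available, with the gauge integral in
  which Cauchy's formula is stated.\<close>

lemma has_integral_circ:
  fixes f :: "real \<Rightarrow> 'b::euclidean_space"
  assumes f: "continuous_on {0..1} f" and [measurable]: "f \<in> borel_measurable borel"
  shows "(f has_integral (\<integral>t. f t \<partial>circ)) {0..1}"
proof -
  have i: "set_integrable lborel {0..1} f"
    using borel_integrable_compact[OF compact_Icc f] unfolding set_integrable_def by (auto simp: mult.commute)
  have "(\<integral>t. f t \<partial>circ) = (\<integral>t. f t \<partial>density lborel (\<lambda>t. ennreal (indicator {0..1} t)))"
    by (simp add: circ_def)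
  also have "\<dots> = set_lebesgue_integral lborel {0..1} f"
    unfolding set_lebesgue_integral_def by (rule integral_density) auto
  finally show ?thesis
    using set_borel_integral_eq_integral[OF i] by (simp add: has_integral_integral)
qed

lemma integrable_circ:
  fixes f :: "real \<Rightarrow> 'b::euclidean_space"
  assumes f: "continuous_on {0..1} f" and [measurable]: "f \<in> borel_measurable borel"
  shows "integrable circ f"
proof -
  have i: "set_integrable lborel {0..1} f"
    using borel_integrable_compact[OF compact_Icc f] unfolding set_integrable_def by (auto simp: mult.commute)
  have "integrable (density lborel (\<lambda>t. ennreal (indicator {0..1} t))) f"
    using i unfolding set_integrable_def by (subst integrable_density) auto
  then show ?thesis by (simp add: circ_def)
qed

lemma mean_value_holomorphic:
  fixes r R :: real
  assumes l: "l holomorphic_on ball w R" and r: "0 \<le> r" "r < R"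
  shows "integrable circ (\<lambda>t. l (w + r * turn t))" "(\<integral>t. l (w + r * turn t) \<partial>circ) = l w"
proof -
  have sub: "w + r * turn t \<in> ball w R" for t
    using r by (simp add: dist_norm norm_mult)
  have lc: "continuous_on (ball w R) l" using l holomorphic_on_imp_continuous_on by blast
  have c: "continuous_on UNIV (\<lambda>t. l (w + r * turn t))"
    by (rule continuous_on_compose2[OF lc]) (use sub in \<open>auto intro!: continuous_intros\<close>)
  then have [measurable]: "(\<lambda>t. l (w + r * turn t)) \<in> borel_measurable borel"
    by (rule borel_measurable_continuous_onI)
  have c1: "continuous_on {0..1} (\<lambda>t. l (w + r * turn t))" using c continuous_on_subset by blast
  show "integrable circ (\<lambda>t. l (w + r * turn t))" by (rule integrable_circ[OF c1]) simp
  show "(\<integral>t. l (w + r * turn t) \<partial>circ) = l w"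
  proof (cases "r = 0")
    case True then show ?thesis by simp
  next
    case False
    with r have r0: "r > 0" by simp
    have "((\<lambda>u. l u / (u - w)) has_contour_integral (2 * of_real pi * \<i> * l w)) (circlepath w r)"
      using r r0 by (intro Cauchy_integral_circlepath)
        (auto intro!: continuous_on_subset[OF lc] holomorphic_on_subset[OF l])
    \<comment> \<open>On the circle the derivative is \<open>2 * pi * \<i>\<close> times
      \<open>circlepath w r x - w\<close>, so the Cauchy kernel cancels and a plain mean
      remains.\<close>
    then have "((\<lambda>t. 2 * of_real pi * \<i> * l (w + r * turn t)) has_integral (2 * of_real pi * \<i> * l w)) {0..1}"
      unfolding has_contour_integral_def
    proof (rule has_integral_eq[rotated])
      fix x :: real assume x: "x \<in> {0..1}"
      have c: "circlepath w r x = w + r * turn x" by (simp add: circlepath turn_def cis_conv_exp mult_ac)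
      have d: "vector_derivative (circlepath w r) (at x within {0..1}) = 2 * pi * \<i> * r * turn x"
        using x by (simp add: vector_derivative_circlepath01 turn_def cis_conv_exp mult_ac)
      show "l (circlepath w r x) / (circlepath w r x - w) * vector_derivative (circlepath w r) (at x within {0..1})
         = 2 * of_real pi * \<i> * l (w + r * turn x)"
        unfolding c d using r0 by simp
    qed
    moreover have "((\<lambda>t. 2 * of_real pi * \<i> * l (w + r * turn t)) has_integral (2 * of_real pi * \<i> * (\<integral>t. l (w + r * turn t) \<partial>circ))) {0..1}"
      by (intro has_integral_mult_right has_integral_circ[OF c1]) simp
    ultimately have "2 * of_real pi * \<i> * l w = 2 * of_real pi * \<i> * (\<integral>t. l (w + r * turn t) \<partial>circ)"
      by (rule has_integral_unique)
    then show ?thesis by simp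
  qed
qed

text \<open>On a ball a zero-free \<open>g\<close> has a holomorphic logarithm; the claim is the
  real part of its mean value identity.\<close>

lemma mean_value_ln_holomorphic:
  fixes r R :: real
  assumes g: "g holomorphic_on ball w R" "\<And>z. z \<in> ball w R \<Longrightarrow> g z \<noteq> 0" and r: "0 \<le> r" "r < R"
  shows "integrable circ (\<lambda>t. ln (norm (g (w + r * turn t))))"
    "(\<integral>t. ln (norm (g (w + r * turn t))) \<partial>circ) = ln (norm (g w))"
proof -
  obtain l where l: "l holomorphic_on ball w R" and gl: "\<And>z. z \<in> ball w R \<Longrightarrow> g z = exp (l z)"
    using contractible_imp_holomorphic_log[OF g(1) convex_imp_contractible[OF convex_ball] g(2)] by metis
  have sub: "w + r * turn t \<in> ball w R" for t
    using r by (simp add: dist_norm norm_mult)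
  have eq: "ln (norm (g z)) = Re (l z)" if "z \<in> ball w R" for z
    using gl[OF that] by simp
  note m = mean_value_holomorphic[OF l r]
  show "integrable circ (\<lambda>t. ln (norm (g (w + r * turn t))))"
    using m(1) by (simp add: eq[OF sub])
  show "(\<integral>t. ln (norm (g (w + r * turn t))) \<partial>circ) = ln (norm (g w))"
    using m(2) eq[of w] r by (simp add: eq[OF sub] integral_Re[OF m(1)])
qed

text \<open>For \<open>a\<close> outside the circle, \<open>z - a\<close> is zero-free on a ball
  containing the circle. For \<open>a\<close> inside, conjugation moves the singularity across the
  circle. The excluded case of \<open>a\<close> on the circle concerns only a null set of
  centres.\<close>

lemma mean_value_ln_dist:
  fixes w a :: complex and r :: real
  assumes r: "0 \<le> r" and ne: "norm (w - a) \<noteq> r"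
  shows "integrable circ (\<lambda>t. ln (norm (w + r * turn t - a)))"
    "(\<integral>t. ln (norm (w + r * turn t - a)) \<partial>circ) = ln (max r (norm (w - a)))"
proof -
  have "integrable circ (\<lambda>t. ln (norm (w + r * turn t - a))) \<and>
    (\<integral>t. ln (norm (w + r * turn t - a)) \<partial>circ) = ln (max r (norm (w - a)))"
  proof (cases "r < norm (w - a)")
    case True
    have H: "(\<lambda>z. z - a) holomorphic_on ball w (norm (w - a))" "\<And>z. z \<in> ball w (norm (w - a)) \<Longrightarrow> z - a \<noteq> 0"
      by (auto intro!: holomorphic_intros simp: dist_norm)
    have "integrable circ (\<lambda>t. ln (norm ((\<lambda>z. z - a) (w + r * turn t))))"
      "(\<integral>t. ln (norm ((\<lambda>z. z - a) (w + r * turn t))) \<partial>circ) = ln (norm (w - a))"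
      using mean_value_ln_holomorphic[OF H(1) H(2) r True] by simp_all
    then show ?thesis using True by (simp add: max_def)
  next
    case False
    \<comment> \<open>Conjugation and multiplication by \<open>turn t\<close> preserve the modulus
      and give \<open>r + b * turn t\<close>. This is zero-free on a disc of radius
      \<open>R > 1\<close> because \<open>norm b < r\<close>, and its value at the centre is
      \<open>r\<close>.\<close>
    define b where "b = cnj (w - a)"
    have b: "norm b < r" using False ne by (auto simp: b_def norm_minus_commute simp flip: complex_cnj_diff)
    have eq: "norm (w + r * turn t - a) = norm (r + b * turn t)" for t
    proof -
      have "norm (w + r * turn t - a) = norm (turn t * cnj (w + r * turn t - a))"
        by (simp only: norm_mult complex_mod_cnj norm_turn mult_1)
      also have "turn t * cnj (w + r * turn t - a) = r + b * turn t"
        by (simp add: algebra_simps turn_def cis_cnj cis_mult b_def)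
      finally show ?thesis .
    qed
    obtain R where R: "R > 1" "norm b * R < r"
    proof (cases "b = 0")
      case True then show ?thesis using that[of 2] b by auto
    next
      case False
      then have "1 < r / norm b" using b by simp
      then obtain R where "1 < R" "R < r / norm b" using dense by blast
      then show ?thesis using that[of R] False by (simp add: field_simps)
    qed
    have nz: "of_real r + b * z \<noteq> 0" if "z \<in> ball 0 R" for z
    proof
      assume "of_real r + b * z = 0"
      then have "b * z = - of_real r" by (simp add: add_eq_0_iff)
      then have "norm (b * z) = r" using r by simp
      moreover have "norm b * norm z \<le> norm b * R" using that by (intro mult_left_mono) auto
      ultimately show False using R by (simp add: norm_mult)
    qed
    have "integrable circ (\<lambda>t. ln (norm ((\<lambda>z. of_real r + b * z) (0 + of_real 1 * turn t))))"
      "(\<integral>t. ln (norm ((\<lambda>z. of_real r + b * z) (0 + of_real 1 * turn t))) \<partial>circ) = ln (norm (of_real r + b * 0))"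
      using mean_value_ln_holomorphic[of "\<lambda>z. of_real r + b * z" 0 R 1, OF _ nz] R(1)
      by (simp_all add: holomorphic_intros)
    then show ?thesis unfolding eq using False r by (simp add: max_def)
  qed
  then show "integrable circ (\<lambda>t. ln (norm (w + r * turn t - a)))"
    "(\<integral>t. ln (norm (w + r * turn t - a)) \<partial>circ) = ln (max r (norm (w - a)))" by auto
qed

text \<open>The weight \<open>t\<close> of polar coordinates tames the logarithm at 0. The bound is
  crude; only its finiteness on bounded ranges matters.\<close>

lemma ln_times_bound:
  fixes t :: real assumes "0 \<le> t" "t \<le> R" shows "\<bar>t * ln t\<bar> \<le> 1 + R\<^sup>2"
proof (cases "t = 0")
  case True then show ?thesis by simp
next
  case False
  then have t: "t > 0" using assms by simp
  show ?thesis
  proof (cases "t \<ge> 1")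
    case True
    have "t * ln t \<le> t * t" using ln_le_minus_one[OF t] t by (intro mult_left_mono) auto
    also have "\<dots> \<le> R * R" using assms True by (intro mult_mono) auto
    finally show ?thesis using True t by (simp add: power2_eq_square)
  next
    case False
    have "ln (1/t) \<le> 1/t" using ln_le_minus_one[of "1/t"] t by simp
    then have "t * ln (1/t) \<le> t * (1/t)" using t by (intro mult_left_mono) auto
    then have "- (t * ln t) \<le> 1" using t by (simp add: ln_div)
    moreover have "t * ln t \<le> 0" using False t by (simp add: mult_nonneg_nonpos)
    ultimately show ?thesis by (smt (verit) zero_le_power2)
  qed
qed

text \<open>Translating the pole to 0 enlarges the disc to radius \<open>2 * R\<close>. The bound
  does not depend on \<open>a\<close>, as Fubini over a whole mass distribution requires
  later.\<close>

lemma nn_integral_ln_norm_ball: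
  fixes a :: complex
  assumes "norm a \<le> R" 
  shows "(\<integral>\<^sup>+z. ennreal \<bar>ln (norm (z - a))\<bar> * indicator (cball 0 R) z \<partial>lborel) \<le> ennreal (2 * pi * (1 + (2 * R)\<^sup>2) * (2 * R))"
proof -
  have R: "R \<ge> 0" using assms norm_ge_zero order_trans by blast
  have "(\<integral>\<^sup>+z. ennreal \<bar>ln (norm (z - a))\<bar> * indicator (cball 0 R) z \<partial>lborel)
     \<le> (\<integral>\<^sup>+z. ennreal \<bar>ln (norm (z - a))\<bar> * indicator {..2*R} (norm (z - a)) \<partial>lborel)"
  proof (intro nn_integral_mono)
    fix z :: complex
    have "norm z \<le> R \<Longrightarrow> norm (z - a) \<le> 2 * R" using norm_triangle_ineq4[of z a] assms by linarith
    then show "ennreal \<bar>ln (norm (z - a))\<bar> * indicator (cball 0 R) z \<le> ennreal \<bar>ln (norm (z - a))\<bar> * indicator {..2*R} (norm (z - a))"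
      by (auto simp: indicator_def)
  qed
  also have "\<dots> = (\<integral>\<^sup>+z. ennreal \<bar>ln (norm (z::complex))\<bar> * indicator {..2*R} (norm z) \<partial>lborel)"
    by (rule nn_integral_lborel_shift_diff) measurable
  also have "\<dots> = (\<integral>\<^sup>+t. ennreal (2 * pi * t) * indicator {0..} t * (ennreal \<bar>ln t\<bar> * indicator {..2*R} t) \<partial>lborel)"
    by (subst nn_integral_lborel_norm[where f="\<lambda>t. ennreal \<bar>ln t\<bar> * indicator {..2*R} t"]) auto
  also have "\<dots> \<le> (\<integral>\<^sup>+t. ennreal (2 * pi * (1 + (2 * R)\<^sup>2)) * indicator {0..2*R} t \<partial>lborel)"
  proof (intro nn_integral_mono)
    fix t :: real
    have "2 * pi * \<bar>t * ln t\<bar> \<le> 2 * pi * (1 + (2 * R)\<^sup>2)" if "0 \<le> t" "t \<le> 2 * R"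
      using ln_times_bound[OF that] by (intro mult_left_mono) auto
    then show "ennreal (2 * pi * t) * indicator {0..} t * (ennreal \<bar>ln t\<bar> * indicator {..2*R} t) \<le> ennreal (2 * pi * (1 + (2 * R)\<^sup>2)) * indicator {0..2*R} t"
      by (auto simp: indicator_def ennreal_mult'[symmetric] abs_mult mult_ac)
  qed
  also have "\<dots> = ennreal (2 * pi * (1 + (2 * R)\<^sup>2) * (2 * R))"
    using R by (simp add: nn_integral_cmult ennreal_mult'[symmetric])
  finally show ?thesis .
qed

section \<open>Compactly supported functions and circle averages\<close>

definition supported_in :: "real \<Rightarrow> (complex \<Rightarrow> real) \<Rightarrow> bool" where
  "supported_in \<rho> \<phi> \<longleftrightarrow> continuous_on UNIV \<phi> \<and> (\<forall>z. norm z > \<rho> \<longrightarrow> \<phi> z = 0)"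

lemma supported_in_bounded:
  assumes "supported_in \<rho> \<phi>" obtains B where "B > 0" "\<And>z. \<bar>\<phi> z\<bar> \<le> B"
proof -
  have "compact (\<phi> ` cball 0 \<rho>)"
    using assms by (intro compact_continuous_image) (auto simp: supported_in_def intro: continuous_on_subset)
  then obtain b where b: "b > 0" "\<And>z. z \<in> cball 0 \<rho> \<Longrightarrow> \<bar>\<phi> z\<bar> \<le> b"
    using compact_imp_bounded[of "\<phi> ` cball 0 \<rho>"] unfolding bounded_pos by auto
  have "\<bar>\<phi> z\<bar> \<le> b" for z
    using b assms by (cases "norm z \<le> \<rho>") (auto simp: supported_in_def)
  with b that show thesis by blast
qed

lemma supported_in_measurable: "supported_in \<rho> \<phi> \<Longrightarrow> \<phi> \<in> borel_measurable borel"
  by (auto simp: supported_in_def intro: borel_measurable_continuous_onI)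

lemma cball_borel [measurable]: "cball (a::complex) r \<in> sets borel" by (simp add: borel_closed)
lemma ball_borel [measurable]: "ball (a::complex) r \<in> sets borel" by simp

lemma lborel_integral_shift:
  fixes f :: "complex \<Rightarrow> real"
  shows "(\<integral>x. f (c + x) \<partial>lborel) = (\<integral>x. f x \<partial>lborel)"
proof (cases "f \<in> borel_measurable borel")
  case True
  then show ?thesis by (subst (2) lborel_distr_plus[of c, symmetric], subst integral_distr) auto
next
  \<comment> \<open>Translation preserves non-measurability, and then both integrals are 0.\<close>
  case False
  have "(\<lambda>x. f (c + x)) \<notin> borel_measurable borel"
  proof
    assume "(\<lambda>x. f (c + x)) \<in> borel_measurable borel"
    then have "(\<lambda>x. f (c + (x - c))) \<in> borel_measurable borel" by measurable
    with False show False by simp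
  qed
  with False show ?thesis by (simp add: not_integrable_integral_eq borel_measurable_integrable[of lborel, simplified] integrable_iff_bounded)
qed

text \<open>Averaging over circles is self-adjoint: both sides are the double integral of
  \<open>u z * \<phi> w\<close> over pairs with \<open>z = w + r * turn t\<close>. Only values of
  \<open>u\<close> on \<open>cball 0 R\<close> are involved, so local integrability is
  enough.\<close>

lemma circle_average_Fubini:
  fixes u \<phi> :: "complex \<Rightarrow> real" and r :: real
  assumes u[measurable]: "u \<in> borel_measurable borel" and \<phi>: "supported_in \<rho> \<phi>" and r: "r \<ge> 0"
    and R: "\<rho> + r \<le> R" and i: "set_integrable lborel (cball 0 R) u"
  shows "integrable lborel (\<lambda>z. u z * (\<integral>t. \<phi> (z - r * turn t) \<partial>circ))"
    "(\<integral>z. u z * (\<integral>t. \<phi> (z - r * turn t) \<partial>circ) \<partial>lborel) = (\<integral>w. \<phi> w * (\<integral>t. u (w + r * turn t) \<partial>circ) \<partial>lborel)"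
proof -
  note [measurable] = supported_in_measurable[OF \<phi>]
  obtain B where B: "B > 0" "\<And>z. \<bar>\<phi> z\<bar> \<le> B" using supported_in_bounded[OF \<phi>] by blast
  let ?u = "\<lambda>z. norm (indicator (cball 0 R) z * u z)"
  have ui: "integrable lborel ?u"
    using i unfolding set_integrable_def by (intro integrable_norm) simp
  have bd: "norm (u z * \<phi> (z - r * turn t)) \<le> B * ?u z" for z t
  proof (cases "norm z \<le> R")
    case True
    then show ?thesis using B by (simp add: abs_mult mult.commute[of B] mult_left_mono)
  next
    case False
    have "norm z \<le> norm (z - r * turn t) + norm (r * turn t)" using norm_triangle_ineq[of "z - r * turn t" "r * turn t"] by simp
    then have "norm (z - r * turn t) > \<rho>" using False R r by (simp add: norm_mult)
    then show ?thesis using \<phi> B by (simp add: supported_in_def)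
  qed
  have int_z: "integrable lborel (\<lambda>z. u z * \<phi> (z - r * turn t))" for t
    using bd by (intro Bochner_Integration.integrable_bound[OF integrable_mult_right[OF ui, of B]]) (auto intro!: AE_I2 order_trans[OF _ abs_ge_self])
  have joint: "integrable (circ \<Otimes>\<^sub>M lborel) (\<lambda>(t, z). u z * \<phi> (z - r * turn t))"
  proof (rule circ_lborel.Fubini_integrable)
    have "norm (\<integral>z. norm (u z * \<phi> (z - r * turn t)) \<partial>lborel) \<le> (\<integral>z. B * ?u z \<partial>lborel)" for t
    proof -
      have "(\<integral>z. norm (u z * \<phi> (z - r * turn t)) \<partial>lborel) \<le> (\<integral>z. B * ?u z \<partial>lborel)"
        using bd by (intro integral_mono integrable_norm int_z integrable_mult_right ui) auto
      then show ?thesis by (subst real_norm_def, subst abs_of_nonneg) auto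
    qed
    then show "integrable circ (\<lambda>t. \<integral>z. norm (case (t, z) of (t, z) \<Rightarrow> u z * \<phi> (z - r * turn t)) \<partial>lborel)"
      by (intro circ.integrable_const_bound[where B="\<integral>z. B * ?u z \<partial>lborel"]) auto
  qed (use int_z in auto)
  have joint2: "integrable (circ \<Otimes>\<^sub>M lborel) (\<lambda>(t, w). u (w + r * turn t) * \<phi> w)"
  proof (rule circ_lborel.Fubini_integrable)
    have e: "(\<integral>w. norm (u (w + r * turn t) * \<phi> w) \<partial>lborel) = (\<integral>z. norm (u z * \<phi> (z - r * turn t)) \<partial>lborel)" for t
      using lborel_integral_shift[of "\<lambda>z. norm (u z * \<phi> (z - r * turn t))" "r * turn t"] by (simp add: add.commute)
    show "integrable circ (\<lambda>t. \<integral>w. norm (case (t, w) of (t, w) \<Rightarrow> u (w + r * turn t) * \<phi> w) \<partial>lborel)"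
      using circ_lborel.integrable_fst'[OF integrable_norm[OF joint]] e by (simp add: case_prod_beta')
    have "integrable (distr lborel borel ((+) (r * turn t))) (\<lambda>z. u z * \<phi> (z - r * turn t))" for t
      unfolding lborel_distr_plus by (rule int_z)
    then have "integrable lborel (\<lambda>w. u (w + r * turn t) * \<phi> w)" for t
      by (subst (asm) integrable_distr_eq) (auto simp: add.commute)
    then show "AE t in circ. integrable lborel (\<lambda>w. case (t, w) of (t, w) \<Rightarrow> u (w + r * turn t) * \<phi> w)" by auto
  qed measurable
  show "integrable lborel (\<lambda>z. u z * (\<integral>t. \<phi> (z - r * turn t) \<partial>circ))"
    using circ_lborel.integrable_snd[OF joint] by simp
  have "(\<integral>z. u z * (\<integral>t. \<phi> (z - r * turn t) \<partial>circ) \<partial>lborel) = (\<integral>z. (\<integral>t. u z * \<phi> (z - r * turn t) \<partial>circ) \<partial>lborel)" by simp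
  also have "\<dots> = (\<integral>t. (\<integral>z. u z * \<phi> (z - r * turn t) \<partial>lborel) \<partial>circ)"
    by (rule circ_lborel.Fubini_integral[OF joint])
  also have "\<dots> = (\<integral>t. (\<integral>w. u (w + r * turn t) * \<phi> w \<partial>lborel) \<partial>circ)"
    using lborel_integral_shift[of "\<lambda>z. u z * \<phi> (z - r * turn t)" "r * turn t" for t] by (simp add: add.commute)
  also have "\<dots> = (\<integral>w. (\<integral>t. u (w + r * turn t) * \<phi> w \<partial>circ) \<partial>lborel)"
    by (rule circ_lborel.Fubini_integral[OF joint2, symmetric])
  finally show "(\<integral>z. u z * (\<integral>t. \<phi> (z - r * turn t) \<partial>circ) \<partial>lborel) = (\<integral>w. \<phi> w * (\<integral>t. u (w + r * turn t) \<partial>circ) \<partial>lborel)"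
    by (simp add: mult.commute)
qed

text \<open>
  The difference of the logarithmic potentials of the uniform distributions on the circles of
  radii \<open>s\<close> and \<open>s / 2\<close>.
\<close>

definition annular_log :: "real \<Rightarrow> complex \<Rightarrow> real" where
  "annular_log s a = ln (max s (norm a)) - ln (max (s / 2) (norm a))"

text \<open>Divided by the mass of \<open>annular_log s\<close> this is an approximate identity
  applied to \<open>\<phi>\<close>, since the kernel is nonnegative and vanishes beyond distance
  \<open>s\<close>.\<close>

definition regularization :: "real \<Rightarrow> (complex \<Rightarrow> real) \<Rightarrow> complex \<Rightarrow> real" where
  "regularization s \<phi> a = (\<integral>w. \<phi> w * annular_log s (w - a) \<partial>lborel)"

text \<open>Formally, \<open>2 * pi\<close> times this is the Laplacian of
  \<open>regularization s \<phi>\<close>; yet it is a bounded function for every continuous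
  \<open>\<phi>\<close> of compact support.\<close>

definition circle_difference :: "real \<Rightarrow> (complex \<Rightarrow> real) \<Rightarrow> complex \<Rightarrow> real" where
  "circle_difference s \<phi> z = (\<integral>t. \<phi> (z - s * turn t) \<partial>circ) - (\<integral>t. \<phi> (z - (s / 2) * turn t) \<partial>circ)"

lemma circle_difference_eq_0:
  assumes "supported_in \<rho> \<phi>" "s > 0" "norm z > \<rho> + s"
  shows "circle_difference s \<phi> z = 0"
proof -
  have *: "\<phi> (z - r * turn t) = 0" if "0 \<le> r" "r \<le> s" for r t
  proof -
    have "norm z \<le> norm (z - r * turn t) + norm (r * turn t)" using norm_triangle_ineq[of "z - r * turn t" "r * turn t"] by simp
    then have "norm (z - r * turn t) > \<rho>" using assms that by (simp add: norm_mult)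
    then show ?thesis using assms by (auto simp: supported_in_def)
  qed
  show ?thesis using *[of s] *[of "s/2"] assms unfolding circle_difference_def by simp
qed

lemma circle_difference_bound:
  assumes "supported_in \<rho> \<phi>" "\<And>z. \<bar>\<phi> z\<bar> \<le> B"
  shows "\<bar>circle_difference s \<phi> z\<bar> \<le> 2 * B"
proof -
  note [measurable] = supported_in_measurable[OF assms(1)]
  have *: "\<bar>\<integral>t. \<phi> (z - r * turn t) \<partial>circ\<bar> \<le> B" for r :: real
  proof -
    have "norm (\<integral>t. \<phi> (z - r * turn t) \<partial>circ) \<le> (\<integral>t. B \<partial>circ)"
      using assms(2) order_trans[OF abs_ge_zero assms(2)[of 0]] by (intro Bochner_Integration.integral_norm_bound_integral circ.integrable_const_bound[where B=B]) auto
    then show ?thesis by simp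
  qed
  show ?thesis using *[of s] *[of "s/2"] unfolding circle_difference_def by simp
qed

lemma circle_difference_measurable [measurable]:
  assumes "supported_in \<rho> \<phi>" 
  shows "circle_difference s \<phi> \<in> borel_measurable borel"
proof -
  note [measurable] = supported_in_measurable[OF assms(1)]
  show ?thesis unfolding circle_difference_def by measurable
qed

text \<open>Discards the centres for which a zero lies on the circle, the case left out of
  \<open>mean_value_ln_dist\<close>.\<close>

lemma AE_norm_neq: "AE w in lborel. norm (w - a :: complex) \<noteq> r"
proof -
  have "sphere a r \<in> null_sets lebesgue" using negligible_sphere by (simp add: negligible_iff_null_sets)
  then have "sphere a r \<in> null_sets lborel" by (simp add: null_sets_completion_iff borel_closed)
  then show ?thesis by (rule AE_I') (auto simp: dist_norm norm_minus_commute)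
qed

lemma set_integrable_ln_dist:
  "set_integrable lborel (cball 0 R) (\<lambda>z::complex. ln (norm (z - a)))"
proof -
  \<comment> \<open>The radius is enlarged so that the pole lies in the disc, as the uniform bound
    demands.\<close>
  define R' where "R' = max R (norm a)"
  have "set_integrable lborel (cball 0 R') (\<lambda>z::complex. ln (norm (z - a)))"
    unfolding set_integrable_def
  proof (rule integrableI_bounded)
    have "(\<integral>\<^sup>+z. ennreal (norm (indicator (cball 0 R') z *\<^sub>R ln (norm (z - a)))) \<partial>lborel)
      = (\<integral>\<^sup>+z. ennreal \<bar>ln (norm (z - a))\<bar> * indicator (cball 0 R') z \<partial>lborel)"
      by (intro nn_integral_cong) (auto simp: indicator_def)
    also have "\<dots> < \<infinity>" using nn_integral_ln_norm_ball[of a R'] by (auto simp: R'_def less_top le_less_trans)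
    finally show "(\<integral>\<^sup>+z. ennreal (norm (indicator (cball 0 R') z *\<^sub>R ln (norm (z - a)))) \<partial>lborel) < \<infinity>" .
  qed measurable
  then show ?thesis by (rule set_integrable_subset) (auto simp: R'_def)
qed

text \<open>The weak Jensen formula for one zero: Fubini moves the two circle means onto the
  logarithm, where they become \<open>ln (max s (norm (w - a)))\<close> and the same with
  \<open>s / 2\<close>; their difference is the kernel \<open>annular_log\<close>.\<close>

lemma integral_ln_dist_circle_difference:
  assumes \<phi>: "supported_in \<rho> \<phi>" and s: "s > 0"
  shows "integrable lborel (\<lambda>z. ln (norm (z - a)) * circle_difference s \<phi> z)"
    "(\<integral>z. ln (norm (z - a)) * circle_difference s \<phi> z \<partial>lborel) = regularization s \<phi> a"
proof -
  note [measurable] = supported_in_measurable[OF \<phi>]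
  let ?u = "\<lambda>z::complex. ln (norm (z - a))"
  let ?A = "\<lambda>r z. \<integral>t. \<phi> (z - of_real r * turn t) \<partial>circ"
  let ?C = "\<lambda>r w. \<phi> w * (\<integral>t. ?u (w + of_real r * turn t) \<partial>circ)"
  have F: "integrable lborel (\<lambda>z. ?u z * ?A r z)" "(\<integral>z. ?u z * ?A r z \<partial>lborel) = (\<integral>w. ?C r w \<partial>lborel)" if "r \<ge> 0" for r
    using circle_average_Fubini[where u="?u" and \<rho>=\<rho> and r=r and R="\<rho>+r", OF _ \<phi> that _ set_integrable_ln_dist] by simp_all
  show "integrable lborel (\<lambda>z. ?u z * circle_difference s \<phi> z)"
    using F(1)[of s] F(1)[of "s/2"] s unfolding circle_difference_def right_diff_distrib by auto
  have C: "(\<integral>w. ?C r w \<partial>lborel) = (\<integral>w. \<phi> w * ln (max r (norm (w - a))) \<partial>lborel)" if "r \<ge> 0" for r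
    using AE_norm_neq[of a r] mean_value_ln_dist(2)[OF that, of _ a]
    by (intro integral_cong_AE) auto
  have I: "integrable lborel (\<lambda>w. \<phi> w * ln (max r (norm (w - a))))" if "r > 0" for r
  proof -
    have "integrable lborel (\<lambda>w. indicator (cball 0 \<rho>) w *\<^sub>R (\<phi> w * ln (max r (norm (w - a)))))"
      using that \<phi> unfolding supported_in_def
      by (intro borel_integrable_compact) (auto intro!: continuous_intros intro: continuous_on_subset)
    also have "(\<lambda>w. indicator (cball 0 \<rho>) w *\<^sub>R (\<phi> w * ln (max r (norm (w - a))))) = (\<lambda>w. \<phi> w * ln (max r (norm (w - a))))"
      using \<phi> by (auto simp: supported_in_def fun_eq_iff indicator_def)
    finally show ?thesis .
  qed
  have "(\<integral>z. ?u z * circle_difference s \<phi> z \<partial>lborel) = (\<integral>z. ?u z * ?A s z \<partial>lborel) - (\<integral>z. ?u z * ?A (s/2) z \<partial>lborel)"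
    using F(1)[of s] F(1)[of "s/2"] s unfolding circle_difference_def right_diff_distrib by (simp add: Bochner_Integration.integral_diff)
  also have "\<dots> = (\<integral>w. \<phi> w * ln (max s (norm (w - a))) \<partial>lborel) - (\<integral>w. \<phi> w * ln (max (s/2) (norm (w - a))) \<partial>lborel)"
    using F(2)[of s] F(2)[of "s/2"] C[of s] C[of "s/2"] s by simp
  also have "\<dots> = regularization s \<phi> a"
    using I[of s] I[of "s/2"] s unfolding regularization_def annular_log_def right_diff_distrib by (simp add: Bochner_Integration.integral_diff)
  finally show "(\<integral>z. ?u z * circle_difference s \<phi> z \<partial>lborel) = regularization s \<phi> a" .
qed

text \<open>Both circle means of \<open>ln (norm (g z))\<close> equal its value at the centre, so
  they cancel.\<close>

lemma integral_ln_nonvanishing_circle_difference: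
  assumes \<phi>: "supported_in \<rho> \<phi>" and s: "s > 0" and R: "\<rho> + s < R"
    and g: "g holomorphic_on ball 0 R" "\<And>z. z \<in> ball 0 R \<Longrightarrow> g z \<noteq> 0"
  shows "integrable lborel (\<lambda>z. ln (norm (g z)) * circle_difference s \<phi> z)"
    "(\<integral>z. ln (norm (g z)) * circle_difference s \<phi> z \<partial>lborel) = 0"
proof -
  note [measurable] = supported_in_measurable[OF \<phi>]
  \<comment> \<open>Truncation outside the ball makes the function Borel on the whole plane; the
    weight vanishes there anyway.\<close>
  define u where "u = (\<lambda>z. if z \<in> ball 0 R then ln (norm (g z)) else 0)"
  have cont: "continuous_on (ball 0 R) (\<lambda>z. ln (norm (g z)))"
    using g by (intro continuous_intros holomorphic_on_imp_continuous_on) auto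
  have [measurable]: "u \<in> borel_measurable borel"
    unfolding u_def by (rule borel_measurable_continuous_on_if[OF _ cont]) auto
  let ?A = "\<lambda>r z. \<integral>t. \<phi> (z - of_real r * turn t) \<partial>circ"
  have ui: "set_integrable lborel (cball 0 (\<rho>+s)) u"
  proof -
    have "set_integrable lborel (cball 0 (\<rho>+s)) (\<lambda>z. ln (norm (g z)))"
      unfolding set_integrable_def using R
      by (intro borel_integrable_compact continuous_on_subset[OF cont]) auto
    then show ?thesis using R by (subst set_integrable_cong[OF refl refl, of _ _ "\<lambda>z. ln (norm (g z))"]) (auto simp: u_def)
  qed
  have F: "integrable lborel (\<lambda>z. u z * ?A r z)" "(\<integral>z. u z * ?A r z \<partial>lborel) = (\<integral>w. \<phi> w * u w \<partial>lborel)" if r: "0 \<le> r" "r \<le> s" for r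
  proof -
    note F = circle_average_Fubini[where u=u and \<rho>=\<rho> and r=r and R="\<rho>+s", OF _ \<phi> r(1) _ ui]
    show "integrable lborel (\<lambda>z. u z * ?A r z)" using F(1) r by simp
    have "\<phi> w * (\<integral>t. u (w + r * turn t) \<partial>circ) = \<phi> w * u w" for w
    proof (cases "norm w \<le> \<rho>")
      case True
      have sub: "ball w (R - \<rho>) \<subseteq> ball 0 R"
      proof
        fix z assume "z \<in> ball w (R - \<rho>)"
        then show "z \<in> ball 0 R" using True norm_triangle_ineq[of w "z - w"] by (auto simp: dist_norm norm_minus_commute)
      qed
      have "(\<integral>t. ln (norm (g (w + r * turn t))) \<partial>circ) = ln (norm (g w))"
        using g sub r R by (intro mean_value_ln_holomorphic(2)[where R="R - \<rho>"]) (auto intro: holomorphic_on_subset)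
      moreover have "w + r * turn t \<in> ball 0 R" for t
        using sub r R by (intro subsetD[OF sub]) (auto simp: dist_norm norm_mult)
      moreover have "w \<in> ball 0 R" using True R s by auto
      ultimately show ?thesis by (simp add: u_def del: mem_ball)
    qed (use \<phi> in \<open>simp add: supported_in_def\<close>)
    then have "(\<integral>w. \<phi> w * (\<integral>t. u (w + r * turn t) \<partial>circ) \<partial>lborel) = (\<integral>w. \<phi> w * u w \<partial>lborel)" by (simp only:)
    with F(2) r show "(\<integral>z. u z * ?A r z \<partial>lborel) = (\<integral>w. \<phi> w * u w \<partial>lborel)" by simp
  qed
  have eq: "ln (norm (g z)) * circle_difference s \<phi> z = u z * ?A s z - u z * ?A (s/2) z" for z
  proof (cases "norm z < R")
    case True then show ?thesis by (simp add: u_def circle_difference_def right_diff_distrib)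
  next
    case False
    then have "circle_difference s \<phi> z = 0" using R by (intro circle_difference_eq_0[OF \<phi> s]) auto
    then show ?thesis using False by (simp add: u_def)
  qed
  show "integrable lborel (\<lambda>z. ln (norm (g z)) * circle_difference s \<phi> z)"
    unfolding eq using F(1)[of s] F(1)[of "s/2"] s by auto
  show "(\<integral>z. ln (norm (g z)) * circle_difference s \<phi> z \<partial>lborel) = 0"
    unfolding eq using F[of s] F[of "s/2"] s by (simp add: Bochner_Integration.integral_diff)
qed


section \<open>The smoothing kernel of radius \<open>s\<close>\<close>

lemma supported_in_integrable:
  assumes "supported_in \<rho> \<phi>" shows "integrable lborel \<phi>"
proof -
  have "integrable lborel (\<lambda>w. indicator (cball 0 \<rho>) w *\<^sub>R \<phi> w)"
    using assms unfolding supported_in_def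
    by (intro borel_integrable_compact) (auto intro: continuous_on_subset)
  also have "(\<lambda>w. indicator (cball 0 \<rho>) w *\<^sub>R \<phi> w) = \<phi>"
    using assms by (auto simp: supported_in_def fun_eq_iff indicator_def)
  finally show ?thesis .
qed

lemma supported_in_mult:
  "supported_in \<rho> \<phi> \<Longrightarrow> continuous_on UNIV f \<Longrightarrow> supported_in \<rho> (\<lambda>z. \<phi> z * f z)"
  by (auto simp: supported_in_def intro!: continuous_intros)

lemma annular_log_bounds:
  assumes "s > 0"
  shows "0 \<le> annular_log s a" "norm a \<ge> s \<Longrightarrow> annular_log s a = 0" "norm a \<le> s / 2 \<Longrightarrow> annular_log s a = ln 2"
proof -
  have "ln (max (s/2) (norm a)) \<le> ln (max s (norm a))"
    using assms by (intro ln_mono) auto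
  then show "0 \<le> annular_log s a" by (simp add: annular_log_def)
  show "annular_log s a = 0" if "norm a \<ge> s"
    using that assms by (simp add: annular_log_def)
  show "annular_log s a = ln 2" if "norm a \<le> s / 2"
  proof -
    have "max s (norm a) = s" "max (s/2) (norm a) = s/2" using that assms by auto
    then show ?thesis using assms by (simp add: annular_log_def ln_div)
  qed
qed

lemma supported_in_annular_log:
  assumes "s > 0" shows "supported_in s (annular_log s)"
proof -
  have "continuous_on UNIV (annular_log s)"
    unfolding annular_log_def using assms by (intro continuous_intros) (auto simp: max_def split: if_splits)
  then show ?thesis using annular_log_bounds(2)[OF assms] by (auto simp: supported_in_def)
qed

definition annular_mass :: "real \<Rightarrow> real" where
  "annular_mass s = (\<integral>z. annular_log s z \<partial>lborel)"

lemma annular_log_shift: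
  assumes "s > 0"
  shows "integrable lborel (\<lambda>w. annular_log s (w - a))" "(\<integral>w. annular_log s (w - a) \<partial>lborel) = annular_mass s"
proof -
  have "integrable (distr lborel borel ((+) (-a))) (annular_log s)"
    unfolding lborel_distr_plus using supported_in_integrable[OF supported_in_annular_log[OF assms]] .
  then show "integrable lborel (\<lambda>w. annular_log s (w - a))"
    using supported_in_measurable[OF supported_in_annular_log[OF assms]]
    by (subst (asm) integrable_distr_eq) auto
  show "(\<integral>w. annular_log s (w - a) \<partial>lborel) = annular_mass s"
    using lborel_integral_shift[of "annular_log s" "-a"] by (simp add: annular_mass_def)
qed

text \<open>The kernel is constantly \<open>ln 2\<close> on the disc of radius \<open>s / 2\<close>.
  Its exact mass never matters.\<close>

lemma annular_mass_pos:
  assumes s: "s > 0" shows "annular_mass s > 0"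
proof -
  have "0 < ln 2 * (pi * (s/2)\<^sup>2)" using s by simp
  also have "\<dots> = (\<integral>z. ln 2 * indicator (cball 0 (s/2)) (z::complex) \<partial>lborel)"
    using s by (simp add: measure_def emeasure_cball unit_ball_vol_2)
  also have "\<dots> \<le> annular_mass s"
    unfolding annular_mass_def
  proof (rule integral_mono)
    show "integrable lborel (\<lambda>z. ln 2 * indicator (cball 0 (s/2)) (z::complex) :: real)"
      using s by (intro integrable_mult_right integrable_real_indicator) (auto simp: emeasure_cball)
    show "integrable lborel (annular_log s)" by (rule supported_in_integrable[OF supported_in_annular_log[OF s]])
    show "ln 2 * indicator (cball 0 (s/2)) z \<le> annular_log s z" for z
      using annular_log_bounds[OF s, of z] by (auto simp: indicator_def)
  qed
  finally show ?thesis .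
qed

lemma regularization_integrable:
  assumes "supported_in \<rho> \<phi>" "s > 0"
  shows "integrable lborel (\<lambda>w. \<phi> w * annular_log s (w - a))"
  using assms supported_in_annular_log[of s]
  by (intro supported_in_integrable[OF supported_in_mult]) (auto simp: supported_in_def intro!: continuous_intros intro: continuous_on_compose2)

text \<open>The kernel is nonnegative with total mass \<open>annular_mass s\<close> and lives within
  distance \<open>s\<close>, so only the oscillation of \<open>\<phi>\<close> at that scale is
  seen.\<close>

lemma regularization_approx:
  assumes \<phi>: "supported_in \<rho> \<phi>" and s: "s > 0" and d: "\<And>w. norm (w - a) \<le> s \<Longrightarrow> \<bar>\<phi> w - c\<bar> \<le> d"
  shows "\<bar>regularization s \<phi> a - annular_mass s * c\<bar> \<le> annular_mass s * d"
proof -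
  note i = annular_log_shift[OF s, of a]
  have "regularization s \<phi> a - annular_mass s * c = (\<integral>w. (\<phi> w - c) * annular_log s (w - a) \<partial>lborel)"
    unfolding regularization_def left_diff_distrib i(2)[symmetric]
    using i(1) regularization_integrable[OF \<phi> s, of a] by (simp add: mult.commute)
  also have "\<bar>\<dots>\<bar> \<le> (\<integral>w. d * annular_log s (w - a) \<partial>lborel)"
  proof (subst real_norm_def[symmetric], rule Bochner_Integration.integral_norm_bound_integral)
    show "integrable lborel (\<lambda>w. (\<phi> w - c) * annular_log s (w - a))"
      unfolding left_diff_distrib using i(1) regularization_integrable[OF \<phi> s, of a] by auto
    show "integrable lborel (\<lambda>w. d * annular_log s (w - a))" using i(1) by auto
    fix w
    show "norm ((\<phi> w - c) * annular_log s (w - a)) \<le> d * annular_log s (w - a)"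
    proof (cases "norm (w - a) \<le> s")
      case True
      then show ?thesis using d[OF True] annular_log_bounds(1)[OF s, of "w - a"] by (simp add: abs_mult mult_right_mono)
    qed (simp add: annular_log_bounds(2)[OF s])
  qed
  also have "\<dots> = annular_mass s * d" using i by simp
  finally show ?thesis .
qed

lemma regularization_eq_0:
  assumes "supported_in \<rho> \<phi>" "s > 0" "norm a > \<rho> + s"
  shows "regularization s \<phi> a = 0"
proof -
  have "\<phi> w = 0" if "norm (w - a) \<le> s" for w
    using that assms norm_triangle_ineq3[of w a] by (auto simp: supported_in_def)
  then show ?thesis using regularization_approx[OF assms(1,2), of a 0 0] by auto
qed

lemma regularization_nonneg:
  assumes "\<And>w. \<phi> w \<ge> 0" "s > 0"
  shows "regularization s \<phi> a \<ge> 0"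
  unfolding regularization_def using assms annular_log_bounds(1)[OF assms(2)] by (intro Bochner_Integration.integral_nonneg) auto

lemma regularization_measurable [measurable]:
  assumes "supported_in \<rho> \<phi>" "s > 0" shows "regularization s \<phi> \<in> borel_measurable borel"
proof -
  note [measurable] = supported_in_measurable[OF assms(1)] supported_in_measurable[OF supported_in_annular_log[OF assms(2)]]
  show ?thesis unfolding regularization_def by measurable
qed

section \<open>Zeros of holomorphic functions\<close>

text \<open>One zero \<open>b\<close> is divided out at a time. Near \<open>b\<close> the new
  cofactor is built from \<open>zor_poly G b\<close>, elsewhere from the old cofactor. As the local
  factor is taken from \<open>G\<close> itself, orders of zeros of the quotients never have to be
  computed.\<close>

lemma holomorphic_divide_zeros:
  assumes G: "G holomorphic_on S" "open S" "connected S" "\<exists>z\<in>S. G z \<noteq> 0"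
    and A: "finite A" "\<And>a. a \<in> A \<Longrightarrow> a \<in> S \<and> G a = 0"
  shows "\<exists>g. g holomorphic_on S \<and> (\<forall>a\<in>A. g a \<noteq> 0) \<and> (\<forall>z\<in>S. G z = g z * (\<Prod>a\<in>A. (z - a) ^ nat (zorder G a)))"
  using A
proof (induction A rule: finite_induct)
  case empty
  then show ?case using G(1) by auto
next
  case (insert b A)
  let ?P = "\<lambda>A z. \<Prod>a\<in>A. (z - a) ^ nat (zorder G a)"
  obtain g where g: "g holomorphic_on S" "\<And>a. a \<in> A \<Longrightarrow> g a \<noteq> 0" "\<And>z. z \<in> S \<Longrightarrow> G z = g z * ?P A z"
    using insert by blast
  have b: "b \<in> S" "G b = 0" using insert by auto
  obtain r where r: "r > 0" "cball b r \<subseteq> S" and h: "zor_poly G b holomorphic_on cball b r"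
    and hG: "\<And>w. w \<in> cball b r \<Longrightarrow> G w = zor_poly G b w * (w - b) ^ nat (zorder G b)" "\<And>w. w \<in> cball b r \<Longrightarrow> zor_poly G b w \<noteq> 0"
    using zorder_exist_zero[OF G(1,2,3) b(1) G(4)] by blast
  \<comment> \<open>Small enough to stay off the zeros already removed, so that one can divide by
    the product over \<open>A\<close>.\<close>
  define r' where "r' = Min (insert r ((\<lambda>a. dist b a) ` A))"
  have r'0: "r' > 0" unfolding r'_def using insert(1,2) r by (subst Min_gr_iff) auto
  have r': "r' \<le> r" "\<And>a. a \<in> A \<Longrightarrow> r' \<le> dist b a" unfolding r'_def using insert(1) by auto
  have PA: "?P A z \<noteq> 0" if "z \<in> ball b r'" for z
    using that r'(2) insert(1) by (fastforce simp: prod_zero_iff)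
  define gg where "gg = (\<lambda>z. if z \<in> ball b r' then zor_poly G b z / ?P A z else g z / (z - b) ^ nat (zorder G b))"
  have "gg holomorphic_on ball b r' \<union> (S - {b})"
    unfolding gg_def
  proof (rule holomorphic_on_If_Un)
    show "(\<lambda>z. zor_poly G b z / ?P A z) holomorphic_on ball b r'"
      using PA r' by (intro holomorphic_intros holomorphic_on_subset[OF h]) auto
    show "(\<lambda>z. g z / (z - b) ^ nat (zorder G b)) holomorphic_on S - {b}"
      by (intro holomorphic_intros holomorphic_on_subset[OF g(1)]) auto
    show "open (S - {b})" using G(2) by (simp add: open_delete)
    fix z assume z: "z \<in> ball b r'" "z \<in> S - {b}"
    then have "z \<in> cball b r" using r' by auto
    then have "g z * ?P A z = zor_poly G b z * (z - b) ^ nat (zorder G b)"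
      using hG(1)[of z] g(3)[of z] z by auto
    then show "zor_poly G b z / ?P A z = g z / (z - b) ^ nat (zorder G b)"
      using PA[OF z(1)] z by (simp add: field_simps)
  qed auto
  then have 1: "gg holomorphic_on S" by (rule holomorphic_on_subset) (use r'0 in auto)
  have 2: "gg a \<noteq> 0" if "a \<in> insert b A" for a
  proof (cases "a = b")
    case True
    then show ?thesis using hG(2)[of b] PA[of b] r r'0 by (simp add: gg_def)
  next
    case False
    then have "a \<notin> ball b r'" using that r'(2)[of a] by auto
    then show ?thesis using False that g(2)[of a] by (auto simp: gg_def)
  qed
  have 3: "G z = gg z * ?P (insert b A) z" if "z \<in> S" for z
  proof (cases "z \<in> ball b r'")
    case True
    then have "z \<in> cball b r" using r' by auto
    have *: "x / p * (y * p) = x * y" if "p \<noteq> 0" for x y p :: complex using that by simp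
    have "G z = zor_poly G b z / ?P A z * ((z - b) ^ nat (zorder G b) * ?P A z)"
      unfolding *[OF PA[OF True]] by (rule hG(1)) fact
    then show ?thesis using insert(1,2) True by (simp add: gg_def)
  next
    case False
    then have "z \<noteq> b" using r'0 by auto
    then show ?thesis using g(3)[OF that] insert(1,2) False by (simp add: gg_def)
  qed
  show ?case using 1 2 3 by blast
qed

lemma holomorphic_finite_zeros_ball:
  assumes G: "G holomorphic_on ball 0 R" "\<exists>z\<in>ball 0 R. G z \<noteq> 0" and R': "R' < R"
  shows "finite {z\<in>cball 0 R'. G z = 0}"
proof (cases "G constant_on ball 0 R")
  case True
  then have "G z \<noteq> 0" if "z \<in> ball 0 R" for z using G(2) that unfolding constant_on_def by metis
  then have "{z\<in>cball 0 R'. G z = 0} = {}" using R' by auto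
  then show ?thesis by (metis finite.emptyI)
next
  case False
  then show ?thesis
    by (intro holomorphic_compact_finite_zeros[OF G(1)]) (use R' in auto)
qed

text \<open>The finitely many zeros in the closed disc are divided out. The cofactor may keep zeros
  beyond \<open>R'\<close>, hence the claims on the smaller ball only.\<close>

lemma holomorphic_factorization:
  assumes G: "G holomorphic_on ball 0 R" "\<exists>z\<in>ball 0 R. G z \<noteq> 0" and R': "R' < R"
  defines "Z \<equiv> {z\<in>cball 0 R'. G z = 0}"
  obtains g where "g holomorphic_on ball 0 R'" "\<And>z. z \<in> ball 0 R' \<Longrightarrow> g z \<noteq> 0"
    "\<And>z. z \<in> ball 0 R' - Z \<Longrightarrow> ln (norm (G z)) = ln (norm (g z)) + (\<Sum>a\<in>Z. nat (zorder G a) * ln (norm (z - a)))"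
proof -
  have fZ: "finite Z" unfolding Z_def by (rule holomorphic_finite_zeros_ball[OF G R'])
  have ZS: "a \<in> ball 0 R \<and> G a = 0" if "a \<in> Z" for a using that R' by (auto simp: Z_def)
  obtain g where g: "g holomorphic_on ball 0 R" "\<And>a. a \<in> Z \<Longrightarrow> g a \<noteq> 0"
    "\<And>z. z \<in> ball 0 R \<Longrightarrow> G z = g z * (\<Prod>a\<in>Z. (z - a) ^ nat (zorder G a))"
    using holomorphic_divide_zeros[OF G(1) open_ball connected_ball G(2) fZ ZS] by blast
  have nz: "g z \<noteq> 0" if z: "z \<in> ball 0 R'" for z
  proof (cases "z \<in> Z")
    case False
    then have "G z \<noteq> 0" using z by (auto simp: Z_def)
    then show ?thesis using g(3)[of z] z R' by auto
  qed (use g in auto)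
  show thesis
  proof (rule that[of g])
    show "g holomorphic_on ball 0 R'" using R' by (intro holomorphic_on_subset[OF g(1)]) auto
    fix z assume z: "z \<in> ball 0 R' - Z"
    have "ln (norm (G z)) = ln (norm (g z) * (\<Prod>a\<in>Z. norm (z - a) ^ nat (zorder G a)))"
      using z R' by (subst g(3)) (auto simp: norm_mult prod_norm[symmetric] norm_power)
    also have "\<dots> = ln (norm (g z)) + ln (\<Prod>a\<in>Z. norm (z - a) ^ nat (zorder G a))"
      using z nz[of z] fZ by (subst ln_mult) (auto intro!: prod_pos)
    also have "ln (\<Prod>a\<in>Z. norm (z - a) ^ nat (zorder G a)) = (\<Sum>a\<in>Z. ln (norm (z - a) ^ nat (zorder G a)))"
      using z fZ by (subst ln_prod) auto
    also have "\<dots> = (\<Sum>a\<in>Z. nat (zorder G a) * ln (norm (z - a)))"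
      by (intro sum.cong refl ln_realpow)
    finally show "ln (norm (G z)) = ln (norm (g z)) + (\<Sum>a\<in>Z. nat (zorder G a) * ln (norm (z - a)))" .
  qed (use nz in auto)
qed

lemma AE_lborel_notin_finite: "finite Z \<Longrightarrow> AE z in lborel. z \<notin> (Z :: complex set)"
  using finite_imp_null_set_lborel AE_not_in by blast

text \<open>Jensen's formula in weak form: in the factorization the zero-free part contributes
  nothing, and each zero contributes its value of \<open>regularization\<close>, counted with
  multiplicity.\<close>

lemma integral_ln_circle_difference:
  assumes G: "G holomorphic_on ball 0 R" "\<exists>z\<in>ball 0 R. G z \<noteq> 0"
    and \<phi>: "supported_in \<rho> \<phi>" and s: "s > 0" and R': "\<rho> + s < R'" "R' < R"
  shows "(\<integral>z. ln (norm (G z)) * circle_difference s \<phi> z \<partial>lborel)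
    = (\<Sum>a\<in>{z\<in>cball 0 R'. G z = 0}. nat (zorder G a) * regularization s \<phi> a)"
proof -
  note [measurable] = supported_in_measurable[OF \<phi>]
  define Z where "Z = {z\<in>cball 0 R'. G z = 0}"
  have fZ: "finite Z" unfolding Z_def by (rule holomorphic_finite_zeros_ball[OF G R'(2)])
  obtain g where g: "g holomorphic_on ball 0 R'" "\<And>z. z \<in> ball 0 R' \<Longrightarrow> g z \<noteq> 0"
    "\<And>z. z \<in> ball 0 R' - Z \<Longrightarrow> ln (norm (G z)) = ln (norm (g z)) + (\<Sum>a\<in>Z. nat (zorder G a) * ln (norm (z - a)))"
    using holomorphic_factorization[OF G R'(2)] unfolding Z_def by blast
  let ?w = "circle_difference s \<phi>"
  note i1 = integral_ln_nonvanishing_circle_difference[OF \<phi> s R'(1) g(1,2)]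
  note i2 = integral_ln_dist_circle_difference[OF \<phi> s]
  have w0: "?w z = 0" if "z \<notin> ball 0 R'" for z using that R' by (intro circle_difference_eq_0[OF \<phi> s]) auto
  have eq: "ln (norm (G z)) * ?w z = ln (norm (g z)) * ?w z + (\<Sum>a\<in>Z. nat (zorder G a) * (ln (norm (z - a)) * ?w z))"
    if "z \<notin> Z" for z
    using g(3)[of z] w0[of z] that by (cases "z \<in> ball 0 R'") (auto simp: distrib_right sum_distrib_right mult.assoc)
  have meas: "(\<lambda>z. ln (norm (G z)) * ?w z) \<in> borel_measurable lborel"
  proof -
    have "(\<lambda>z. if z \<in> ball 0 R then G z else 0) \<in> borel_measurable borel"
      using G(1) by (intro borel_measurable_continuous_on_if) (auto intro: holomorphic_on_imp_continuous_on)
    moreover have "?w \<in> borel_measurable borel" by (rule circle_difference_measurable[OF \<phi>])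
    ultimately have "(\<lambda>z. ln (norm (if z \<in> ball 0 R then G z else 0)) * ?w z) \<in> borel_measurable borel" by measurable
    also have "(\<lambda>z. ln (norm (if z \<in> ball 0 R then G z else 0)) * ?w z) = (\<lambda>z. ln (norm (G z)) * ?w z)"
      using w0 R' by (auto simp: fun_eq_iff)
    finally show ?thesis by simp
  qed
  have "(\<integral>z. ln (norm (G z)) * ?w z \<partial>lborel) =
    (\<integral>z. ln (norm (g z)) * ?w z + (\<Sum>a\<in>Z. nat (zorder G a) * (ln (norm (z - a)) * ?w z)) \<partial>lborel)"
    using AE_lborel_notin_finite[OF fZ] eq i1(1) i2(1) meas
    by (intro integral_cong_AE) auto
  also have "\<dots> = (\<Sum>a\<in>Z. nat (zorder G a) * regularization s \<phi> a)"
    using i1 i2 by (subst Bochner_Integration.integral_add) (auto simp: Bochner_Integration.integral_sum)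
  finally show ?thesis unfolding Z_def .
qed

section \<open>Rotational averages and subharmonicity of the logarithm of the modulus\<close>

lemma rotation_average:
  fixes f :: "complex \<Rightarrow> real"
  assumes [measurable]: "f \<in> borel_measurable borel" and i: "integrable lborel f"
  shows "integrable lborel (\<lambda>z. \<integral>t. f (turn t * z) \<partial>circ)" "(\<integral>z. (\<integral>t. f (turn t * z) \<partial>circ) \<partial>lborel) = (\<integral>z. f z \<partial>lborel)"
proof -
  have rot: "integrable lborel (\<lambda>z. h (turn t * z))" "(\<integral>z. h (turn t * z) \<partial>lborel) = (\<integral>z. h z \<partial>lborel)"
    if [measurable]: "h \<in> borel_measurable borel" and ih: "integrable lborel h" for t and h :: "complex \<Rightarrow> real"
  proof -
    have [measurable]: "(*) (turn t) \<in> borel_measurable borel" by simp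
    have "integrable (distr lborel borel ((*) (turn t))) h" using ih by (simp add: lborel_distr_rotation)
    then show "integrable lborel (\<lambda>z. h (turn t * z))" by (subst (asm) integrable_distr_eq) auto
    show "(\<integral>z. h (turn t * z) \<partial>lborel) = (\<integral>z. h z \<partial>lborel)"
      by (subst (2) lborel_distr_rotation[OF norm_turn[of t], symmetric], subst integral_distr) auto
  qed
  \<comment> \<open>Each single rotation preserves Lebesgue measure, so the average over all of them
    does too. This takes the place of integration in polar coordinates.\<close>
  have joint: "integrable (circ \<Otimes>\<^sub>M lborel) (\<lambda>(t, z). f (turn t * z))"
    using rot(1)[OF assms] rot(2)[of "\<lambda>z. norm (f z)"] i
    by (intro circ_lborel.Fubini_integrable) auto
  show "integrable lborel (\<lambda>z. \<integral>t. f (turn t * z) \<partial>circ)"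
    using circ_lborel.integrable_snd[OF joint] by simp
  show "(\<integral>z. (\<integral>t. f (turn t * z) \<partial>circ) \<partial>lborel) = (\<integral>z. f z \<partial>lborel)"
    using circ_lborel.Fubini_integral[OF joint] rot(2)[OF assms] by simp
qed

text \<open>Parametrising circles by \<open>turn t * z\<close> with \<open>z\<close> in the plane
  allows integration over \<open>z\<close> afterwards. The direction of \<open>z\<close> is rotated
  away.\<close>

lemma mean_value_ln_dist_rotated:
  fixes w a z :: complex
  assumes ne: "norm (w - a) \<noteq> norm z"
  shows "integrable circ (\<lambda>t. ln (norm (w + turn t * z - a)))"
    "(\<integral>t. ln (norm (w + turn t * z - a)) \<partial>circ) = ln (max (norm z) (norm (w - a)))"
proof -
  define c where "c = (if z = 0 then 1 else sgn z)"
  have c: "norm c = 1" "z = norm z * c" by (simp_all add: c_def norm_divide sgn_eq)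
  have c0: "c \<noteq> 0" using c by auto
  have d: "norm (w / c - a / c) = norm (w - a)"
    using c by (simp add: diff_divide_distrib[symmetric] norm_divide)
  have e: "norm (w + turn t * z - a) = norm (w / c + norm z * turn t - a / c)" for t
  proof -
    have "w + turn t * z - a = c * (w / c + norm z * turn t - a / c)"
      using c0 by (subst c(2)) (simp add: algebra_simps)
    then show ?thesis by (metis c(1) mult_1 norm_mult)
  qed
  show "integrable circ (\<lambda>t. ln (norm (w + turn t * z - a)))"
    "(\<integral>t. ln (norm (w + turn t * z - a)) \<partial>circ) = ln (max (norm z) (norm (w - a)))"
    using mean_value_ln_dist[of "norm z" "w/c" "a/c"] ne unfolding d e by simp_all
qed

text \<open>Reduces to the unit circle for the function \<open>g (w + u * z)\<close> of
  \<open>u\<close>, which is zero-free on a disc of radius larger than 1.\<close>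

lemma mean_value_ln_holomorphic_rotated:
  fixes z w :: complex
  assumes g: "g holomorphic_on ball w R" "\<And>z. z \<in> ball w R \<Longrightarrow> g z \<noteq> 0" and r: "norm z < R"
  shows "integrable circ (\<lambda>t. ln (norm (g (w + turn t * z))))"
    "(\<integral>t. ln (norm (g (w + turn t * z))) \<partial>circ) = ln (norm (g w))"
proof -
  let ?g = "\<lambda>u. g (w + u * z)"
  obtain R' where R': "R' > 1" "norm z * R' < R"
  proof (cases "z = 0")
    case True then show ?thesis using that[of 2] r by auto
  next
    case False
    then have "1 < R / norm z" using r by simp
    then obtain R' where "1 < R'" "R' < R / norm z" using dense by blast
    then show ?thesis using that[of R'] False by (simp add: field_simps)
  qed
  have sub: "w + u * z \<in> ball w R" if "u \<in> ball 0 R'" for u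
  proof -
    have "norm u * norm z \<le> R' * norm z" using that by (intro mult_right_mono) auto
    then show ?thesis using R' by (simp add: dist_norm norm_mult mult.commute)
  qed
  have "?g holomorphic_on ball 0 R'"
    by (rule holomorphic_on_compose_gen[of "\<lambda>u. w + u * z" _ g, unfolded o_def, OF _ g(1)]) (use sub in \<open>auto intro!: holomorphic_intros\<close>)
  from mean_value_ln_holomorphic[OF this, of 1] sub g(2) R'
  show "integrable circ (\<lambda>t. ln (norm (g (w + turn t * z))))"
    "(\<integral>t. ln (norm (g (w + turn t * z))) \<partial>circ) = ln (norm (g w))" by auto
qed

lemma ln_norm_set_integrable:
  assumes G: "G holomorphic_on ball 0 R" "\<exists>z\<in>ball 0 R. G z \<noteq> 0" and R': "R' < R"
  shows "set_integrable lborel (cball 0 R') (\<lambda>z. ln (norm (G z)))"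
proof -
  \<comment> \<open>The cofactor is zero-free only on an open ball; an intermediate radius makes
    \<open>cball 0 R'\<close> a compact subset of it.\<close>
  obtain R1 where R1: "R' < R1" "R1 < R" using R' dense by blast
  define Z where "Z = {z\<in>cball 0 R1. G z = 0}"
  have fZ: "finite Z" unfolding Z_def by (rule holomorphic_finite_zeros_ball[OF G R1(2)])
  obtain g where g: "g holomorphic_on ball 0 R1" "\<And>z. z \<in> ball 0 R1 \<Longrightarrow> g z \<noteq> 0"
    "\<And>z. z \<in> ball 0 R1 - Z \<Longrightarrow> ln (norm (G z)) = ln (norm (g z)) + (\<Sum>a\<in>Z. nat (zorder G a) * ln (norm (z - a)))"
    using holomorphic_factorization[OF G R1(2)] unfolding Z_def by blast
  have gc: "continuous_on (cball 0 R') (\<lambda>z. ln (norm (g z)))"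
    using g R1 by (intro continuous_intros holomorphic_on_imp_continuous_on holomorphic_on_subset[OF g(1)]) auto
  have i1: "set_integrable lborel (cball 0 R') (\<lambda>z. ln (norm (g z)))"
    unfolding set_integrable_def by (intro borel_integrable_compact gc compact_cball)
  have 1: "set_integrable lborel (cball 0 R') (\<lambda>z. ln (norm (g z)) + (\<Sum>a\<in>Z. nat (zorder G a) * ln (norm (z - a))))"
    using i1 set_integrable_ln_dist[of R'] unfolding set_integrable_def scaleR_add_right scaleR_sum_right
    by (intro Bochner_Integration.integrable_add Bochner_Integration.integrable_sum)
      (simp_all add: mult.left_commute[of "indicator _ _"])
  have meas: "(\<lambda>z. indicator (cball 0 R') z *\<^sub>R ln (norm (G z))) \<in> borel_measurable lborel"
  proof -
    have "(\<lambda>z. if z \<in> ball 0 R then G z else 0) \<in> borel_measurable borel"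
      using G(1) by (intro borel_measurable_continuous_on_if) (auto intro: holomorphic_on_imp_continuous_on)
    then have "(\<lambda>z. indicator (cball 0 R') z *\<^sub>R ln (norm (if z \<in> ball 0 R then G z else 0))) \<in> borel_measurable borel" by measurable
    also have "(\<lambda>z. indicator (cball 0 R') z *\<^sub>R ln (norm (if z \<in> ball 0 R then G z else 0))) = (\<lambda>z. indicator (cball 0 R') z *\<^sub>R ln (norm (G z)))"
      using R' by (auto simp: fun_eq_iff indicator_def)
    finally show ?thesis by simp
  qed
  show ?thesis
    using 1 unfolding set_integrable_def
    by (rule integrable_cong_AE_imp[OF _ meas]) (use AE_lborel_notin_finite[OF fZ] g(3) R1 in \<open>auto simp: indicator_def\<close>)
qed

text \<open>Subharmonicity, one zero at a time: a zero \<open>a\<close> contributes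
  \<open>ln (max (norm z) (norm (w - a)))\<close> to the circle mean, at least its contribution at
  the centre; the zero-free factor contributes the same to both.\<close>

lemma ln_norm_circle_mean_ge:
  assumes G: "G holomorphic_on ball 0 R" "\<exists>z\<in>ball 0 R. G z \<noteq> 0" and R': "R' < R"
    and w: "ball w r \<subseteq> ball 0 R'" "norm z < r" "G w \<noteq> 0"
    and ne: "\<And>a. a \<in> cball 0 R' \<Longrightarrow> G a = 0 \<Longrightarrow> norm (w - a) \<noteq> norm z"
  shows "ln (norm (G w)) \<le> (\<integral>t. ln (norm (G (w + turn t * z))) \<partial>circ)"
proof -
  define Z where "Z = {z\<in>cball 0 R'. G z = 0}"
  have fZ: "finite Z" unfolding Z_def by (rule holomorphic_finite_zeros_ball[OF G R'])
  obtain g where g: "g holomorphic_on ball 0 R'" "\<And>z. z \<in> ball 0 R' \<Longrightarrow> g z \<noteq> 0"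
    "\<And>z. z \<in> ball 0 R' - Z \<Longrightarrow> ln (norm (G z)) = ln (norm (g z)) + (\<Sum>a\<in>Z. nat (zorder G a) * ln (norm (z - a)))"
    using holomorphic_factorization[OF G R'] unfolding Z_def by blast
  have wt: "w + turn t * z \<in> ball 0 R' - Z" for t
  proof -
    have "w + turn t * z \<in> ball w r" using w by (simp add: dist_norm norm_mult)
    moreover have "w + turn t * z \<notin> Z"
    proof
      assume "w + turn t * z \<in> Z"
      then have "norm (w - (w + turn t * z)) \<noteq> norm z" using ne[of "w + turn t * z"] unfolding Z_def by blast
      moreover have "norm (w - (w + turn t * z)) = norm z" by (simp add: norm_mult)
      ultimately show False by simp
    qed
    ultimately show ?thesis using w by auto
  qed
  have wr: "w \<in> ball 0 R'" using le_less_trans[OF norm_ge_zero w(2)] by (intro subsetD[OF w(1)]) simp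
  then have wZ: "w \<in> ball 0 R' - Z" using w(3) by (auto simp: Z_def)
  have g': "g holomorphic_on ball w r" "\<And>z. z \<in> ball w r \<Longrightarrow> g z \<noteq> 0"
    using g w by (auto intro: holomorphic_on_subset)
  note m1 = mean_value_ln_holomorphic_rotated[OF g' w(2)]
  have neZ: "norm (w - a) \<noteq> norm z" if "a \<in> Z" for a using that ne by (auto simp: Z_def)
  note m2 = mean_value_ln_dist_rotated[OF neZ]
  have "ln (norm (G w)) = ln (norm (g w)) + (\<Sum>a\<in>Z. nat (zorder G a) * ln (norm (w - a)))"
    using g(3)[OF wZ] .
  also have "\<dots> \<le> ln (norm (g w)) + (\<Sum>a\<in>Z. nat (zorder G a) * ln (max (norm z) (norm (w - a))))"
    using wZ by (intro add_left_mono sum_mono mult_left_mono ln_mono) auto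
  also have "\<dots> = (\<integral>t. ln (norm (g (w + turn t * z))) + (\<Sum>a\<in>Z. nat (zorder G a) * ln (norm (w + turn t * z - a))) \<partial>circ)"
    using m1 m2 by (subst Bochner_Integration.integral_add) (auto simp: Bochner_Integration.integral_sum)
  also have "\<dots> = (\<integral>t. ln (norm (G (w + turn t * z))) \<partial>circ)"
    using g(3)[OF wt] by simp
  finally show ?thesis .
qed

lemma ln_norm_submean:
  assumes G: "G holomorphic_on ball 0 R" "\<exists>z\<in>ball 0 R. G z \<noteq> 0" and R': "R' < R"
    and w: "ball w r \<subseteq> ball 0 R'" "r > 0" "G w \<noteq> 0"
  shows "set_integrable lborel (ball w r) (\<lambda>z. ln (norm (G z)))"
    "pi * r\<^sup>2 * ln (norm (G w)) \<le> (LINT z:ball w r|lborel. ln (norm (G z)))"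
proof -
  show i: "set_integrable lborel (ball w r) (\<lambda>z. ln (norm (G z)))"
    using w(1) ball_subset_cball by (intro set_integrable_subset[OF ln_norm_set_integrable[OF G R']]) auto
  define f where "f = (\<lambda>z. indicator (ball w r) (w + z) *\<^sub>R ln (norm (G (w + z))))"
  have m: "(\<lambda>z. indicator (ball w r) z *\<^sub>R ln (norm (G z))) \<in> borel_measurable borel"
    using i unfolding set_integrable_def by auto
  then have [measurable]: "f \<in> borel_measurable borel" unfolding f_def by measurable
  have "integrable (distr lborel borel ((+) w)) (\<lambda>z. indicator (ball w r) z *\<^sub>R ln (norm (G z)))"
    unfolding lborel_distr_plus using i unfolding set_integrable_def .
  then have fi: "integrable lborel f" unfolding f_def using m by (subst (asm) integrable_distr_eq) auto
  define Z where "Z = {z\<in>cball 0 R'. G z = 0}"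
  have fZ: "finite Z" unfolding Z_def by (rule holomorphic_finite_zeros_ball[OF G R'])
  \<comment> \<open>For almost every \<open>z\<close> the circle misses the finitely many zeros, so
    the circle inequality can be integrated over \<open>ball 0 r\<close>.\<close>
  have "AE z::complex in lborel. \<forall>a\<in>Z. norm (z - 0) \<noteq> norm (w - a)"
    using fZ by (intro AE_finite_allI AE_norm_neq) auto
  then have ae: "AE z in lborel. indicator (ball 0 r) z * ln (norm (G w)) \<le> (\<integral>t. f (turn t * z) \<partial>circ)"
  proof eventually_elim
    case (elim z)
    show ?case
    proof (cases "norm z < r")
      case True
      then have "ln (norm (G w)) \<le> (\<integral>t. ln (norm (G (w + turn t * z))) \<partial>circ)"
        using elim by (intro ln_norm_circle_mean_ge[OF G R' w(1) _ w(3)]) (auto simp: Z_def)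
      also have "\<dots> = (\<integral>t. f (turn t * z) \<partial>circ)"
        using True by (simp add: f_def dist_norm norm_mult)
      finally show ?thesis using True by simp
    qed (simp add: f_def dist_norm norm_mult)
  qed
  have "pi * r\<^sup>2 * ln (norm (G w)) = (\<integral>z. indicator (ball 0 r) (z::complex) * ln (norm (G w)) \<partial>lborel)"
    using w(2) by (simp add: measure_def emeasure_ball unit_ball_vol_2)
  also have "\<dots> \<le> (\<integral>z. (\<integral>t. f (turn t * z) \<partial>circ) \<partial>lborel)"
    using w(2) by (intro integral_mono_AE rotation_average fi integrable_mult_left integrable_real_indicator ae)
      (auto simp: emeasure_ball)
  also have "\<dots> = (\<integral>z. f z \<partial>lborel)" by (rule rotation_average(2)) (use fi in auto)
  also have "\<dots> = (LINT z:ball w r|lborel. ln (norm (G z)))"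
    unfolding f_def set_lebesgue_integral_def by (rule lborel_integral_shift)
  finally show "pi * r\<^sup>2 * ln (norm (G w)) \<le> (LINT z:ball w r|lborel. ln (norm (G z)))" .
qed

text \<open>
  The half-integer shift of the grid keeps the origin, where the lower bound on the random
  function may fail, away from the centres.
\<close>

lemma finite_disc_cover:
  fixes \<rho> e :: real
  assumes "\<rho> > 0" "e > 0"
  obtains C :: "complex set" and d :: real where "finite C" "0 < d" "d < e" "card C * d\<^sup>2 \<le> 36 * \<rho>\<^sup>2" "0 \<notin> C"
    "C \<subseteq> ball 0 (\<rho> + d)" "cball 0 \<rho> \<subseteq> (\<Union>c\<in>C. ball c d)"
proof -
  obtain m :: nat where m: "2 * \<rho> / e < m" using reals_Archimedean2 by blast
  have m0: "m > 0" using m assms by (cases m) (auto simp: field_simps)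
  \<comment> \<open>The spacing of the grid; the discs get radius \<open>2 * r\<close>. At most
    \<open>(2 * m + 1)\<^sup>2 \<le> 9 * m\<^sup>2\<close> grid points times
    \<open>4 * r\<^sup>2 = 4 * \<rho>\<^sup>2 / m\<^sup>2\<close> give the constant 36.\<close>
  define r where "r = \<rho> / m"
  have r: "r > 0" using assms m0 by (simp add: r_def)
  define f where "f = (\<lambda>(j::int, k::int). Complex (r * (j + 1/2)) (r * k))"
  let ?I = "{-int m..int m} \<times> {-int m..int m}"
  define C where "C = {c \<in> f ` ?I. norm c < \<rho> + 2 * r}"
  have "card C \<le> card (f ` ?I)" unfolding C_def by (intro card_mono) auto
  also have "\<dots> \<le> card ?I" by (intro card_image_le) auto
  also have "\<dots> = (2 * m + 1)\<^sup>2" by (simp add: card_cartesian_product power2_eq_square nat_add_distrib nat_mult_distrib)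
  also have "\<dots> \<le> (3 * m)\<^sup>2" using m0 by (intro power_mono) auto
  finally have "real (card C) \<le> real ((3 * m)\<^sup>2)" by (simp only: of_nat_le_iff)
  then have "card C * (2 * r)\<^sup>2 \<le> (3 * m)\<^sup>2 * (2 * r)\<^sup>2" by (intro mult_right_mono) auto
  also have "\<dots> = 36 * \<rho>\<^sup>2" using m0 by (simp add: r_def power2_eq_square)
  finally have card: "card C * (2 * r)\<^sup>2 \<le> 36 * \<rho>\<^sup>2" .
  have nz: "0 \<notin> C"
  proof
    assume "0 \<in> C"
    then obtain j k where "0 = f (j, k)" by (auto simp: C_def)
    then have "r * (j + 1/2) = 0" by (simp add: f_def complex_eq_iff)
    then have "real_of_int (2 * j + 1) = 0" using r by simp
    then have "2 * j + 1 = 0" by (simp only: of_int_eq_0_iff)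
    then show False by presburger
  qed
  have cov: "z \<in> (\<Union>c\<in>C. ball c (2 * r))" if z: "z \<in> cball 0 \<rho>" for z
  proof -
    define j where "j = \<lfloor>Re z / r\<rfloor>"
    define k where "k = \<lfloor>Im z / r\<rfloor>"
    have b: "\<bar>Re z / r\<bar> \<le> m" "\<bar>Im z / r\<bar> \<le> m"
      using abs_Re_le_cmod[of z] abs_Im_le_cmod[of z] z r m0 assms(1)
      by (auto simp: r_def field_simps abs_mult)
    have "- int m \<le> j" "j \<le> int m" "- int m \<le> k" "k \<le> int m" using b unfolding j_def k_def by linarith+
    then have jk: "(j, k) \<in> ?I" by auto
    define c where "c = f (j, k)"
    \<comment> \<open>A point is within \<open>r / 2\<close> of the grid horizontally and within
      \<open>r\<close> vertically, hence nearer than \<open>2 * r\<close>.\<close>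
    have "\<bar>j + 1/2 - Re z / r\<bar> \<le> 1/2" "\<bar>k - Im z / r\<bar> \<le> 1" unfolding j_def k_def by linarith+
    then have "r * \<bar>j + 1/2 - Re z / r\<bar> \<le> r * (1/2)" "r * \<bar>k - Im z / r\<bar> \<le> r * 1" using r by (intro mult_left_mono; simp)+
    moreover have "r * \<bar>j + 1/2 - Re z / r\<bar> = \<bar>Re (c - z)\<bar>" "r * \<bar>k - Im z / r\<bar> = \<bar>Im (c - z)\<bar>"
      using r unfolding c_def f_def
      by (simp_all add: abs_mult_pos' right_diff_distrib)
    ultimately have d: "norm (c - z) < 2 * r" using cmod_le[of "c - z"] r by linarith
    then have "norm c < \<rho> + 2 * r" using z norm_triangle_sub[of c z] by auto
    then have "c \<in> C" using jk by (auto simp: C_def c_def)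
    then show ?thesis using d by (auto simp: dist_norm)
  qed
  show thesis
  proof (rule that[of C "2 * r"])
    show "2 * r < e" using m m0 assms by (simp add: r_def field_simps)
  qed (use r card nz cov in \<open>auto simp: C_def\<close>)
qed

text \<open>The gap \<open>v = p + \<kappa> - ln (norm (G z)) / n\<close> is nonnegative. By the
  submean property its mean over a disc is at most \<open>3 * \<kappa>\<close>: one from its
  definition, one from the oscillation of \<open>p\<close>, one from the lower bound at the centre.
  Since \<open>v\<close> is nonnegative, overlaps of discs do no harm, and \<open>pi * K\<close>
  bounds their total area.\<close>

lemma L1_bound_from_centres:
  fixes p :: "complex \<Rightarrow> real" and d K \<kappa> \<rho> :: real
  assumes G: "G holomorphic_on ball 0 R" and R': "R' < R" "\<rho> < R'" and \<rho>: "\<rho> > 0" and n: "n > (0::real)"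
    and p: "continuous_on (cball 0 R') p" and \<kappa>: "\<kappa> \<ge> 0"
    and ub: "\<And>z. z \<in> ball 0 R' \<Longrightarrow> ln (norm (G z)) / n \<le> p z + \<kappa>"
    and C: "finite C" "d > 0" "card C * d\<^sup>2 \<le> K" "cball 0 \<rho> \<subseteq> (\<Union>c\<in>C. ball c d)"
      "\<And>c. c \<in> C \<Longrightarrow> ball c d \<subseteq> ball 0 R'"
    and osc: "\<And>c z. c \<in> C \<Longrightarrow> z \<in> ball c d \<Longrightarrow> \<bar>p z - p c\<bar> \<le> \<kappa>"
    and lb: "\<And>c. c \<in> C \<Longrightarrow> G c \<noteq> 0 \<and> p c - \<kappa> \<le> ln (norm (G c)) / n"
  shows "(LINT z:cball 0 \<rho>|lborel. \<bar>ln (norm (G z)) / n - p z\<bar>) \<le> (3 * pi * K + pi * \<rho>\<^sup>2) * \<kappa>"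
proof -
  have "0 \<in> cball (0::complex) \<rho>" using \<rho> by simp
  then obtain c0 where c0: "c0 \<in> C" using C(4) by blast
  have cb: "c \<in> ball 0 R'" if "c \<in> C" for c using subsetD[OF C(5)[OF that], of c] C(2) by simp
  have nz: "\<exists>z\<in>ball 0 R. G z \<noteq> 0" using lb[OF c0] cb[OF c0] R' by (intro bexI[of _ c0]) auto
  let ?u = "\<lambda>z. ln (norm (G z)) / n"
  define v where "v = (\<lambda>z. p z + \<kappa> - ?u z)"
  have v0: "v z \<ge> 0" if "z \<in> ball 0 R'" for z using ub[OF that] by (simp add: v_def)
  have ui: "set_integrable lborel (cball 0 R') ?u"
    using ln_norm_set_integrable[OF G nz R'(1)] by (rule set_integrable_divide) 
  have pi1: "set_integrable lborel (cball 0 R') p"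
    unfolding set_integrable_def using p by (intro borel_integrable_compact) auto
  have ki: "set_integrable lborel A (\<lambda>z. k :: real)" if "A \<in> sets lborel" "emeasure lborel A < \<infinity>" for A :: "complex set" and k
    using that unfolding set_integrable_def by auto
  have fin: "emeasure lborel (cball (a::complex) r) < \<infinity>" "emeasure lborel (ball (a::complex) r) < \<infinity>" for a r
    using emeasure_bounded_finite[of "cball a r"] emeasure_bounded_finite[of "ball a r"] by auto
  have vi: "set_integrable lborel (cball 0 R') v"
    unfolding v_def by (intro set_integral_diff set_integral_add pi1 ui ki fin) auto
  have sub: "set_integrable lborel A f" if "set_integrable lborel (cball 0 R') f" "A \<subseteq> cball 0 R'" "A \<in> sets lborel" for A and f :: "complex \<Rightarrow> real"
    using that by (intro set_integrable_subset[OF that(1)]) auto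
  have bC: "ball c d \<subseteq> cball 0 R'" if "c \<in> C" for c using C(5)[OF that] ball_subset_cball by blast
  have \<rho>sub: "cball 0 \<rho> \<subseteq> cball (0::complex) R'" using R' by (intro subset_cball) simp
  have one: "(LINT z:ball c d|lborel. v z) \<le> pi * d\<^sup>2 * (3 * \<kappa>)" if c: "c \<in> C" for c
  proof -
    have "(LINT z:ball c d|lborel. v z) = (LINT z:ball c d|lborel. p z + \<kappa>) - (LINT z:ball c d|lborel. ?u z)"
      unfolding v_def by (intro set_integral_diff(2) set_integral_add sub[OF pi1] sub[OF ui] bC[OF c] ki fin) auto
    moreover have "(LINT z:ball c d|lborel. p z + \<kappa>) \<le> (LINT z:ball c d|lborel. p c + 2 * \<kappa>)"
      by (intro set_integral_mono set_integral_add sub[OF pi1] bC[OF c] ki fin) (use osc[OF c] in \<open>auto simp: abs_le_iff\<close>, smt (verit) osc[OF c] mem_ball)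
    moreover have "(LINT z:ball c d|lborel. p c + 2 * \<kappa>) = pi * d\<^sup>2 * (p c + 2 * \<kappa>)"
      using C(2) unfolding set_lebesgue_integral_def by (simp add: measure_def emeasure_ball unit_ball_vol_2)
    moreover have "(LINT z:ball c d|lborel. ?u z) \<ge> pi * d\<^sup>2 * ?u c"
      using ln_norm_submean(2)[OF G nz R'(1) C(5)[OF c] C(2)] lb[OF c] n
      by (simp add: divide_simps mult.commute)
    moreover have "pi * d\<^sup>2 * ?u c \<ge> pi * d\<^sup>2 * (p c - \<kappa>)"
      using lb[OF c] by (intro mult_left_mono) auto
    ultimately show ?thesis by (simp add: algebra_simps)
  qed
  have "(LINT z:cball 0 \<rho>|lborel. v z) \<le> (\<integral>z. (\<Sum>c\<in>C. indicator (ball c d) z *\<^sub>R v z) \<partial>lborel)"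
    unfolding set_lebesgue_integral_def
  proof (rule integral_mono)
    show "integrable lborel (\<lambda>z. indicator (cball 0 \<rho>) z *\<^sub>R v z)"
      using sub[OF vi \<rho>sub] by (auto simp: set_integrable_def)
    show "integrable lborel (\<lambda>z. \<Sum>c\<in>C. indicator (ball c d) z *\<^sub>R v z)"
      using sub[OF vi bC] by (intro Bochner_Integration.integrable_sum) (auto simp: set_integrable_def)
    fix z
    have nn: "0 \<le> indicator (ball c d) z *\<^sub>R v z" if "c \<in> C" for c
      using v0[of z] C(5)[OF that] by (auto simp: indicator_def)
    show "indicator (cball 0 \<rho>) z *\<^sub>R v z \<le> (\<Sum>c\<in>C. indicator (ball c d) z *\<^sub>R v z)"
    proof (cases "z \<in> cball 0 \<rho>")
      case True
      then obtain c where c: "c \<in> C" "z \<in> ball c d" using C(4) by blast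
      then have "indicator (cball 0 \<rho>) z *\<^sub>R v z = indicator (ball c d) z *\<^sub>R v z" using True by simp
      also have "\<dots> \<le> (\<Sum>c\<in>C. indicator (ball c d) z *\<^sub>R v z)"
        by (intro member_le_sum c C nn) auto
      finally show ?thesis .
    qed (use nn in \<open>auto intro: sum_nonneg\<close>)
  qed
  also have "\<dots> = (\<Sum>c\<in>C. LINT z:ball c d|lborel. v z)"
    unfolding set_lebesgue_integral_def using sub[OF vi bC]
    by (intro Bochner_Integration.integral_sum) (auto simp: set_integrable_def)
  also have "\<dots> \<le> (\<Sum>c\<in>C. pi * d\<^sup>2 * (3 * \<kappa>))" by (intro sum_mono one)
  also have "\<dots> = (card C * d\<^sup>2) * (3 * pi * \<kappa>)" by simp
  also have "\<dots> \<le> K * (3 * pi * \<kappa>)" using C(3) \<kappa> by (intro mult_right_mono) auto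
  finally have V: "(LINT z:cball 0 \<rho>|lborel. v z) \<le> K * (3 * pi * \<kappa>)" .
  have \<rho>i: "set_integrable lborel (cball 0 \<rho>) f" if "set_integrable lborel (cball 0 R') f" for f :: "complex \<Rightarrow> real"
    using sub[OF that \<rho>sub] by auto
  \<comment> \<open>Passing from \<open>v\<close> to the absolute value costs another
    \<open>\<kappa>\<close> on the disc, the source of \<open>pi * \<rho>\<^sup>2\<close>.\<close>
  have "(LINT z:cball 0 \<rho>|lborel. \<bar>?u z - p z\<bar>) \<le> (LINT z:cball 0 \<rho>|lborel. v z + \<kappa>)"
  proof (intro set_integral_mono set_integral_add(1) \<rho>i vi ki fin set_integrable_abs set_integral_diff(1) ui pi1)
    fix z :: complex assume "z \<in> cball 0 \<rho>"
    then have "z \<in> ball 0 R'" using R' by auto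
    from ub[OF this] show "\<bar>?u z - p z\<bar> \<le> v z + \<kappa>" unfolding v_def using \<kappa> by linarith
  qed auto
  also have "\<dots> = (LINT z:cball 0 \<rho>|lborel. v z) + (LINT z:cball (0::complex) \<rho>|lborel. \<kappa>)"
    by (intro set_integral_add \<rho>i vi ki fin) auto
  also have "(LINT z:cball (0::complex) \<rho>|lborel. \<kappa>) = pi * \<rho>\<^sup>2 * \<kappa>"
    using \<rho> unfolding set_lebesgue_integral_def by (simp add: measure_def emeasure_cball unit_ball_vol_2)
  finally show ?thesis using V by (simp add: algebra_simps)
qed

section \<open>Integrals against zero-counting measures\<close>

lemma integral_scale_measure:
  fixes f :: "'a \<Rightarrow> real"
  assumes "c \<ge> 0"
  shows "integral\<^sup>L (scale_measure (ennreal c) N) f = c * integral\<^sup>L N f"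
proof (cases "f \<in> borel_measurable N")
  case True
  have "scale_measure (ennreal c) N = density N (\<lambda>_. ennreal c)"
    by (rule measure_eqI) (auto simp: emeasure_density_const)
  then show ?thesis using True assms by (simp add: integral_density)
next
  case False
  then have "\<not> integrable N f" "\<not> integrable (scale_measure (ennreal c) N) f"
    by (auto simp: integrable_iff_bounded)
  then show ?thesis by (simp add: not_integrable_integral_eq)
qed

text \<open>\<open>D\<close> may contain infinitely many zeros, but only those in \<open>K\<close>
  count, so the integral is a finite sum.\<close>

lemma integral_zero_measure:
  fixes f :: "complex \<Rightarrow> real"
  assumes G: "G analytic_on D" "\<exists>z\<in>D. G z \<noteq> 0"
    and f: "f \<in> borel_measurable (restrict_space borel D)" "\<And>z. z \<in> D - K \<Longrightarrow> f z = 0"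
    and K: "K \<subseteq> D" "finite {z\<in>K. G z = 0}"
  shows "integral\<^sup>L (zero_measure D G) f = (\<Sum>a\<in>{z\<in>K. G z = 0}. nat (zorder G a) * f a)"
proof -
  let ?Z = "{z\<in>D. G z = 0}"
  have "integral\<^sup>L (zero_measure D G) f = (\<integral>z. f z \<partial>point_measure ?Z (\<lambda>z. of_nat (nat (zorder G z))))"
    unfolding zero_measure_def using G f(1)
    by (simp, subst integral_distr) (auto simp: measurable_point_measure_eq1 space_restrict_space)
  also have "\<dots> = (\<integral>z. f z \<partial>density (count_space ?Z) (\<lambda>z. ennreal (real (nat (zorder G z)))))"
    by (simp add: point_measure_def ennreal_of_nat_eq_real_of_nat)
  also have "\<dots> = (\<integral>z. real (nat (zorder G z)) * f z \<partial>count_space ?Z)"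
    by (subst integral_density) auto
  also have "\<dots> = (\<Sum>z | z \<in> ?Z \<and> real (nat (zorder G z)) * f z \<noteq> 0. real (nat (zorder G z)) * f z)"
    using f(2) by (intro lebesgue_integral_count_space_finite_support finite_subset[OF _ K(2)]) auto
  also have "\<dots> = (\<Sum>a\<in>{z\<in>K. G z = 0}. nat (zorder G a) * f a)"
    using f(2) K by (intro sum.mono_neutral_left) auto
  finally show ?thesis .
qed

section \<open>The limiting potential\<close>

text \<open>The last assumption is the weak form of \<open>\<Delta> p = 2 * pi * \<rho>\<close>.\<close>

locale limit_potential =
  fixes D :: "complex set" and p \<rho> :: "complex \<Rightarrow> real"
  assumes D: "D = UNIV \<or> D = ball 0 1"
    and p_continuous: "continuous_on D p"
    and \<rho>_nonneg: "\<And>z. \<rho> z \<ge> 0"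
    and density_measurable [measurable]: "\<rho> \<in> borel_measurable borel"
    and density_integrable: "\<And>r. cball 0 r \<subseteq> D \<Longrightarrow> set_integrable lborel (cball 0 r) \<rho>"
    and potential: "\<And>r s \<phi>. supported_in r \<phi> \<Longrightarrow> s > 0 \<Longrightarrow> r > 0 \<Longrightarrow> cball 0 (r + s) \<subseteq> D \<Longrightarrow>
      (\<integral>z. p z * circle_difference s \<phi> z \<partial>lborel) = (\<integral>a. regularization s \<phi> a * \<rho> a \<partial>lborel)"
begin

lemma open_D: "open D" and connected_D: "connected D" and zero_in_D: "0 \<in> D"
  using D by auto

text \<open>By the identity theorem: a function vanishing near 0 vanishes on all of the connected
  set \<open>D\<close>.\<close>

lemma nonzero_on_ball:
  assumes G: "G holomorphic_on D" "\<exists>z\<in>D. G z \<noteq> 0" and R: "cball 0 R \<subseteq> D" "R > 0"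
  shows "\<exists>z\<in>ball 0 R. G z \<noteq> 0"
proof (rule ccontr)
  assume "\<not> ?thesis"
  then have z: "\<And>z. z \<in> ball 0 R \<Longrightarrow> G z = 0" by blast
  have "G w = 0" if "w \<in> D" for w
  proof (rule analytic_continuation_open[of "ball 0 R" D G "\<lambda>_. 0", OF _ open_D _ connected_D _ G(1) _ z that])
    show "ball 0 R \<subseteq> D" using R ball_subset_cball by blast
    show "ball 0 R \<noteq> ({} :: complex set)" using R by simp
  qed simp_all
  with G(2) show False by blast
qed

lemma supported_density_integrable:
  assumes f: "f \<in> borel_measurable borel" "\<And>z. \<bar>f z\<bar> \<le> B" "\<And>z. norm z > r \<Longrightarrow> f z = 0" and r: "cball 0 r \<subseteq> D"
  shows "integrable lborel (\<lambda>z. f z * \<rho> z)"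
proof -
  note [measurable] = f(1)
  have i: "integrable lborel (\<lambda>z. B * (indicator (cball 0 r) z * \<rho> z))"
    using density_integrable[OF r] unfolding set_integrable_def by (intro integrable_mult_right) simp
  have bd: "norm (f z * \<rho> z) \<le> norm (B * (indicator (cball 0 r) z * \<rho> z))" for z
  proof (cases "norm z \<le> r")
    case True
    have "\<bar>f z\<bar> * \<rho> z \<le> \<bar>B\<bar> * \<rho> z"
      using order_trans[OF f(2)[of z] abs_ge_self] \<rho>_nonneg[of z] by (rule mult_right_mono)
    then show ?thesis using True \<rho>_nonneg[of z] by (simp add: abs_mult)
  next
    case False
    then show ?thesis using f(3)[of z] by simp
  qed
  show ?thesis
    by (rule Bochner_Integration.integrable_bound[OF i]) (simp_all only: bd AE_I2, measurable)
qed

text \<open>The threshold \<open>\<kappa>\<close> is chosen before \<open>G\<close> and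
  \<open>n\<close>. Regularized test functions compare at once, since their zero sums and density
  integrals are integrals of the two potentials against the same bounded weight. Replacing
  \<open>\<phi>\<close> by its regularization costs its oscillation times the number of zeros per
  \<open>n\<close>, so that number is bounded first, with the cut-off \<open>\<eta>\<close>.\<close>

lemma zeros_close_to_density:
  fixes \<phi> :: "complex \<Rightarrow> real"
  assumes \<phi>: "supported_in r \<phi>" and r: "r > 0" and e: "e > 0" and rD: "cball 0 (r + 5 * e) \<subseteq> D" and \<epsilon>: "\<epsilon> > 0"
  obtains \<kappa> where "\<kappa> > 0"
    "\<And>G n. \<lbrakk>G holomorphic_on D; \<exists>z\<in>D. G z \<noteq> 0; n > (0::real);
      (LINT z:cball 0 (r + 4 * e)|lborel. \<bar>ln (norm (G z)) / n - p z\<bar>) \<le> \<kappa>\<rbrakk> \<Longrightarrow>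
      \<bar>(\<Sum>a\<in>{z\<in>cball 0 (r + 4 * e). G z = 0}. nat (zorder G a) * \<phi> a) / n - (\<integral>z. \<phi> z * \<rho> z \<partial>lborel)\<bar> \<le> \<epsilon>"
proof -
  define R where "R = r + 4 * e"
  have RD: "cball 0 R \<subseteq> D" using rD e by (auto simp: R_def)
  define L where "L = (\<lambda>f. \<integral>z. f z * \<rho> z \<partial>lborel)"
  \<comment> \<open>Equal to 1 up to radius \<open>r + 2 * e\<close>, so its regularization at scale
    \<open>e / 2\<close> is constant on \<open>cball 0 (r + e)\<close>, where the zeros are to be
    counted.\<close>
  define \<eta> where "\<eta> = (\<lambda>z::complex. max 0 (min 1 ((r + 3 * e - norm z) / e)))"
  have \<eta>: "supported_in (r + 3 * e) \<eta>" "\<And>z. 0 \<le> \<eta> z" "\<And>z. \<bar>\<eta> z\<bar> \<le> 1" "\<And>z. norm z \<le> r + 2 * e \<Longrightarrow> \<eta> z = 1"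
  proof -
    have "\<eta> z = 0" if "norm z > r + 3 * e" for z
    proof -
      have "(r + 3 * e - norm z) / e \<le> 0" using that e by (simp add: divide_le_0_iff)
      then show ?thesis by (simp add: \<eta>_def)
    qed
    moreover have "continuous_on UNIV \<eta>"
      unfolding \<eta>_def using e by (intro continuous_intros) simp
    ultimately show "supported_in (r + 3 * e) \<eta>" by (simp add: supported_in_def)
    show "\<eta> z = 1" if "norm z \<le> r + 2 * e" for z
    proof -
      have "1 \<le> (r + 3 * e - norm z) / e" using that e by (simp add: le_divide_eq)
      then show ?thesis by (simp add: \<eta>_def)
    qed
  qed (simp_all add: \<eta>_def)
  define c1 where "c1 = annular_mass (e/2)"
  have c1: "c1 > 0" using annular_mass_pos[of "e/2"] e by (simp add: c1_def)
  define X where "X = regularization (e/2) \<eta>"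
  have X0: "X z \<ge> 0" for z unfolding X_def using e by (intro regularization_nonneg \<eta>) auto
  have X1: "X a = c1" if "norm a \<le> r + e" for a
  proof -
    have "\<bar>\<eta> w - 1\<bar> \<le> 0" if "norm (w - a) \<le> e/2" for w
      using that \<open>norm a \<le> r + e\<close> norm_triangle_sub[of w a] e by (subst \<eta>(4)) auto
    from regularization_approx[OF \<eta>(1) _ this] e show ?thesis by (simp add: X_def c1_def)
  qed
  \<comment> \<open>Bound for the number of zeros in \<open>cball 0 (r + e)\<close> divided by
    \<open>n\<close>; the summand 1 is the error \<open>2 * \<kappa>\<close> allowed when the
    regularized cut-off is compared.\<close>
  define M0 where "M0 = (L X + 1) / c1"
  have LX: "L X \<ge> 0" unfolding L_def using X0 \<rho>_nonneg by (intro Bochner_Integration.integral_nonneg) simp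
  then have M0: "M0 > 0" using c1 by (simp add: M0_def)
  define M1 where "M1 = L (indicator (cball 0 (r + e)))"
  have M1: "M1 \<ge> 0" unfolding M1_def L_def using \<rho>_nonneg by (intro Bochner_Integration.integral_nonneg) simp
  \<comment> \<open>The regularization error is weighted by the zeros, at most \<open>M0\<close>,
    and by the density, of mass \<open>M1\<close>; together they use half of
    \<open>\<epsilon>\<close>.\<close>
  define \<omega> where "\<omega> = \<epsilon> / (2 * (M0 + M1))"
  have \<omega>: "\<omega> > 0" using \<epsilon> M0 M1 by (simp add: \<omega>_def)
  obtain B where B: "B > 0" "\<And>z. \<bar>\<phi> z\<bar> \<le> B" using supported_in_bounded[OF \<phi>] by blast
  have "continuous_on (cball 0 (r + 2 * e)) \<phi>"
    using \<phi> continuous_on_subset unfolding supported_in_def by blast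
  then have uc: "uniformly_continuous_on (cball 0 (r + 2 * e)) \<phi>"
    by (rule compact_uniformly_continuous) simp
  obtain d where d: "d > 0" "\<And>z w. z \<in> cball 0 (r + 2 * e) \<Longrightarrow> w \<in> cball 0 (r + 2 * e) \<Longrightarrow> dist w z < d \<Longrightarrow> dist (\<phi> w) (\<phi> z) < \<omega>"
    using uc[unfolded uniformly_continuous_on_def, rule_format, OF \<omega>] by blast
  define s where "s = min (d / 2) e"
  have s: "s > 0" "s < d" "s \<le> e" using d e by (auto simp: s_def)
  have close: "\<bar>\<phi> w - \<phi> a\<bar> \<le> \<omega>" if "norm (w - a) \<le> s" for w a
  proof (cases "norm a \<le> r + e")
    case True
    then have "norm w \<le> r + 2 * e" using that s norm_triangle_sub[of w a] by auto
    then show ?thesis using d(2)[of a w] True that s e by (auto simp: dist_norm dist_real_def)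
  next
    case False
    then have "norm w > r" using that s norm_triangle_sub[of a w] by (auto simp: norm_minus_commute)
    then have "\<phi> w = 0" "\<phi> a = 0" using \<phi> False e by (auto simp: supported_in_def)
    then show ?thesis using \<omega> by simp
  qed
  define c where "c = annular_mass s"
  have c: "c > 0" using annular_mass_pos[OF s(1)] by (simp add: c_def)
  define Y where "Y = regularization s \<phi>"
  have Y: "\<bar>Y a - c * \<phi> a\<bar> \<le> c * (\<omega> * indicator (cball 0 (r + e)) a)" for a
  proof (cases "norm a \<le> r + e")
    case True
    then show ?thesis using regularization_approx[OF \<phi> s(1) close] by (simp add: Y_def c_def)
  next
    case False
    then have "Y a = 0" unfolding Y_def using s by (intro regularization_eq_0[OF \<phi>]) auto
    then show ?thesis using \<phi> False e by (auto simp: supported_in_def)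
  qed
  \<comment> \<open>The term \<open>1 / 2\<close> serves the zero count; the other one uses up the
    second half of \<open>\<epsilon>\<close> after division by the mass \<open>c\<close>.\<close>
  define \<kappa> where "\<kappa> = min (1/2) (c * \<epsilon> / (4 * B))"
  have \<kappa>: "\<kappa> > 0" "\<kappa> \<le> 1/2" "2 * B * \<kappa> \<le> c * \<epsilon> / 2"
  proof -
    have "2 * B * \<kappa> \<le> 2 * B * (c * \<epsilon> / (4 * B))" using B(1) unfolding \<kappa>_def by (intro mult_left_mono min.cobounded2) simp
    also have "\<dots> = c * \<epsilon> / 2" using B(1) by simp
    finally show "2 * B * \<kappa> \<le> c * \<epsilon> / 2" .
    have "c * \<epsilon> / (4 * B) > 0" using c \<epsilon> B(1) by simp
    then show "\<kappa> > 0" unfolding \<kappa>_def by simp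
    show "\<kappa> \<le> 1/2" unfolding \<kappa>_def by (rule min.cobounded1)
  qed
  note [measurable] = supported_in_measurable[OF \<phi>]
  have [measurable]: "Y \<in> borel_measurable borel" "X \<in> borel_measurable borel"
    unfolding Y_def X_def using regularization_measurable[OF \<phi> s(1)] regularization_measurable[OF \<eta>(1), of "e/2"] e by auto
  have Yb: "\<bar>Y a\<bar> \<le> c * \<omega> + c * B" for a
  proof -
    have "c * (\<omega> * indicator (cball 0 (r + e)) a) \<le> c * \<omega>" using c \<omega> by (auto simp: indicator_def)
    moreover have "\<bar>c * \<phi> a\<bar> \<le> c * B" using B c by (simp add: abs_mult)
    ultimately show ?thesis using Y[of a] by linarith
  qed
  have Yz: "Y a = 0" if "norm a > r + e" for a
    unfolding Y_def using s that by (intro regularization_eq_0[OF \<phi>]) auto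
  have reD: "cball 0 (r + e) \<subseteq> D" using rD e by auto
  have iY: "integrable lborel (\<lambda>z. Y z * \<rho> z)" by (rule supported_density_integrable[OF _ Yb Yz reD]) auto
  have i\<phi>: "integrable lborel (\<lambda>z. \<phi> z * \<rho> z)"
    by (rule supported_density_integrable[OF _ B(2) _ reD]) (use \<phi> e in \<open>auto simp: supported_in_def\<close>)
  have iI: "integrable lborel (\<lambda>z. indicator (cball 0 (r + e)) z * \<rho> z)"
    by (rule supported_density_integrable[of _ 1 "r + e"]) (use reD in \<open>auto simp: indicator_def\<close>)
  have LY: "\<bar>L Y - c * L \<phi>\<bar> \<le> c * \<omega> * M1"
  proof -
    have "L Y - c * L \<phi> = (\<integral>z. (Y z - c * \<phi> z) * \<rho> z \<partial>lborel)"
      unfolding L_def left_diff_distrib mult.assoc using iY i\<phi> by simp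
    also have "norm \<dots> \<le> (\<integral>z. c * \<omega> * (indicator (cball 0 (r + e)) z * \<rho> z) \<partial>lborel)"
    proof (rule Bochner_Integration.integral_norm_bound_integral)
      show "integrable lborel (\<lambda>z. (Y z - c * \<phi> z) * \<rho> z)"
        unfolding left_diff_distrib mult.assoc using iY i\<phi> by simp
      show "integrable lborel (\<lambda>z. c * \<omega> * (indicator (cball 0 (r + e)) z * \<rho> z))" using iI by simp
      fix z
      have "\<bar>Y z - c * \<phi> z\<bar> * \<rho> z \<le> c * (\<omega> * indicator (cball 0 (r + e)) z) * \<rho> z"
        using Y[of z] \<rho>_nonneg[of z] by (intro mult_right_mono)
      then show "norm ((Y z - c * \<phi> z) * \<rho> z) \<le> c * \<omega> * (indicator (cball 0 (r + e)) z * \<rho> z)"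
        using \<rho>_nonneg[of z] by (simp add: abs_mult mult.assoc)
    qed
    also have "\<dots> = c * \<omega> * M1" by (simp add: M1_def L_def)
    finally show ?thesis by simp
  qed
  show thesis
  proof (rule that[OF \<kappa>(1)])
    fix G and n :: real
    assume GD: "G holomorphic_on D" "\<exists>z\<in>D. G z \<noteq> 0" and n: "n > 0"
      and close: "(LINT z:cball 0 (r + 4 * e)|lborel. \<bar>ln (norm (G z)) / n - p z\<bar>) \<le> \<kappa>"
    have G: "G holomorphic_on ball 0 (r + 5 * e)"
      by (rule holomorphic_on_subset[OF GD(1)]) (use rD ball_subset_cball in blast)
    have Gnz: "\<exists>z\<in>ball 0 (r + 5 * e). G z \<noteq> 0"
      by (rule nonzero_on_ball[OF GD rD]) (use r e in simp)
    define Z where "Z = {z\<in>cball 0 R. G z = 0}"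
    have fZ: "finite Z" unfolding Z_def by (rule holomorphic_finite_zeros_ball[OF G Gnz]) (use e in \<open>simp add: R_def\<close>)
    define N :: "(complex \<Rightarrow> real) \<Rightarrow> real" where "N = (\<lambda>f. (\<Sum>a\<in>Z. real (nat (zorder G a)) * f a) / n)"
    have N_mono: "N f \<le> N g" if "\<And>a. a \<in> Z \<Longrightarrow> f a \<le> g a" for f g
      unfolding N_def using n that by (intro divide_right_mono sum_mono mult_left_mono) auto
    have N_cmult: "N (\<lambda>a. k * f a) = k * N f" for k f
      by (simp add: N_def sum_distrib_left mult.left_commute)
    have N_diff: "N (\<lambda>a. f a - g a) = N f - N g" for f g
      by (simp add: N_def sum_subtractf right_diff_distrib diff_divide_distrib)
    \<comment> \<open>Zero sum and density integral are integrals against the same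
      \<open>circle_difference\<close>, bounded by \<open>2 * b\<close>; hence the mean distance of
      the potentials controls their difference.\<close>
    have main: "\<bar>N (regularization t f) - L (regularization t f)\<bar> \<le> 2 * b * \<kappa>"
      if f: "supported_in r' f" "\<And>z. \<bar>f z\<bar> \<le> b" and t: "t > 0" "r' + t < R" "r' > 0" for f b t r'
    proof -
      let ?w = "circle_difference t f"
      have b0: "b \<ge> 0" using order_trans[OF abs_ge_zero f(2)[of 0]] .
      have [measurable]: "?w \<in> borel_measurable borel" by (rule circle_difference_measurable[OF f(1)])
      have w0: "?w z = 0" if "z \<notin> cball 0 R" for z using that t by (intro circle_difference_eq_0[OF f(1)]) auto
      have wb: "\<bar>?w z\<bar> \<le> 2 * b" for z by (rule circle_difference_bound[OF f])
      have iu: "set_integrable lborel (cball 0 R) (\<lambda>z. ln (norm (G z)) / n)"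
        by (intro set_integrable_divide ln_norm_set_integrable[OF G Gnz]) (use e in \<open>simp add: R_def\<close>)
      have ip: "set_integrable lborel (cball 0 R) p"
        unfolding set_integrable_def using p_continuous RD by (intro borel_integrable_compact continuous_on_subset[OF p_continuous]) auto
      have I: "integrable lborel (\<lambda>z. h z * ?w z)" if "set_integrable lborel (cball 0 R) h" for h
      proof -
        have i: "integrable lborel (\<lambda>z. indicator (cball 0 R) z * h z)" using that by (simp add: set_integrable_def)
        have "integrable lborel (\<lambda>z. (indicator (cball 0 R) z * h z) * ?w z)"
        proof (rule Bochner_Integration.integrable_bound[OF integrable_mult_right[OF integrable_abs[OF i], of "2 * b"]])
          show "AE z in lborel. norm (indicator (cball 0 R) z * h z * ?w z) \<le> norm (2 * b * \<bar>indicator (cball 0 R) z * h z\<bar>)"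
          proof (intro AE_I2)
            fix z
            have "\<bar>indicator (cball 0 R) z * h z\<bar> * \<bar>?w z\<bar> \<le> \<bar>indicator (cball 0 R) z * h z\<bar> * (2 * b)"
              by (rule mult_left_mono[OF wb]) simp
            then show "norm (indicator (cball 0 R) z * h z * ?w z) \<le> norm (2 * b * \<bar>indicator (cball 0 R) z * h z\<bar>)"
              using b0 by (simp add: abs_mult mult_ac)
          qed
          show "(\<lambda>z. indicator (cball 0 R) z * h z * ?w z) \<in> borel_measurable lborel"
            using borel_measurable_integrable[OF i] by measurable
        qed
        also have "(\<lambda>z. (indicator (cball 0 R) z * h z) * ?w z) = (\<lambda>z. h z * ?w z)"
          using w0 by (auto simp: fun_eq_iff indicator_def)
        finally show ?thesis .
      qed
      have "N (regularization t f) = (\<integral>z. ln (norm (G z)) * ?w z \<partial>lborel) / n"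
        unfolding N_def Z_def by (subst integral_ln_circle_difference[OF G Gnz f(1) t(1,2)]) (use e in \<open>auto simp: R_def\<close>)
      also have "\<dots> = (\<integral>z. ln (norm (G z)) / n * ?w z \<partial>lborel)" by simp
      finally have 1: "N (regularization t f) = (\<integral>z. ln (norm (G z)) / n * ?w z \<partial>lborel)" .
      have "cball 0 (r' + t) \<subseteq> D" using t RD by auto
      from potential[OF f(1) t(1,3) this]
      have 2: "L (regularization t f) = (\<integral>z. p z * ?w z \<partial>lborel)" by (simp add: L_def)
      have "N (regularization t f) - L (regularization t f) = (\<integral>z. (ln (norm (G z)) / n - p z) * ?w z \<partial>lborel)"
        unfolding 1 2 left_diff_distrib using I[OF iu] I[OF ip] by simp
      also have "norm \<dots> \<le> (\<integral>z. 2 * b * (indicator (cball 0 R) z *\<^sub>R \<bar>ln (norm (G z)) / n - p z\<bar>) \<partial>lborel)"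
      proof (rule Bochner_Integration.integral_norm_bound_integral)
        have "set_integrable lborel (cball 0 R) (\<lambda>z. \<bar>ln (norm (G z)) / n - p z\<bar>)"
          by (intro set_integrable_abs set_integral_diff iu ip)
        then show "integrable lborel (\<lambda>z. 2 * b * (indicator (cball 0 R) z *\<^sub>R \<bar>ln (norm (G z)) / n - p z\<bar>))"
          unfolding set_integrable_def by (rule integrable_mult_right)
        show "integrable lborel (\<lambda>z. (ln (norm (G z)) / n - p z) * ?w z)"
          unfolding left_diff_distrib using I[OF iu] I[OF ip] by simp
        fix z
        show "norm ((ln (norm (G z)) / n - p z) * ?w z) \<le> 2 * b * (indicator (cball 0 R) z *\<^sub>R \<bar>ln (norm (G z)) / n - p z\<bar>)"
        proof (cases "z \<in> cball 0 R")
          case True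
          have "\<bar>ln (norm (G z)) / n - p z\<bar> * \<bar>?w z\<bar> \<le> \<bar>ln (norm (G z)) / n - p z\<bar> * (2 * b)"
            by (rule mult_left_mono[OF wb]) simp
          then show ?thesis unfolding real_norm_def abs_mult using True by (simp only: indicator_simps scaleR_one mult.commute)
        qed (simp add: w0)
      qed
      also have "\<dots> \<le> 2 * b * \<kappa>"
        using close b0 unfolding set_lebesgue_integral_def R_def by (simp add: mult_left_mono)
      finally show ?thesis by simp
    qed
    have "\<bar>N X - L X\<bar> \<le> 2 * 1 * \<kappa>" unfolding X_def
      by (rule main[OF \<eta>(1,3)]) (use e r in \<open>auto simp: R_def\<close>)
    then have NX: "N X \<le> L X + 1" using \<kappa> by linarith
    have "c1 * N (indicator (cball 0 (r + e))) = N (\<lambda>a. c1 * indicator (cball 0 (r + e)) a)" by (simp add: N_cmult)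
    also have "\<dots> \<le> N X" using X0 X1 by (intro N_mono) (auto simp: indicator_def)
    finally have N1: "N (indicator (cball 0 (r + e))) \<le> M0"
      using NX c1 by (simp add: M0_def field_simps)
    have "N (\<lambda>a. Y a - c * \<phi> a) \<le> N (\<lambda>a. c * (\<omega> * indicator (cball 0 (r + e)) a))" 
      by (rule N_mono) (rule abs_le_D1[OF Y])
    moreover have "N (\<lambda>a. c * \<phi> a - Y a) \<le> N (\<lambda>a. c * (\<omega> * indicator (cball 0 (r + e)) a))"
      by (rule N_mono) (use abs_le_D2[OF Y] in simp)
    ultimately have "\<bar>N Y - c * N \<phi>\<bar> \<le> c * \<omega> * N (indicator (cball 0 (r + e)))"
      unfolding N_diff N_cmult by (simp add: abs_le_iff mult.assoc)
    also have "\<dots> \<le> c * \<omega> * M0" using N1 c \<omega> by (intro mult_left_mono) auto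
    finally have NY: "\<bar>N Y - c * N \<phi>\<bar> \<le> c * \<omega> * M0" .
    have NL: "\<bar>N Y - L Y\<bar> \<le> 2 * B * \<kappa>" unfolding Y_def
      by (rule main[OF \<phi> B(2)]) (use s e r in \<open>auto simp: R_def\<close>)
    have om: "c * \<omega> * (M0 + M1) = c * \<epsilon> / 2" 
    proof -
      have "c * (\<epsilon> / (2 * x)) * x = c * \<epsilon> / 2" if "x \<noteq> 0" for x using that by simp
      moreover have "M0 + M1 \<noteq> 0" using M0 M1 by linarith
      ultimately show ?thesis unfolding \<omega>_def by blast
    qed
    have "c * \<bar>N \<phi> - L \<phi>\<bar> = \<bar>c * N \<phi> - c * L \<phi>\<bar>" using c by (simp add: abs_mult flip: right_diff_distrib)
    also have "\<dots> \<le> c * \<omega> * M0 + 2 * B * \<kappa> + c * \<omega> * M1" using NY NL LY by linarith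
    also have "\<dots> \<le> c * \<epsilon>" using om \<kappa>(3) by (simp add: distrib_left)
    finally have "\<bar>N \<phi> - L \<phi>\<bar> \<le> \<epsilon>" using c by simp
    then show "\<bar>(\<Sum>a\<in>{z\<in>cball 0 (r + 4 * e). G z = 0}. nat (zorder G a) * \<phi> a) / n - (\<integral>z. \<phi> z * \<rho> z \<partial>lborel)\<bar> \<le> \<epsilon>"
      by (simp add: N_def L_def Z_def R_def)
  qed
qed

end

text \<open>
  \<open>m t\<close> is the mass of the disc of radius \<open>t\<close>. The integrand is shifted by \<open>ln R\<close> to make it
  nonnegative.
\<close>

lemma radial_log_integral:
  fixes q m d :: "real \<Rightarrow> real"
  assumes q: "\<And>t. 0 < t \<Longrightarrow> t \<le> R \<Longrightarrow> (q has_real_derivative m t / t) (at t)"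
    and m: "\<And>t. 0 < t \<Longrightarrow> t \<le> R \<Longrightarrow> (m has_real_derivative d t) (at t)"
    and d: "\<And>t. 0 < t \<Longrightarrow> t \<le> R \<Longrightarrow> isCont d t" "\<And>t. d t \<ge> 0"
    and m0: "(m \<longlongrightarrow> 0) (at_right 0)" and [measurable]: "d \<in> borel_measurable borel" and r: "0 < r" "r < R"
  shows "integrable lborel (\<lambda>t. indicator {0<..<R} t * ((ln R - ln (max r t)) * d t))"
    "(\<integral>t. indicator {0<..<R} t * ((ln R - ln (max r t)) * d t) \<partial>lborel) = q R - q r"
    "integrable lborel (\<lambda>t. indicator {0<..<R} t * d t)"
proof -
  have mc: "isCont m t" and qc: "isCont q t" if "0 < t" "t \<le> R" for t
    using m[OF that] q[OF that] DERIV_isCont by blast+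
  have lim_left: "((F \<circ> real_of_ereal) \<longlongrightarrow> F b) (at_left (ereal b))" if "isCont F b" for F :: "real \<Rightarrow> real" and b
    using that unfolding ereal_tendsto_simps by (simp add: isCont_def filterlim_at_split)
  have lim_right: "((F \<circ> real_of_ereal) \<longlongrightarrow> F b) (at_right (ereal b))" if "isCont F b" for F :: "real \<Rightarrow> real" and b
    using that unfolding ereal_tendsto_simps by (simp add: isCont_def filterlim_at_split)
  have ei: "einterval (ereal a) (ereal b) = {a<..<b}" for a b by (simp add: einterval_eq)
  have A: "set_integrable lborel {0<..<T} d" "(LBINT t=ereal 0..ereal T. d t) = m T - 0" if T: "0 < T" "T \<le> R" for T
  proof -
    have m0': "((m \<circ> real_of_ereal) \<longlongrightarrow> 0) (at_right (ereal 0))"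
      using m0 unfolding ereal_tendsto_simps .
    note FTC = interval_integral_FTC_nonneg[where a="ereal 0" and b="ereal T" and F=m and f=d and A=0 and B="m T",
        OF _ _ _ _ m0' lim_left[OF mc[OF T]]]
    show "set_integrable lborel {0<..<T} d" "(LBINT t=ereal 0..ereal T. d t) = m T - 0"
      using FTC T m d unfolding ei by auto
  qed
  have lnnn: "ln R - ln t \<ge> 0" if "0 < t" "t < R" for t using that by simp
  \<comment> \<open>Integration by parts: differentiating \<open>ln t\<close> produces
    \<open>- m t / t\<close>, which the derivative of \<open>q\<close> cancels.\<close>
  define F where "F = (\<lambda>t. (ln R - ln t) * m t + q t)"
  have F: "(F has_real_derivative (ln R - ln t) * d t) (at t)" if "0 < t" "t \<le> R" for t
    unfolding F_def using that by (auto intro!: derivative_eq_intros m q simp: field_simps)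
  have fc: "isCont (\<lambda>t. (ln R - ln t) * d t) t" if "0 < t" "t \<le> R" for t
    using that by (intro continuous_intros d(1)) auto
  have B: "set_integrable lborel {r<..<R} (\<lambda>t. (ln R - ln t) * d t)" "(LBINT t=ereal r..ereal R. (ln R - ln t) * d t) = F R - F r"
  proof -
    have "isCont F r" "isCont F R" using F r DERIV_isCont by (metis less_imp_le order_refl order_less_trans)+
    note FTC = interval_integral_FTC_nonneg[where a="ereal r" and b="ereal R" and F=F and f="\<lambda>t. (ln R - ln t) * d t",
        OF _ _ _ _ lim_right[OF this(1)] lim_left[OF this(2)]]
    show "set_integrable lborel {r<..<R} (\<lambda>t. (ln R - ln t) * d t)" "(LBINT t=ereal r..ereal R. (ln R - ln t) * d t) = F R - F r"
      using FTC r F d(2) fc lnnn unfolding ei by auto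
  qed
  show "integrable lborel (\<lambda>t. indicator {0<..<R} t * d t)"
    using A(1)[of R] r by (simp add: set_integrable_def)
  have i1: "integrable lborel (\<lambda>t. (ln R - ln r) * (indicator {0<..<r} t * d t))"
    using A(1)[of r] r by (simp add: set_integrable_def)
  have i2: "integrable lborel (\<lambda>t. indicator {r<..<R} t * ((ln R - ln t) * d t))"
    using B(1) by (simp add: set_integrable_def)
  \<comment> \<open>The kernel is constant for \<open>t < r\<close> and logarithmic beyond; the
    terms with \<open>m r\<close> cancel in the end, and \<open>F R = q R\<close>.\<close>
  have eq: "AE t in lborel. (ln R - ln r) * (indicator {0<..<r} t * d t) + indicator {r<..<R} t * ((ln R - ln t) * d t)
    = indicator {0<..<R} t * ((ln R - ln (max r t)) * d t)"
    using AE_lborel_singleton[of r] by eventually_elim (use r in \<open>auto simp: indicator_def max_def\<close>)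
  show "integrable lborel (\<lambda>t. indicator {0<..<R} t * ((ln R - ln (max r t)) * d t))"
    by (rule integrable_cong_AE_imp[OF Bochner_Integration.integrable_add[OF i1 i2] _ eq]) measurable
  have "(\<integral>t. indicator {0<..<R} t * ((ln R - ln (max r t)) * d t) \<partial>lborel)
    = (\<integral>t. (ln R - ln r) * (indicator {0<..<r} t * d t) + indicator {r<..<R} t * ((ln R - ln t) * d t) \<partial>lborel)"
    using eq by (intro integral_cong_AE) auto
  also have "\<dots> = (ln R - ln r) * (\<integral>t. indicator {0<..<r} t * d t \<partial>lborel) + (\<integral>t. indicator {r<..<R} t * ((ln R - ln t) * d t) \<partial>lborel)"
    using i1 i2 by simp
  also have "(\<integral>t. indicator {0<..<r} t * d t \<partial>lborel) = m r"
    using A(2)[of r] r by (simp add: interval_lebesgue_integral_def set_lebesgue_integral_def einterval_eq)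
  also have "(\<integral>t. indicator {r<..<R} t * ((ln R - ln t) * d t) \<partial>lborel) = F R - F r"
    using B(2) r by (simp add: interval_lebesgue_integral_def set_lebesgue_integral_def einterval_eq)
  finally show "(\<integral>t. indicator {0<..<R} t * ((ln R - ln (max r t)) * d t) \<partial>lborel) = q R - q r"
    by (simp add: F_def algebra_simps)
qed

text \<open>For a radial density the mean of \<open>ln (norm (z - a))\<close> over rotations of
  \<open>a\<close> depends only on \<open>norm z\<close> and \<open>norm a\<close>, and the radial
  integral gives \<open>p z + C\<close> on a disc, with \<open>C\<close> independent of
  \<open>z\<close>. The constant disappears against \<open>circle_difference\<close>, and Fubini
  turns the rest into the integral of \<open>regularization\<close>.\<close>

lemma limit_potential_radial:
  fixes q m d :: "real \<Rightarrow> real"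
  assumes D: "D = UNIV \<or> D = ball 0 1"
    and q: "\<And>t. 0 < t \<Longrightarrow> complex_of_real t \<in> D \<Longrightarrow> (q has_real_derivative m t / t) (at t)"
    and m: "\<And>t. 0 < t \<Longrightarrow> complex_of_real t \<in> D \<Longrightarrow> (m has_real_derivative d t) (at t)"
    and d: "\<And>t. 0 < t \<Longrightarrow> complex_of_real t \<in> D \<Longrightarrow> isCont d t" "\<And>t. d t \<ge> 0"
    and m0: "(m \<longlongrightarrow> 0) (at_right 0)" and [measurable]: "d \<in> borel_measurable borel"
    and p: "\<And>z. p z = q (norm z)" "continuous_on D p"
    and \<rho>: "\<And>z. \<rho> z = d (norm z) / (2 * pi * norm z)"
  shows "limit_potential D p \<rho>"
proof
  show "D = UNIV \<or> D = ball 0 1" "continuous_on D p" by fact+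
  show "\<rho> z \<ge> 0" for z using d(2) by (simp add: \<rho>)
  have \<rho>': "\<rho> = (\<lambda>z. d (norm z) / (2 * pi * norm z))" using \<rho> by blast
  show \<rho>_meas [measurable]: "\<rho> \<in> borel_measurable borel" unfolding \<rho>' by measurable
  \<comment> \<open>Room beyond a closed disc in \<open>D\<close>, so that the density can be
    truncated at a radius outside the support of the weight.\<close>
  have larger: "\<exists>R>max x 0. cball 0 R \<subseteq> D" if "cball 0 x \<subseteq> D" for x
  proof (cases "D = UNIV")
    case True then show ?thesis by (intro exI[of _ "max x 0 + 1"]) auto
  next
    case False
    then have D1: "D = ball 0 1" using D by blast
    have "x < 1"
    proof (rule ccontr)
      assume "\<not> x < 1"
      then have "(1::complex) \<in> cball 0 x" by simp
      then have "(1::complex) \<in> D" using that by blast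
      then show False by (simp add: D1)
    qed
    then show ?thesis by (intro exI[of _ "(max x 0 + 1) / 2"]) (auto simp: D1)
  qed
  have rD: "complex_of_real t \<in> D" if "cball 0 R \<subseteq> D" "0 < t" "t \<le> R" for t R
    using that by (intro subsetD[OF that(1)]) simp
  have rad: "integrable lborel (\<lambda>t. indicator {0<..<R} t * ((ln R - ln (max r t)) * d t))"
    "(\<integral>t. indicator {0<..<R} t * ((ln R - ln (max r t)) * d t) \<partial>lborel) = q R - q r"
    "integrable lborel (\<lambda>t. indicator {0<..<R} t * d t)"
    if R: "cball 0 R \<subseteq> D" and r: "0 < r" "r < R" for r R
  proof -
    have h: "(q has_real_derivative m t / t) (at t)" "(m has_real_derivative d t) (at t)" "isCont d t" if "0 < t" "t \<le> R" for t
      using that rD[OF R that] q m d(1) by auto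
    note * = radial_log_integral[where q=q and m=m and d=d and R=R, OF h(1) h(2) h(3) d(2) m0 _ r]
    from * show "integrable lborel (\<lambda>t. indicator {0<..<R} t * ((ln R - ln (max r t)) * d t))"
      "(\<integral>t. indicator {0<..<R} t * ((ln R - ln (max r t)) * d t) \<partial>lborel) = q R - q r"
      "integrable lborel (\<lambda>t. indicator {0<..<R} t * d t)" by simp_all
  qed
  have mass: "integrable lborel (\<lambda>a. indicator (ball 0 R) a * \<rho> a)" if R: "cball 0 R \<subseteq> D" "R > 0" for R
  proof -
    have A: "integrable lborel (\<lambda>t. indicator {0<..<R} t * d t)"
      using rad(3)[of R "R/2"] R by simp
    \<comment> \<open>The factor \<open>2 * pi * t\<close> of polar coordinates cancels the
      denominator of the density, except at \<open>t = 0\<close>.\<close>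
    have B: "AE t in lborel. indicator {0<..<R} t * d t = 2 * pi * t * indicator {0..} t * (indicator {..<R} t * (d t / (2 * pi * t)))"
      using AE_lborel_singleton[of 0] by eventually_elim (auto simp: indicator_def)
    have "integrable lborel (\<lambda>t. 2 * pi * t * indicator {0..} t * (indicator {..<R} t * (d t / (2 * pi * t))))"
      by (rule integrable_cong_AE_imp[OF A _ B]) measurable
    then have "integrable lborel (\<lambda>a::complex. indicator {..<R} (norm a) * (d (norm a) / (2 * pi * norm a)))"
      by (subst integrable_lborel_norm) auto
    then show ?thesis by (simp add: \<rho>' indicator_def)
  qed
  show "set_integrable lborel (cball 0 x) \<rho>" if xD: "cball 0 x \<subseteq> D" for x
  proof -
    obtain R where R: "R > max x 0" "cball 0 R \<subseteq> D" using larger[OF xD] by blast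
    have "set_integrable lborel (ball 0 R) \<rho>" using mass[OF R(2)] R(1) by (simp add: set_integrable_def)
    then show ?thesis by (rule set_integrable_subset) (use R in auto)
  qed
  fix x s :: real and \<phi> :: "complex \<Rightarrow> real"
  assume \<phi>: "supported_in x \<phi>" and s: "s > 0" and x: "x > 0" and xs: "cball 0 (x + s) \<subseteq> D"
  obtain R where R: "R > x + s" "R > 0" "cball 0 R \<subseteq> D" using larger[OF xs] x s by auto
  let ?w = "circle_difference s \<phi>"
  have [measurable]: "?w \<in> borel_measurable borel" by (rule circle_difference_measurable[OF \<phi>])
  obtain B where B: "B > 0" "\<And>z. \<bar>\<phi> z\<bar> \<le> B" using supported_in_bounded[OF \<phi>] by blast
  have wb: "\<bar>?w z\<bar> \<le> 2 * B" for z by (rule circle_difference_bound[OF \<phi> B(2)])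
  have w0: "?w z = 0" if "norm z > x + s" for z using that by (rule circle_difference_eq_0[OF \<phi> s])
  let ?\<rho> = "\<lambda>a. indicator (ball 0 R) a * \<rho> a"
  have \<rho>nn: "?\<rho> a \<ge> 0" for a using d(2) by (simp add: \<rho>)
  note M = mass[OF R(3,2)]
  let ?f = "\<lambda>a z. ?\<rho> a * (ln (norm (z - a)) * ?w z)"
  define K where "K = 2 * pi * (1 + (2 * R)\<^sup>2) * (2 * R)"
  have K: "K \<ge> 0" using R by (simp add: K_def)
  note iw = integral_ln_dist_circle_difference[OF \<phi> s]
  \<comment> \<open>Joint integrability rests on the bound for the integral of the logarithm over a
    disc, which is uniform in the pole \<open>a\<close>.\<close>
  have joint: "integrable (lborel \<Otimes>\<^sub>M lborel) (\<lambda>(a, z). ?f a z)"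
  proof (rule lborel_pair.Fubini_integrable)
    show "AE a in lborel. integrable lborel (\<lambda>z. case (a, z) of (a, z) \<Rightarrow> ?f a z)"
      using iw(1) by (intro AE_I2) simp
    show "integrable lborel (\<lambda>a. \<integral>z. norm (case (a, z) of (a, z) \<Rightarrow> ?f a z) \<partial>lborel)"
    proof (rule Bochner_Integration.integrable_bound[OF integrable_mult_right[OF M, of "2 * B * K"]])
      have bd: "norm (\<integral>z. norm (case (a, z) of (a, z) \<Rightarrow> ?f a z) \<partial>lborel) \<le> norm (2 * B * K * ?\<rho> a)" for a
      proof (cases "norm a < R")
        case True
        have "(\<integral>z. norm (ln (norm (z - a)) * ?w z) \<partial>lborel) \<le> 2 * B * K"
        proof -
          have "ennreal (\<integral>z. norm (ln (norm (z - a)) * ?w z) \<partial>lborel) = (\<integral>\<^sup>+z. ennreal (norm (ln (norm (z - a)) * ?w z)) \<partial>lborel)"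
            by (rule nn_integral_eq_integral[symmetric]) (use iw(1) in auto)
          also have "\<dots> \<le> (\<integral>\<^sup>+z. ennreal (2 * B) * (ennreal \<bar>ln (norm (z - a))\<bar> * indicator (cball 0 R) z) \<partial>lborel)"
          proof (rule nn_integral_mono)
            fix z
            show "ennreal (norm (ln (norm (z - a)) * ?w z)) \<le> ennreal (2 * B) * (ennreal \<bar>ln (norm (z - a))\<bar> * indicator (cball 0 R) z)"
            proof (cases "z \<in> cball 0 R")
              case True
              have "\<bar>ln (norm (z - a))\<bar> * \<bar>?w z\<bar> \<le> \<bar>ln (norm (z - a))\<bar> * (2 * B)" by (intro mult_left_mono wb) simp
              then show ?thesis using True B(1) by (simp add: abs_mult mult.commute ennreal_leI flip: ennreal_mult')
            next
              case False
              then show ?thesis using w0[of z] R by simp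
            qed
          qed
          also have "\<dots> = ennreal (2 * B) * (\<integral>\<^sup>+z. ennreal \<bar>ln (norm (z - a))\<bar> * indicator (cball 0 R) z \<partial>lborel)"
            by (rule nn_integral_cmult) measurable
          also have "\<dots> \<le> ennreal (2 * B) * ennreal K"
            unfolding K_def using True by (intro mult_left_mono nn_integral_ln_norm_ball) auto
          also have "\<dots> = ennreal (2 * B * K)" using B K by (simp add: ennreal_mult')
          finally show ?thesis using B K by (subst (asm) ennreal_le_iff) auto
        qed
        then have "?\<rho> a * (\<integral>z. norm (ln (norm (z - a)) * ?w z) \<partial>lborel) \<le> ?\<rho> a * (2 * B * K)"
          using \<rho>nn by (rule mult_left_mono)
        moreover have "(\<integral>z. norm (?f a z) \<partial>lborel) = ?\<rho> a * (\<integral>z. norm (ln (norm (z - a)) * ?w z) \<partial>lborel)"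
          using \<rho>nn[of a] by (simp add: abs_mult[of "?\<rho> a"] del: indicator_simps)
        ultimately have "(\<integral>z. norm (?f a z) \<partial>lborel) \<le> 2 * B * K * ?\<rho> a" by (simp add: mult.commute)
        moreover have "(\<integral>z. norm (?f a z) \<partial>lborel) \<ge> 0" by simp
        ultimately show ?thesis unfolding case_prod_conv real_norm_def by linarith
      qed simp
      then show "AE a in lborel. norm (\<integral>z. norm (case (a, z) of (a, z) \<Rightarrow> ?f a z) \<partial>lborel) \<le> norm (2 * B * K * ?\<rho> a)" by (rule AE_I2)
      show "(\<lambda>a. \<integral>z. norm (case (a, z) of (a, z) \<Rightarrow> ?f a z) \<partial>lborel) \<in> borel_measurable lborel" by measurable
    qed
  qed measurable
  \<comment> \<open>Collects what the shift by \<open>ln R\<close> in the radial integral leaves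
    behind.\<close>
  define C where "C = ln R * (\<integral>a. ?\<rho> a \<partial>lborel) - q R"
  have inner: "(\<integral>a. ?f a z \<partial>lborel) = (p z + C) * ?w z" if i: "integrable lborel (\<lambda>a. ?f a z)" and z0: "z \<noteq> 0" for z
  proof (cases "?w z = 0")
    case False
    then have "\<not> norm z > x + s" using w0[of z] by blast
    then have zR: "norm z < R" using R(1) by linarith
    let ?r = "norm z"
    let ?g = "\<lambda>a. ?\<rho> a * ln (norm (z - a))"
    have gi: "integrable lborel ?g"
      using integrable_divide[OF i, of "?w z"] False by (simp add: mult.assoc)
    let ?T = "\<lambda>t. 2 * pi * t * indicator {0..} t * (indicator {..<R} t * ((ln R - ln (max ?r t)) * (d t / (2 * pi * t))))"
    have ae: "AE t in lborel. indicator {0<..<R} t * ((ln R - ln (max ?r t)) * d t) = ?T t"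
      using AE_lborel_singleton[of 0] by eventually_elim (auto simp: indicator_def)
    have rd: "integrable lborel (\<lambda>t. indicator {0<..<R} t * ((ln R - ln (max ?r t)) * d t))"
      "(\<integral>t. indicator {0<..<R} t * ((ln R - ln (max ?r t)) * d t) \<partial>lborel) = q R - q ?r"
      using rad(1,2)[of R ?r] R z0 zR by simp_all
    have "integrable lborel ?T"
      by (rule integrable_cong_AE_imp[OF rd(1) _ ae]) measurable
    then have "integrable lborel (\<lambda>a::complex. indicator {..<R} (norm a) * ((ln R - ln (max ?r (norm a))) * (d (norm a) / (2 * pi * norm a))))"
      by (subst integrable_lborel_norm) auto
    moreover have "(\<integral>a. indicator {..<R} (norm (a::complex)) * ((ln R - ln (max ?r (norm a))) * (d (norm a) / (2 * pi * norm a))) \<partial>lborel) = q R - q ?r"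
      unfolding rd(2)[symmetric] using ae by (subst integral_lborel_norm) (auto intro!: integral_cong_AE)
    moreover have "(\<lambda>a::complex. indicator {..<R} (norm a) * ((ln R - ln (max ?r (norm a))) * (d (norm a) / (2 * pi * norm a))))
      = (\<lambda>a. ln R * ?\<rho> a - ?\<rho> a * ln (max ?r (norm a)))"
      by (auto simp: fun_eq_iff \<rho>' indicator_def algebra_simps diff_divide_distrib)
    ultimately have L: "integrable lborel (\<lambda>a. ln R * ?\<rho> a - ?\<rho> a * ln (max ?r (norm a)))"
      "(\<integral>a. ln R * ?\<rho> a - ?\<rho> a * ln (max ?r (norm a)) \<partial>lborel) = q R - q ?r" by simp_all
    have L1: "integrable lborel (\<lambda>a. ?\<rho> a * ln (max ?r (norm a)))"
      using Bochner_Integration.integrable_diff[OF integrable_mult_right[OF M, of "ln R"] L(1)] by simp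
    have "(\<integral>a. ?\<rho> a * ln (max ?r (norm a)) \<partial>lborel) = C + q ?r"
      using L(2) L1 M unfolding C_def by simp
    moreover have "(\<integral>a. ?g a \<partial>lborel) = (\<integral>a. ?\<rho> a * ln (max ?r (norm a)) \<partial>lborel)"
    proof -
      have "(\<integral>a. ?g a \<partial>lborel) = (\<integral>a. (\<integral>t. ?g (turn t * a) \<partial>circ) \<partial>lborel)"
        by (rule rotation_average(2)[OF _ gi, symmetric]) measurable
      also have "\<dots> = (\<integral>a. ?\<rho> a * ln (max ?r (norm a)) \<partial>lborel)"
      proof (rule integral_cong_AE)
        show "AE a in lborel. (\<integral>t. ?g (turn t * a) \<partial>circ) = ?\<rho> a * ln (max ?r (norm a))"
          using AE_norm_neq[of 0 ?r]
        proof eventually_elim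
          case (elim a)
          have "(\<integral>t. ?g (turn t * a) \<partial>circ) = ?\<rho> a * (\<integral>t. ln (norm (0 + turn t * a - z)) \<partial>circ)"
            by (simp add: \<rho> norm_mult norm_minus_commute indicator_def)
          also have "(\<integral>t. ln (norm (0 + turn t * a - z)) \<partial>circ) = ln (max (norm a) (norm (0 - z)))"
            using elim by (intro mean_value_ln_dist_rotated(2)) auto
          finally show ?case by (simp add: max.commute)
        qed
      qed measurable
      finally show ?thesis .
    qed
    ultimately have "(\<integral>a. ?g a \<partial>lborel) = p z + C" by (simp add: p(1))
    moreover have "(\<integral>a. ?f a z \<partial>lborel) = (\<integral>a. ?g a \<partial>lborel) * ?w z" by (simp add: mult.assoc[symmetric])
    ultimately show ?thesis by simp
  qed simp
  have pw: "integrable lborel (\<lambda>z. (p z + C) * ?w z)" "(\<integral>z. (p z + C) * ?w z \<partial>lborel) = (\<integral>a. regularization s \<phi> a * \<rho> a \<partial>lborel)"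
  proof -
    have ae: "AE z in lborel. (\<integral>a. ?f a z \<partial>lborel) = (p z + C) * ?w z"
      using lborel_pair.AE_integrable_snd[OF joint] AE_lborel_singleton[of 0]
      by eventually_elim (rule inner)
    have meas: "(\<lambda>z. (p z + C) * ?w z) \<in> borel_measurable lborel"
    proof -
      have "(\<lambda>z. if z \<in> D then p z else 0) \<in> borel_measurable borel"
        using p(2) D by (intro borel_measurable_continuous_on_if) auto
      then have "(\<lambda>z. ((if z \<in> D then p z else 0) + C) * ?w z) \<in> borel_measurable borel" by measurable
      also have "(\<lambda>z. ((if z \<in> D then p z else 0) + C) * ?w z) = (\<lambda>z. (p z + C) * ?w z)"
      proof
        fix z
        show "((if z \<in> D then p z else 0) + C) * ?w z = (p z + C) * ?w z"
          using w0[of z] subsetD[OF xs, of z] by (cases "norm z > x + s") auto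
      qed
      finally show ?thesis by simp
    qed
    show "integrable lborel (\<lambda>z. (p z + C) * ?w z)"
      using lborel_pair.integrable_snd[OF joint] meas ae by (rule integrable_cong_AE_imp)
    have "(\<integral>z. (p z + C) * ?w z \<partial>lborel) = (\<integral>z. (\<integral>a. ?f a z \<partial>lborel) \<partial>lborel)"
      using ae meas borel_measurable_integrable[OF lborel_pair.integrable_snd[OF joint]]
      by (intro integral_cong_AE[symmetric])
    also have "\<dots> = (\<integral>a. (\<integral>z. ?f a z \<partial>lborel) \<partial>lborel)"
      by (rule lborel_pair.Fubini_integral[OF joint])
    also have "\<dots> = (\<integral>a. regularization s \<phi> a * \<rho> a \<partial>lborel)"
    proof (rule Bochner_Integration.integral_cong[OF refl])
      fix a
      have "regularization s \<phi> a = 0" if "norm a \<ge> R"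
        using that R by (intro regularization_eq_0[OF \<phi> s]) auto
      then show "(\<integral>z. ?f a z \<partial>lborel) = regularization s \<phi> a * \<rho> a"
        using iw(2)[of a] by (cases "norm a < R") auto
    qed
    finally show "(\<integral>z. (p z + C) * ?w z \<partial>lborel) = (\<integral>a. regularization s \<phi> a * \<rho> a \<partial>lborel)" .
  qed
  \<comment> \<open>The zero-free constant \<open>exp 1\<close> has logarithm 1, so the weight has
    integral 0 and constants drop out.\<close>
  have w: "integrable lborel ?w" "(\<integral>z. ?w z \<partial>lborel) = 0"
    using integral_ln_nonvanishing_circle_difference[OF \<phi> s R(1), of "\<lambda>_. exp 1"] by (simp_all add: holomorphic_intros)
  have "(\<integral>z. p z * ?w z \<partial>lborel) = (\<integral>z. (p z + C) * ?w z - C * ?w z \<partial>lborel)" by (simp add: algebra_simps)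
  also have "\<dots> = (\<integral>a. regularization s \<phi> a * \<rho> a \<partial>lborel)"
    using pw w by simp
  finally show "(\<integral>z. p z * ?w z \<partial>lborel) = (\<integral>a. regularization s \<phi> a * \<rho> a \<partial>lborel)" .
qed

section \<open>Anticoncentration and growth of the coefficients\<close>

text \<open>Conditioning on all coordinates but \<open>m\<close>: then \<open>H\<close> and the
  centre \<open>Y\<close> are fixed, while \<open>\<xi> m\<close> keeps its law and lies in a fixed
  ball with probability at most \<open>q\<close>.\<close>

lemma (in prob_space) independent_coordinate_ball:
  fixes \<xi> :: "nat \<Rightarrow> 'a \<Rightarrow> complex"
  assumes ind: "indep_vars (\<lambda>_. borel) \<xi> UNIV"
    and H[measurable]: "Measurable.pred (PiM UNIV (\<lambda>_. borel)) H" and Y[measurable]: "Y \<in> borel_measurable (PiM UNIV (\<lambda>_. borel))"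
    and inv: "\<And>x c. H (x(m := c)) = H x" "\<And>x c. Y (x(m := c)) = Y x"
    and q: "\<And>c. prob {\<omega>\<in>space M. norm (\<xi> m \<omega> - c) \<le> \<delta>} \<le> q"
  shows "prob {\<omega>\<in>space M. H (\<lambda>i. \<xi> i \<omega>) \<and> norm (\<xi> m \<omega> - Y (\<lambda>i. \<xi> i \<omega>)) \<le> \<delta>} \<le> q * prob {\<omega>\<in>space M. H (\<lambda>i. \<xi> i \<omega>)}"
proof -
  have \<xi>m [measurable]: "\<xi> i \<in> borel_measurable M" for i using ind by (simp add: indep_vars_def)
  have q0: "q \<ge> 0" using order_trans[OF measure_nonneg q] .
  let ?P = "PiM (-{m}) (\<lambda>_. borel) :: (nat \<Rightarrow> complex) measure"
  define W where "W = (\<lambda>\<omega>. restrict (\<lambda>i. \<xi> i \<omega>) (-{m}))"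
  \<comment> \<open>Any value may be filled in at \<open>m\<close>, because \<open>H\<close> and
    \<open>Y\<close> do not depend on it.\<close>
  define ext where "ext = (\<lambda>w :: nat \<Rightarrow> complex. w(m := 0))"
  have W[measurable]: "W \<in> M \<rightarrow>\<^sub>M ?P" unfolding W_def by (intro measurable_restrict) auto
  have ext[measurable]: "ext \<in> ?P \<rightarrow>\<^sub>M PiM UNIV (\<lambda>_. borel)"
  proof (rule measurable_PiM_single')
    fix i :: nat
    show "(\<lambda>w. ext w i) \<in> borel_measurable ?P"
      by (cases "i = m") (auto simp: ext_def intro!: measurable_component_singleton)
  qed auto
  have extW: "ext (W \<omega>) = (\<lambda>i. \<xi> i \<omega>)(m := 0)" for \<omega> by (auto simp: ext_def W_def)
  have HW: "H (ext (W \<omega>)) = H (\<lambda>i. \<xi> i \<omega>)" "Y (ext (W \<omega>)) = Y (\<lambda>i. \<xi> i \<omega>)" for \<omega>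
    unfolding extW inv by simp_all
  let ?Q = "PiM {m} (\<lambda>_. borel) :: (nat \<Rightarrow> complex) measure"
  define V where "V = (\<lambda>\<omega>. restrict (\<lambda>i. \<xi> i \<omega>) {m})"
  have V[measurable]: "V \<in> M \<rightarrow>\<^sub>M ?Q" unfolding V_def by (intro measurable_restrict) auto
  have Vm: "V \<omega> m = \<xi> m \<omega>" for \<omega> by (simp add: V_def)
  have [measurable]: "(\<lambda>f. f m) \<in> borel_measurable ?Q" by (rule measurable_component_singleton) simp
  have "indep_var ?Q V ?P W"
    unfolding W_def V_def by (rule indep_var_restrict[OF ind]) auto
  then have joint: "distr M ?Q V \<Otimes>\<^sub>M distr M ?P W = distr M (?Q \<Otimes>\<^sub>M ?P) (\<lambda>\<omega>. (V \<omega>, W \<omega>))"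
    unfolding indep_var_distribution_eq by blast
  interpret X: prob_space "distr M ?Q V" by (rule prob_space_distr) simp
  interpret W: prob_space "distr M ?P W" by (rule prob_space_distr) simp
  interpret XW: pair_sigma_finite "distr M ?Q V" "distr M ?P W" ..
  let ?S = "{fw \<in> space (?Q \<Otimes>\<^sub>M ?P). H (ext (snd fw)) \<and> norm (fst fw m - Y (ext (snd fw))) \<le> \<delta>}"
  have S: "?S \<in> sets (?Q \<Otimes>\<^sub>M ?P)" by measurable
  have "emeasure M {\<omega>\<in>space M. H (\<lambda>i. \<xi> i \<omega>) \<and> norm (\<xi> m \<omega> - Y (\<lambda>i. \<xi> i \<omega>)) \<le> \<delta>}
      = emeasure (distr M (?Q \<Otimes>\<^sub>M ?P) (\<lambda>\<omega>. (V \<omega>, W \<omega>))) ?S"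
    using S measurable_space[OF W] measurable_space[OF V]
    by (subst emeasure_distr) (auto intro!: arg_cong[where f="emeasure M"] simp: HW Vm space_pair_measure)
  also have "\<dots> = (\<integral>\<^sup>+w. emeasure (distr M ?Q V) ((\<lambda>x. (x, w)) -` ?S) \<partial>distr M ?P W)"
    unfolding joint[symmetric] by (rule XW.emeasure_pair_measure_alt2) (use S in simp)
  also have "\<dots> \<le> (\<integral>\<^sup>+w. ennreal q * indicator {w\<in>space ?P. H (ext w)} w \<partial>distr M ?P W)"
  proof (rule nn_integral_mono)
    fix w assume w: "w \<in> space (distr M ?P W)"
    show "emeasure (distr M ?Q V) ((\<lambda>x. (x, w)) -` ?S) \<le> ennreal q * indicator {w\<in>space ?P. H (ext w)} w"
    proof (cases "H (ext w)")
      case True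
      have "(\<lambda>x. (x, w)) -` ?S = {f \<in> space ?Q. norm (f m - Y (ext w)) \<le> \<delta>}"
        using True w by (auto simp: space_pair_measure)
      also have "emeasure (distr M ?Q V) \<dots> = emeasure M {\<omega>\<in>space M. norm (\<xi> m \<omega> - Y (ext w)) \<le> \<delta>}"
        using measurable_space[OF V]
        by (subst emeasure_distr) (auto intro!: arg_cong[where f="emeasure M"] simp: Vm)
      also have "\<dots> \<le> ennreal q" using q[of "Y (ext w)"] by (simp add: emeasure_eq_measure ennreal_leI)
      finally show ?thesis using True w by simp
    qed simp
  qed
  also have "\<dots> = ennreal q * emeasure (distr M ?P W) {w\<in>space ?P. H (ext w)}"
    by (rule nn_integral_cmult_indicator) measurable
  also have "emeasure (distr M ?P W) {w\<in>space ?P. H (ext w)} = emeasure M {\<omega>\<in>space M. H (\<lambda>i. \<xi> i \<omega>)}"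
    using measurable_space[OF W]
    by (subst emeasure_distr) (auto intro!: arg_cong[where f="emeasure M"] simp: HW)
  finally show ?thesis
    using q0 by (simp add: emeasure_eq_measure flip: ennreal_mult')
qed

text \<open>\<open>R\<close> stands for all terms outside the chosen indices. By \<open>dom\<close>,
  a tiny sum with coefficients capped by \<open>K\<close> confines \<open>\<xi> (k j)\<close> to a
  ball of radius \<open>\<delta>\<close> whose centre depends only on \<open>R\<close> and on the
  chosen coefficients of smaller \<open>j\<close>; the cap makes the later terms negligible.
  Conditioning on one coordinate at a time gives the factors \<open>q\<close>.\<close>

lemma (in prob_space) dominated_sum_anticoncentration:
  fixes \<xi> :: "nat \<Rightarrow> 'a \<Rightarrow> complex" and a :: "nat \<Rightarrow> complex" and k :: "nat \<Rightarrow> nat"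
  assumes ind: "indep_vars (\<lambda>_. borel) \<xi> UNIV"
    and R[measurable]: "R \<in> borel_measurable (PiM UNIV (\<lambda>_. borel))"
    and inv: "\<And>x j c. j < N \<Longrightarrow> R (x(k j := c)) = R x"
    and k: "inj_on k {..<N}" and a: "\<And>j. j < N \<Longrightarrow> a j \<noteq> 0"
    and dom: "\<And>j. j < N \<Longrightarrow> K * (\<Sum>l\<in>{j<..<N}. norm (a l)) + t \<le> \<delta> * norm (a j)"
    and q: "\<And>m c. prob {\<omega>\<in>space M. norm (\<xi> m \<omega> - c) \<le> \<delta>} \<le> q"
  shows "prob {\<omega>\<in>space M. norm (R (\<lambda>i. \<xi> i \<omega>) + (\<Sum>j<N. a j * \<xi> (k j) \<omega>)) \<le> t \<and> (\<forall>j<N. norm (\<xi> (k j) \<omega>) \<le> K)} \<le> q ^ N"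
proof -
  have \<xi>m [measurable]: "\<xi> i \<in> borel_measurable M" for i using ind by (simp add: indep_vars_def)
  have \<Xi> [measurable]: "(\<lambda>\<omega> i. \<xi> i \<omega>) \<in> M \<rightarrow>\<^sub>M PiM UNIV (\<lambda>_. borel)"
    by (rule measurable_PiM_single') auto
  have q0: "q \<ge> 0" using order_trans[OF measure_nonneg q[of 0 0]] .
  \<comment> \<open>The value of \<open>x (k j)\<close> for which the sum, with the terms after
    \<open>j\<close> dropped, is 0.\<close>
  define Y where "Y = (\<lambda>j x. - (R x + (\<Sum>l<j. a l * x (k l))) / a j)"
  have [measurable]: "Y j \<in> borel_measurable (PiM UNIV (\<lambda>_. borel))" for j unfolding Y_def by measurable
  define H where "H = (\<lambda>j x. \<forall>i<j. norm (x (k i) - Y i x) \<le> \<delta>)"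
  have [measurable]: "Measurable.pred (PiM UNIV (\<lambda>_. borel)) (H j)" for j unfolding H_def by measurable
  have Yinv: "Y i (x(k j := c)) = Y i x" if "i \<le> j" "j < N" for i j x c
  proof -
    have "k l \<noteq> k j" if "l < i" for l using that \<open>i \<le> j\<close> \<open>j < N\<close> inj_onD[OF k, of l j] by auto
    then have "(\<Sum>l<i. a l * (x(k j := c)) (k l)) = (\<Sum>l<i. a l * x (k l))" by (intro sum.cong) auto
    then show ?thesis using inv[OF that(2)] by (simp add: Y_def)
  qed
  have Hinv: "H j (x(k j := c)) = H j x" if "j < N" for j x c
  proof -
    have "k i \<noteq> k j" if "i < j" for i using that \<open>j < N\<close> inj_onD[OF k, of i j] by auto
    then show ?thesis using Yinv[OF less_imp_le that] by (simp add: H_def)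
  qed
  have main: "prob {\<omega>\<in>space M. H j (\<lambda>i. \<xi> i \<omega>)} \<le> q ^ j" if "j \<le> N" for j
    using that
  proof (induction j)
    case 0 then show ?case by simp
  next
    case (Suc j)
    have "{\<omega>\<in>space M. H (Suc j) (\<lambda>i. \<xi> i \<omega>)} = {\<omega>\<in>space M. H j (\<lambda>i. \<xi> i \<omega>) \<and> norm (\<xi> (k j) \<omega> - Y j (\<lambda>i. \<xi> i \<omega>)) \<le> \<delta>}"
      unfolding H_def by (auto simp: less_Suc_eq)
    also have "prob \<dots> \<le> q * prob {\<omega>\<in>space M. H j (\<lambda>i. \<xi> i \<omega>)}"
      using Suc.prems by (intro independent_coordinate_ball[OF ind _ _ Hinv Yinv q]) auto
    also have "\<dots> \<le> q * q ^ j" using Suc q0 by (intro mult_left_mono) auto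
    finally show ?case by simp
  qed
  have "prob {\<omega>\<in>space M. norm (R (\<lambda>i. \<xi> i \<omega>) + (\<Sum>j<N. a j * \<xi> (k j) \<omega>)) \<le> t \<and> (\<forall>j<N. norm (\<xi> (k j) \<omega>) \<le> K)}
     \<le> prob {\<omega>\<in>space M. H N (\<lambda>i. \<xi> i \<omega>)}"
  proof (rule finite_measure_mono)
    show "{\<omega>\<in>space M. norm (R (\<lambda>i. \<xi> i \<omega>) + (\<Sum>j<N. a j * \<xi> (k j) \<omega>)) \<le> t \<and> (\<forall>j<N. norm (\<xi> (k j) \<omega>) \<le> K)} \<subseteq> {\<omega>\<in>space M. H N (\<lambda>i. \<xi> i \<omega>)}"
    proof safe
      fix \<omega> assume t: "norm (R (\<lambda>i. \<xi> i \<omega>) + (\<Sum>j<N. a j * \<xi> (k j) \<omega>)) \<le> t" and K: "\<forall>j<N. norm (\<xi> (k j) \<omega>) \<le> K"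
      let ?r = "R (\<lambda>i. \<xi> i \<omega>)"
      show "H N (\<lambda>i. \<xi> i \<omega>)"
        unfolding H_def
      proof (intro allI impI)
        fix j assume j: "j < N"
        have split: "(\<Sum>l<N. a l * \<xi> (k l) \<omega>) = (\<Sum>l<j. a l * \<xi> (k l) \<omega>) + a j * \<xi> (k j) \<omega> + (\<Sum>l\<in>{j<..<N}. a l * \<xi> (k l) \<omega>)"
        proof -
          have "{..<N} = {..<j} \<union> {j} \<union> {j<..<N}" using j by auto
          moreover have "(\<Sum>l\<in>{..<j} \<union> {j<..<N}. a l * \<xi> (k l) \<omega>) = (\<Sum>l<j. a l * \<xi> (k l) \<omega>) + (\<Sum>l\<in>{j<..<N}. a l * \<xi> (k l) \<omega>)"
            by (rule sum.union_disjoint) auto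
          ultimately show ?thesis by simp
        qed
        have "norm (\<Sum>l\<in>{j<..<N}. a l * \<xi> (k l) \<omega>) \<le> (\<Sum>l\<in>{j<..<N}. norm (a l) * K)"
          using K by (intro sum_norm_le) (auto simp: norm_mult intro!: mult_left_mono)
        also have "\<dots> = K * (\<Sum>l\<in>{j<..<N}. norm (a l))" by (simp add: sum_distrib_left mult.commute)
        finally have tail: "norm (\<Sum>l\<in>{j<..<N}. a l * \<xi> (k l) \<omega>) \<le> K * (\<Sum>l\<in>{j<..<N}. norm (a l))" .
        have "a j * (\<xi> (k j) \<omega> - Y j (\<lambda>i. \<xi> i \<omega>)) = (?r + (\<Sum>l<N. a l * \<xi> (k l) \<omega>)) - (\<Sum>l\<in>{j<..<N}. a l * \<xi> (k l) \<omega>)"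
          using a[OF j] unfolding split Y_def by (simp add: field_simps)
        then have "norm (a j) * norm (\<xi> (k j) \<omega> - Y j (\<lambda>i. \<xi> i \<omega>)) \<le> t + K * (\<Sum>l\<in>{j<..<N}. norm (a l))"
          using norm_triangle_ineq4[of "?r + (\<Sum>l<N. a l * \<xi> (k l) \<omega>)" "\<Sum>l\<in>{j<..<N}. a l * \<xi> (k l) \<omega>"] t tail
          by (simp flip: norm_mult)
        also have "\<dots> \<le> norm (a j) * \<delta>" using dom[OF j] by (simp add: mult.commute add.commute)
        finally show "norm (\<xi> (k j) \<omega> - Y j (\<lambda>i. \<xi> i \<omega>)) \<le> \<delta>" using a[OF j] by simp
      qed
    qed
  qed measurable
  also have "\<dots> \<le> q ^ N" by (rule main) simp
  finally show ?thesis .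
qed

text \<open>A law that is not a point mass has two distinct points in its support, and a small ball
  cannot come near both.\<close>

lemma (in prob_space) nondegenerate_imp_ball_prob_less_1:
  fixes X :: "'a \<Rightarrow> complex"
  assumes X[measurable]: "X \<in> borel_measurable M" and nd: "\<not> (\<exists>c. AE \<omega> in M. X \<omega> = c)"
  obtains \<delta> q where "\<delta> > 0" "q < 1" "\<And>c. prob {\<omega>\<in>space M. norm (X \<omega> - c) \<le> \<delta>} \<le> q"
proof -
  have [measurable]: "Measurable.pred M (\<lambda>\<omega>. X \<omega> \<in> ball z r)" for z r
    unfolding mem_ball by measurable
  \<comment> \<open>By Lindelof, a set that is not avoided almost surely contains a point all of
    whose neighbourhoods have positive probability.\<close>
  have supp: "\<exists>x\<in>S. \<forall>r>0. prob {\<omega>\<in>space M. X \<omega> \<in> ball x r} > 0" if S: "\<not> (AE \<omega> in M. X \<omega> \<notin> S)" for S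
  proof (rule ccontr)
    assume "\<not> ?thesis"
    then have "\<forall>x\<in>S. \<exists>r>0. prob {\<omega>\<in>space M. X \<omega> \<in> ball x r} = 0"
      by (metis measure_nonneg order_le_less)
    then obtain r where r: "\<And>x. x \<in> S \<Longrightarrow> r x > 0" "\<And>x. x \<in> S \<Longrightarrow> prob {\<omega>\<in>space M. X \<omega> \<in> ball x (r x)} = 0"
      by metis
    obtain F where F: "F \<subseteq> (\<lambda>x. ball x (r x)) ` S" "countable F" "\<Union>F = \<Union>((\<lambda>x. ball x (r x)) ` S)"
      using Lindelof[of "(\<lambda>x. ball x (r x)) ` S"] by auto
    have "AE \<omega> in M. \<forall>B\<in>F. X \<omega> \<notin> B"
    proof (subst AE_ball_countable[OF F(2)], intro ballI)
      fix B assume "B \<in> F"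
      then obtain x where x: "x \<in> S" "B = ball x (r x)" using F(1) by auto
      then have "{\<omega>\<in>space M. X \<omega> \<in> B} \<in> null_sets M" using r(2)[OF x(1)] by (auto simp: null_sets_def emeasure_eq_measure)
      then show "AE \<omega> in M. X \<omega> \<notin> B" by (rule AE_I') auto
    qed
    then have "AE \<omega> in M. X \<omega> \<notin> S"
    proof eventually_elim
      case (elim \<omega>)
      show ?case
      proof
        assume "X \<omega> \<in> S"
        then have "X \<omega> \<in> \<Union>((\<lambda>x. ball x (r x)) ` S)" using r(1) by force
        then show False using elim F(3) by blast
      qed
    qed
    with S show False by blast
  qed
  obtain x where x: "\<And>r. r > 0 \<Longrightarrow> prob {\<omega>\<in>space M. X \<omega> \<in> ball x r} > 0"
    using supp[of UNIV] prob_space.AE_False[OF prob_space_axioms] by auto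
  have "\<not> (AE \<omega> in M. X \<omega> \<notin> -{x})" using nd by auto
  from supp[OF this] obtain y where y: "y \<noteq> x" "\<And>r. r > 0 \<Longrightarrow> prob {\<omega>\<in>space M. X \<omega> \<in> ball y r} > 0"
    by auto
  \<comment> \<open>One of the two points has distance at least \<open>5 / 2 * \<delta>\<close> from
    \<open>c\<close>, so its ball of radius \<open>\<delta>\<close> is disjoint from the closed ball
    around \<open>c\<close>.\<close>
  define \<delta> where "\<delta> = dist x y / 5"
  have \<delta>: "\<delta> > 0" using y by (simp add: \<delta>_def)
  define u where "u = min (prob {\<omega>\<in>space M. X \<omega> \<in> ball x \<delta>}) (prob {\<omega>\<in>space M. X \<omega> \<in> ball y \<delta>})"
  show thesis
  proof (rule that[OF \<delta>, of "1 - u"])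
    show "1 - u < 1" using x[OF \<delta>] y(2)[OF \<delta>] by (simp add: u_def)
    fix c
    have *: "prob {\<omega>\<in>space M. norm (X \<omega> - c) \<le> \<delta>} \<le> 1 - u"
      if z: "u \<le> prob {\<omega>\<in>space M. X \<omega> \<in> ball z \<delta>}" "dist c z \<ge> 2 * \<delta>" for z
    proof -
      have "{\<omega>\<in>space M. norm (X \<omega> - c) \<le> \<delta>} \<subseteq> space M - {\<omega>\<in>space M. X \<omega> \<in> ball z \<delta>}"
      proof safe
        fix \<omega> assume "norm (X \<omega> - c) \<le> \<delta>" "X \<omega> \<in> ball z \<delta>"
        then have "dist c z < 2 * \<delta>"
          using dist_triangle[of c z "X \<omega>"] by (simp add: dist_norm norm_minus_commute)
        then show False using z(2) by simp
      qed
      then have "prob {\<omega>\<in>space M. norm (X \<omega> - c) \<le> \<delta>} \<le> prob (space M - {\<omega>\<in>space M. X \<omega> \<in> ball z \<delta>})"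
        by (intro finite_measure_mono) auto
      also have "\<dots> = 1 - prob {\<omega>\<in>space M. X \<omega> \<in> ball z \<delta>}" by (rule prob_compl) measurable
      finally show ?thesis using z(1) by simp
    qed
    have "dist c x \<ge> 2 * \<delta> \<or> dist c y \<ge> 2 * \<delta>"
    proof -
      have "dist x y \<le> dist c x + dist c y" using dist_triangle[of x y c] by (simp add: dist_commute)
      then show ?thesis using \<delta> unfolding \<delta>_def by linarith
    qed
    then show "prob {\<omega>\<in>space M. norm (X \<omega> - c) \<le> \<delta>} \<le> 1 - u"
      using *[of x] *[of y] by (auto simp: u_def)
  qed
qed

lemma sum_indicator_less_le:
  fixes y :: real
  assumes "0 \<le> y"
  shows "(\<Sum>k<n. if real k < y then 1 else 0 :: real) \<le> y + 1"
proof -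
  have "(\<Sum>k<n. if real k < y then 1 else 0 :: real) = real (card {k\<in>{..<n}. real k < y})"
    by (simp add: sum.If_cases Int_def)
  moreover have "{k\<in>{..<n}. real k < y} \<subseteq> {..<nat \<lceil>y\<rceil>}"
  proof safe
    fix k :: nat assume "real k < y"
    then show "k < nat \<lceil>y\<rceil>" by linarith
  qed
  then have "card {k\<in>{..<n}. real k < y} \<le> nat \<lceil>y\<rceil>"
    using card_mono[of "{..<nat \<lceil>y\<rceil>}"] by fastforce
  moreover have "real (nat \<lceil>y\<rceil>) \<le> y + 1" using assms by linarith
  ultimately show ?thesis by linarith
qed

text \<open>\<open>C\<close> depends on the realisation; it is a natural number so that the
  quantifier over it is countable.\<close>

lemma (in prob_space) log_moment_growth:
  fixes \<xi> :: "nat \<Rightarrow> 'a \<Rightarrow> complex"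
  assumes \<xi>[measurable]: "\<And>k. \<xi> k \<in> borel_measurable M" and id: "\<And>k. distr M borel (\<xi> k) = distr M borel (\<xi> 0)"
    and int: "integrable M (\<lambda>\<omega>. ln (1 + norm (\<xi> 0 \<omega>)))" and e: "\<epsilon> > 0"
  shows "AE \<omega> in M. \<exists>C::nat. \<forall>k. norm (\<xi> k \<omega>) \<le> C * exp (\<epsilon> * k)"
proof -
  let ?X = "\<lambda>\<omega>. ln (1 + norm (\<xi> 0 \<omega>))"
  let ?A = "\<lambda>k. {\<omega>\<in>space M. norm (\<xi> k \<omega>) > exp (\<epsilon> * k)}"
  let ?B = "\<lambda>k::nat. {\<omega>\<in>space M. ?X \<omega> > \<epsilon> * k}"
  have le: "prob (?A k) \<le> prob (?B k)" for k
  proof -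
    have "prob (?A k) = measure (distr M borel (\<xi> k)) {x. norm x > exp (\<epsilon> * k)}"
      by (subst measure_distr) (auto intro!: arg_cong[where f=prob])
    also have "\<dots> = prob {\<omega>\<in>space M. norm (\<xi> 0 \<omega>) > exp (\<epsilon> * k)}"
      unfolding id[of k] by (subst measure_distr) (auto intro!: arg_cong[where f=prob])
    also have "\<dots> \<le> prob (?B k)"
    proof (rule finite_measure_mono)
      show "{\<omega>\<in>space M. norm (\<xi> 0 \<omega>) > exp (\<epsilon> * k)} \<subseteq> ?B k"
      proof safe
        fix \<omega> assume "norm (\<xi> 0 \<omega>) > exp (\<epsilon> * k)"
        then have "exp (\<epsilon> * k) < 1 + norm (\<xi> 0 \<omega>)" by simp
        then have "ln (exp (\<epsilon> * k)) < ?X \<omega>" by (subst ln_less_cancel_iff) (auto simp: add_pos_nonneg)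
        then show "?X \<omega> > \<epsilon> * k" by simp
      qed
    qed measurable
    finally show ?thesis .
  qed
  have "summable (\<lambda>k. prob (?B k))"
  proof (rule summableI_nonneg_bounded)
    fix n
    \<comment> \<open>The sum counts the indices below \<open>?X \<omega> / \<epsilon>\<close>; its
      expectation gives the summability needed for Borel-Cantelli.\<close>
    have pt: "(\<Sum>k<n. indicator (?B k) \<omega>) \<le> ?X \<omega> / \<epsilon> + 1" if "\<omega> \<in> space M" for \<omega>
    proof -
      have "(\<Sum>k<n. indicator (?B k) \<omega>) = (\<Sum>k<n. if real k < ?X \<omega> / \<epsilon> then 1 else 0 :: real)"
        using that e by (intro sum.cong) (auto simp: indicator_def field_simps)
      also have "\<dots> \<le> ?X \<omega> / \<epsilon> + 1"
        by (rule sum_indicator_less_le) (use e in simp)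
      finally show ?thesis .
    qed
    have "(\<Sum>k<n. prob (?B k)) = (\<integral>\<omega>. (\<Sum>k<n. indicator (?B k) \<omega>) \<partial>M)"
      by (subst Bochner_Integration.integral_sum) (auto simp: emeasure_eq_measure)
    also have "\<dots> \<le> (\<integral>\<omega>. ?X \<omega> / \<epsilon> + 1 \<partial>M)"
      using int pt by (intro integral_mono Bochner_Integration.integrable_sum integrable_real_indicator) (auto simp: emeasure_eq_measure)
    finally show "(\<Sum>k<n. prob (?B k)) \<le> (\<integral>\<omega>. ?X \<omega> / \<epsilon> + 1 \<partial>M)" .
  qed simp
  then have "summable (\<lambda>k. prob (?A k))"
    by (rule summable_comparison_test'[where N=0]) (use le in simp)
  then have "AE \<omega> in M. eventually (\<lambda>k. \<omega> \<in> space M - ?A k) sequentially"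
    by (intro borel_cantelli_AE1) (auto simp: emeasure_eq_measure)
  then show ?thesis
  proof eventually_elim
    case (elim \<omega>)
    then obtain N where N: "\<And>k. k \<ge> N \<Longrightarrow> norm (\<xi> k \<omega>) \<le> exp (\<epsilon> * k)"
      by (auto simp: eventually_sequentially not_less)
    obtain C :: nat where C: "1 + (\<Sum>k<N. norm (\<xi> k \<omega>)) \<le> C" using real_arch_simple by blast
    have C1: "real C \<ge> 1" using C sum_nonneg[of "{..<N}" "\<lambda>k. norm (\<xi> k \<omega>)"] by simp
    have "norm (\<xi> k \<omega>) \<le> C * exp (\<epsilon> * k)" for k
    proof (cases "k \<ge> N")
      case True
      have "1 * exp (\<epsilon> * k) \<le> C * exp (\<epsilon> * k)" using C1 by (intro mult_right_mono) auto
      then show ?thesis using N[OF True] by linarith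
    next
      case False
      then have "norm (\<xi> k \<omega>) \<le> (\<Sum>k<N. norm (\<xi> k \<omega>))" by (intro member_le_sum) auto
      also have "\<dots> \<le> real C * 1" using C by simp
      also have "\<dots> \<le> C * exp (\<epsilon> * k)" using e by (intro mult_left_mono) auto
      finally show ?thesis .
    qed
    then show ?case by blast
  qed
qed

section \<open>Random power series\<close>

text \<open>Apart from sign and initial value, individual coefficients are controlled only by
  \<open>b_Suc\<close>; all asymptotic information is in the generating function. Positivity of
  \<open>L\<close> provides levels above the constant term 1.\<close>

locale coefficient_family =
  fixes D :: "complex set" and b :: "nat \<Rightarrow> nat \<Rightarrow> real" and L :: "real \<Rightarrow> real" and \<alpha> :: real
  assumes D: "D = UNIV \<or> D = ball 0 1" and \<alpha>: "\<alpha> > 0"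
    and b_nonneg: "\<And>n k. n \<ge> 1 \<Longrightarrow> b n k \<ge> 0"
    and b_0: "\<And>n. n \<ge> 1 \<Longrightarrow> b n 0 = 1"
    and b_Suc: "\<And>n k. n \<ge> 1 \<Longrightarrow> b n (Suc k) \<le> n * b n k"
    and b_sums: "\<And>n s. n \<ge> 1 \<Longrightarrow> s \<ge> 0 \<Longrightarrow> complex_of_real s \<in> D \<Longrightarrow> (\<lambda>k. b n k * s ^ k) sums exp (n * L s)"
    and L_continuous: "continuous_on {s. s \<ge> 0 \<and> complex_of_real s \<in> D} L"
    and L_pos: "\<And>s. s > 0 \<Longrightarrow> complex_of_real s \<in> D \<Longrightarrow> L s > 0"
begin

definition F :: "nat \<Rightarrow> (nat \<Rightarrow> complex) \<Rightarrow> complex \<Rightarrow> complex" where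
  "F n x z = (\<Sum>k. x k * of_real (b n k powr \<alpha>) * z ^ k)"

text \<open>Up to its random factor, a term has modulus \<open>(b n k * s ^ k) powr \<alpha>\<close>
  with \<open>s = norm z powr (1 / \<alpha>)\<close>, because the coefficients carry the power
  \<open>\<alpha>\<close>; the exponential rate of the largest one is
  \<open>\<alpha> * L s\<close>.\<close>

definition P :: "complex \<Rightarrow> real" where
  "P z = \<alpha> * L (norm z powr (1 / \<alpha>))"

lemma of_real_in_D_iff: "s \<ge> 0 \<Longrightarrow> complex_of_real s \<in> D \<longleftrightarrow> D = UNIV \<or> s < 1"
  using D by auto

lemma larger_in_D:
  assumes "s \<ge> 0" "complex_of_real s \<in> D" obtains s' where "s' > s" "complex_of_real s' \<in> D"
proof (cases "D = UNIV")
  case True then show ?thesis using that[of "s + 1"] by simp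
next
  case False
  then have "s < 1" using assms of_real_in_D_iff by auto
  then show ?thesis using that[of "(s + 1) / 2"] assms(1) by (simp add: of_real_in_D_iff del: of_real_divide of_real_add)
qed

lemma powr_root_in_D: "z \<in> D \<Longrightarrow> complex_of_real (norm z powr (1 / \<alpha>)) \<in> D"
  using D \<alpha> powr_less_mono2[of "1/\<alpha>" "norm z" 1] by (cases "z = 0") (auto simp: of_real_in_D_iff)

lemma coefficient_powr:
  assumes "n \<ge> 1"
  shows "b n k powr \<alpha> * norm z ^ k = (b n k * (norm z powr (1 / \<alpha>)) ^ k) powr \<alpha>"
proof -
  have "((norm z powr (1 / \<alpha>)) ^ k) powr \<alpha> = norm z ^ k"
  proof (cases "z = 0")
    case False
    then have "(norm z powr (1 / \<alpha>)) ^ k = norm z powr (k / \<alpha>)" by (simp add: powr_realpow[symmetric] powr_powr)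
    then show ?thesis using False \<alpha> by (simp add: powr_powr powr_realpow)
  qed (cases k; simp)
  then show ?thesis using b_nonneg[OF assms] by (simp add: powr_mult)
qed

lemma term_le:
  assumes "n \<ge> 1" "s \<ge> 0" "complex_of_real s \<in> D"
  shows "b n k * s ^ k \<le> exp (n * L s)"
  using sums_unique[OF b_sums[OF assms]] sum_le_suminf[OF sums_summable[OF b_sums[OF assms]], of "{k}"] b_nonneg[OF assms(1)] assms(2)
  by simp

text \<open>Enlarging \<open>s\<close> by the factor \<open>exp (2 * \<epsilon> / \<alpha>)\<close>
  gains \<open>exp (- 2 * \<epsilon> * k)\<close> in the term of index \<open>k\<close>: half of the
  exponent absorbs the growth of \<open>x k\<close>, the other half gives the geometric series
  behind \<open>1 - exp (-\<epsilon>)\<close>.\<close>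

lemma growth_bound:
  assumes n: "n \<ge> 1" and x: "\<And>k. norm (x k) \<le> C * exp (\<epsilon> * k)" and \<epsilon>: "\<epsilon> > 0"
    and s: "complex_of_real (norm z powr (1 / \<alpha>) * exp (2 * \<epsilon> / \<alpha>)) \<in> D"
  shows "summable (\<lambda>k. norm (x k * of_real (b n k powr \<alpha>) * z ^ k))"
    "norm (F n x z) \<le> C / (1 - exp (-\<epsilon>)) * exp (n * (\<alpha> * L (norm z powr (1 / \<alpha>) * exp (2 * \<epsilon> / \<alpha>))))"
proof -
  define s where "s = norm z powr (1 / \<alpha>)"
  define s' where "s' = s * exp (2 * \<epsilon> / \<alpha>)"
  have C: "C \<ge> 0" using order_trans[OF norm_ge_zero x[of 0]] by simp
  have s'D: "complex_of_real s' \<in> D" "s' \<ge> 0" using s by (auto simp: s'_def s_def)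
  let ?E = "exp (n * (\<alpha> * L s'))"
  have bd: "norm (x k * of_real (b n k powr \<alpha>) * z ^ k) \<le> C * ?E * exp (-\<epsilon>) ^ k" for k
  proof -
    have "b n k * s ^ k = (b n k * s' ^ k) * exp (- (2 * \<epsilon> * k / \<alpha>))"
    proof -
      have "s' ^ k = s ^ k * exp (2 * \<epsilon> * k / \<alpha>)"
        by (simp add: s'_def power_mult_distrib exp_of_nat_mult[symmetric] mult_ac)
      then show ?thesis by (simp add: exp_minus)
    qed
    also have "\<dots> \<le> exp (n * L s') * exp (- (2 * \<epsilon> * k / \<alpha>))"
      using term_le[OF n s'D(2,1), of k] by (intro mult_right_mono) auto
    also have "\<dots> = exp (n * L s' - 2 * \<epsilon> * k / \<alpha>)" by (simp add: exp_diff exp_minus field_simps)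
    finally have "(b n k * s ^ k) powr \<alpha> \<le> exp (n * L s' - 2 * \<epsilon> * k / \<alpha>) powr \<alpha>"
      using b_nonneg[OF n] \<alpha> by (intro powr_mono2) (auto simp: s_def)
    also have "\<dots> = exp (n * (\<alpha> * L s') - 2 * \<epsilon> * k)" using \<alpha> by (simp add: powr_def algebra_simps)
    finally have 1: "(b n k * s ^ k) powr \<alpha> \<le> exp (n * (\<alpha> * L s') - 2 * \<epsilon> * k)" .
    have "norm (x k * of_real (b n k powr \<alpha>) * z ^ k) = norm (x k) * (b n k powr \<alpha> * norm z ^ k)"
      by (simp add: norm_mult norm_power)
    also have "\<dots> = norm (x k) * (b n k * s ^ k) powr \<alpha>" unfolding coefficient_powr[OF n] s_def ..
    also have "\<dots> \<le> (C * exp (\<epsilon> * k)) * exp (n * (\<alpha> * L s') - 2 * \<epsilon> * k)"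
      using x 1 C by (intro mult_mono) auto
    also have "\<dots> = C * (exp (\<epsilon> * k) * exp (n * (\<alpha> * L s') - 2 * \<epsilon> * k))" by simp
    also have "exp (\<epsilon> * k) * exp (n * (\<alpha> * L s') - 2 * \<epsilon> * k) = ?E * exp (-\<epsilon>) ^ k"
      by (simp add: exp_of_nat_mult[symmetric] exp_add[symmetric] algebra_simps)
    finally show ?thesis by simp
  qed
  have g: "(\<lambda>k. C * ?E * exp (-\<epsilon>) ^ k) sums (C * ?E * (1 / (1 - exp (-\<epsilon>))))"
    using \<epsilon> by (intro sums_mult geometric_sums) simp
  show sm: "summable (\<lambda>k. norm (x k * of_real (b n k powr \<alpha>) * z ^ k))"
    by (rule summable_comparison_test'[OF sums_summable[OF g], where N=0]) (use bd in simp)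
  have "norm (F n x z) \<le> (\<Sum>k. norm (x k * of_real (b n k powr \<alpha>) * z ^ k))"
    unfolding F_def by (rule summable_norm[OF sm])
  also have "\<dots> \<le> C * ?E * (1 / (1 - exp (-\<epsilon>)))"
    using bd sm g by (subst sums_unique[OF g]) (intro suminf_le sums_summable[OF g], auto)
  finally show "norm (F n x z) \<le> C / (1 - exp (-\<epsilon>)) * exp (n * (\<alpha> * L (norm z powr (1 / \<alpha>) * exp (2 * \<epsilon> / \<alpha>))))"
    by (simp add: s'_def s_def)
qed

text \<open>A pigeonhole argument. Terms beyond \<open>l * n\<close> are negligible by comparison
  with a larger radius; if the first \<open>l * n\<close> terms were all below
  \<open>exp (n * (L s - \<delta>))\<close>, the sum could not reach
  \<open>exp (n * L s)\<close>.\<close>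

lemma exists_large_term:
  fixes s \<delta> :: real
  assumes s: "s > 0" "complex_of_real s \<in> D" and \<delta>: "\<delta> > 0"
  shows "eventually (\<lambda>n. \<exists>k. b n k * s ^ k \<ge> exp (n * (L s - \<delta>))) sequentially"
proof -
  obtain s' where s': "s' > s" "complex_of_real s' \<in> D" using larger_in_D s by (metis less_imp_le)
  define \<theta> where "\<theta> = s / s'"
  have \<theta>: "0 < \<theta>" "\<theta> < 1" using s s' by (auto simp: \<theta>_def)
  \<comment> \<open>Chosen so that \<open>\<theta> ^ (l * n)\<close> brings the bound
    \<open>exp (n * L s')\<close> down to \<open>exp (n * (L s - 1))\<close>.\<close>
  obtain l :: nat where l: "(L s' - L s + 1) / (- ln \<theta>) < l" using reals_Archimedean2 by blast
  have ln\<theta>: "- ln \<theta> > 0" using \<theta> by simp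
  then have "L s' - L s + 1 < l * (- ln \<theta>)" using l pos_divide_less_eq by blast
  then have l': "L s' + l * ln \<theta> \<le> L s - 1" by (simp add: algebra_simps)
  have "eventually (\<lambda>n::nat. real l * real n * exp (- \<delta> * n) + exp (- real n) / (1 - \<theta>) < 1) sequentially"
  proof -
    have "(\<lambda>n::nat. real l * real n * exp (- \<delta> * n) + exp (- real n) / (1 - \<theta>)) \<longlonglongrightarrow> 0"
    proof -
      have 1: "(\<lambda>n::nat. real n * exp (- \<delta> * n)) \<longlonglongrightarrow> 0" using \<delta> by real_asymp
      have 2: "(\<lambda>n::nat. exp (- real n)) \<longlonglongrightarrow> 0" by real_asymp
      show ?thesis
        using tendsto_add[OF tendsto_mult[OF tendsto_const[of "real l"] 1] tendsto_divide[OF 2 tendsto_const[of "1 - \<theta>"]]] \<theta>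
        by (simp add: mult.assoc)
    qed
    then show ?thesis by (rule order_tendstoD) simp
  qed
  then show ?thesis using eventually_ge_at_top[of 1]
  proof eventually_elim
    case (elim n)
    show ?case
    proof (rule ccontr)
      assume "\<not> ?thesis"
      then have small: "\<And>k. b n k * s ^ k \<le> exp (n * (L s - \<delta>))" by (auto simp: not_le intro: less_imp_le)
      let ?f = "\<lambda>k. b n k * s ^ k"
      have sums: "?f sums exp (n * L s)" using b_sums[OF elim(2)] s by simp
      have tail: "?f (k + l * n) \<le> exp (n * (L s - 1)) * \<theta> ^ k" for k
      proof -
        have "?f (k + l * n) = (b n (k + l * n) * s' ^ (k + l * n)) * \<theta> ^ (k + l * n)"
          using s s' by (simp add: \<theta>_def power_divide)
        also have "\<dots> \<le> exp (n * L s') * \<theta> ^ (k + l * n)"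
          using term_le[OF elim(2) _ s'(2)] s s' \<theta> by (intro mult_right_mono) auto
        also have "\<theta> ^ (k + l * n) = \<theta> ^ k * exp (l * n * ln \<theta>)"
          using \<theta> by (simp add: power_add exp_of_nat_mult[symmetric, of "l * n"] powr_def powr_realpow[symmetric])
        also have "exp (n * L s') * (\<theta> ^ k * exp (l * n * ln \<theta>)) = exp (n * (L s' + l * ln \<theta>)) * \<theta> ^ k"
          by (simp add: exp_add[symmetric] algebra_simps)
        also have "\<dots> \<le> exp (n * (L s - 1)) * \<theta> ^ k"
          using l' \<theta> by (intro mult_right_mono) (auto intro!: mult_left_mono)
        finally show ?thesis .
      qed
      have g: "(\<lambda>k. exp (n * (L s - 1)) * \<theta> ^ k) sums (exp (n * (L s - 1)) * (1 / (1 - \<theta>)))"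
        using \<theta> by (intro sums_mult geometric_sums) simp
      have "exp (n * L s) = (\<Sum>k. ?f (k + l * n)) + (\<Sum>k<l * n. ?f k)"
        using suminf_split_initial_segment[OF sums_summable[OF sums], of "l * n"] sums_unique[OF sums] by simp
      also have "\<dots> \<le> exp (n * (L s - 1)) * (1 / (1 - \<theta>)) + (\<Sum>k<l * n. exp (n * (L s - \<delta>)))"
      proof (intro add_mono sum_mono small)
        have "(\<Sum>k. ?f (k + l * n)) \<le> (\<Sum>k. exp (n * (L s - 1)) * \<theta> ^ k)"
          by (intro suminf_le tail summable_ignore_initial_segment sums_summable[OF sums] sums_summable[OF g])
        then show "(\<Sum>k. ?f (k + l * n)) \<le> exp (n * (L s - 1)) * (1 / (1 - \<theta>))" using sums_unique[OF g] by simp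
      qed
      also have "\<dots> = exp (n * L s) * (real l * real n * exp (- \<delta> * n) + exp (- real n) / (1 - \<theta>))"
        by (simp add: algebra_simps exp_diff exp_minus divide_simps)
      also have "\<dots> < exp (n * L s) * 1" using elim(1) by (intro mult_strict_left_mono) auto
      finally show False by simp
    qed
  qed
qed

text \<open>
  The indices are the first ones at which the terms exceed the given levels: consecutive terms
  grow at most by the factor \<open>n * s\<close>, so no level is overshot by more.
\<close>

lemma exists_separated_terms:
  fixes s \<delta> :: real and N :: nat
  assumes s: "s > 0" "complex_of_real s \<in> D" and \<delta>: "\<delta> > 0" and N: "N * \<delta> < L s"
  shows "eventually (\<lambda>n. \<exists>\<kappa>::nat \<Rightarrow> nat. \<forall>j<N. exp (n * (L s - (real j + 1) * \<delta>)) \<le> b n (\<kappa> j) * s ^ \<kappa> j \<and>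
    b n (\<kappa> j) * s ^ \<kappa> j \<le> n * s * exp (n * (L s - (real j + 1) * \<delta>))) sequentially"
  using exists_large_term[OF s \<delta>] eventually_ge_at_top[of 1]
proof eventually_elim
  case (elim n)
  obtain k0 where k0: "b n k0 * s ^ k0 \<ge> exp (n * (L s - \<delta>))" using elim(1) by blast
  have "\<exists>k. exp (n * (L s - (real j + 1) * \<delta>)) \<le> b n k * s ^ k \<and> b n k * s ^ k \<le> n * s * exp (n * (L s - (real j + 1) * \<delta>))"
    if j: "j < N" for j :: nat
  proof -
    let ?e = "exp (n * (L s - (real j + 1) * \<delta>))"
    have ex: "?e \<le> b n k0 * s ^ k0"
    proof (rule order_trans[OF _ k0])
      have "n * (L s - (real j + 1) * \<delta>) \<le> n * (L s - \<delta>)" using \<delta> by (intro mult_left_mono) (auto simp: algebra_simps)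
      then show "?e \<le> exp (n * (L s - \<delta>))" by simp
    qed
    define k where "k = (LEAST k. ?e \<le> b n k * s ^ k)"
    have k: "?e \<le> b n k * s ^ k" unfolding k_def by (rule LeastI[of _ k0]) (rule ex)
    \<comment> \<open>All levels exceed 1, the term of index 0, so the first index above a level has
      a predecessor to compare with.\<close>
    have "(real j + 1) * \<delta> \<le> N * \<delta>" using j \<delta> by (intro mult_right_mono) auto
    then have "L s - (real j + 1) * \<delta> > 0" using N by simp
    then have "n * (L s - (real j + 1) * \<delta>) > 0" using elim(2) by (intro mult_pos_pos) auto
    then have "?e > 1" by simp
    then have "k \<noteq> 0" using k b_0[OF elim(2)] by (intro notI) simp
    then obtain k' where k': "k = Suc k'" using not0_implies_Suc by blast
    have "\<not> ?e \<le> b n k' * s ^ k'" using not_less_Least[of k' "\<lambda>k. ?e \<le> b n k * s ^ k"] k' unfolding k_def by simp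
    then have lt: "b n k' * s ^ k' \<le> ?e" by simp
    have "b n k * s ^ k = b n (Suc k') * (s * s ^ k')" by (simp add: k')
    also have "\<dots> \<le> (n * b n k') * (s * s ^ k')"
      using b_Suc[OF elim(2)] s by (intro mult_right_mono) auto
    also have "\<dots> = n * s * (b n k' * s ^ k')" by simp
    also have "\<dots> \<le> n * s * ?e" using lt s by (intro mult_left_mono) auto
    finally show ?thesis using k by blast
  qed
  then obtain \<kappa> where "\<And>j. j < N \<Longrightarrow> exp (n * (L s - (real j + 1) * \<delta>)) \<le> b n (\<kappa> j) * s ^ \<kappa> j \<and>
    b n (\<kappa> j) * s ^ \<kappa> j \<le> n * s * exp (n * (L s - (real j + 1) * \<delta>))" by metis
  then show ?case by (intro exI[of _ \<kappa>]) simp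
qed

end

section \<open>Convergence, measurability and pointwise lower bound of the random series\<close>

lemma measurable_suminf_banach [measurable (raw)]:
  fixes f :: "nat \<Rightarrow> 'a \<Rightarrow> complex"
  assumes [measurable]: "\<And>i. f i \<in> borel_measurable M"
  shows "(\<lambda>x. \<Sum>i. f i x) \<in> borel_measurable M"
  unfolding suminf_eq_lim by measurable

lemma (in prob_space) tail_prob_tendsto_0:
  fixes X :: "'a \<Rightarrow> complex"
  assumes [measurable]: "X \<in> borel_measurable M" and f: "filterlim f at_top sequentially"
  shows "(\<lambda>n. prob {\<omega>\<in>space M. norm (X \<omega>) > f n}) \<longlonglongrightarrow> 0"
proof (rule LIMSEQ_I)
  fix e :: real assume e: "e > 0"
  let ?A = "\<lambda>i::nat. {\<omega>\<in>space M. norm (X \<omega>) > real i}"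
  have "(\<lambda>i. prob (?A i)) \<longlonglongrightarrow> prob (\<Inter>i. ?A i)"
    by (intro finite_Lim_measure_decseq) (auto simp: decseq_def)
  also have "(\<Inter>i. ?A i) = {}" by (auto, metis linorder_not_less real_arch_simple)
  finally have "(\<lambda>i. prob (?A i)) \<longlonglongrightarrow> 0" by simp
  then obtain i where i: "prob (?A i) < e" using e by (metis (no_types, lifting) LIMSEQ_D diff_0_right order_refl real_norm_def abs_of_nonneg measure_nonneg)
  from f have "eventually (\<lambda>n. f n \<ge> real i) sequentially" by (simp add: filterlim_at_top)
  then obtain n0 where n0: "\<And>n. n \<ge> n0 \<Longrightarrow> f n \<ge> real i" by (auto simp: eventually_sequentially)
  show "\<exists>no. \<forall>n\<ge>no. norm (prob {\<omega>\<in>space M. norm (X \<omega>) > f n} - 0) < e"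
  proof (intro exI[of _ n0] allI impI)
    fix n assume "n \<ge> n0"
    then have "prob {\<omega>\<in>space M. norm (X \<omega>) > f n} \<le> prob (?A i)"
      using n0[of n] by (intro finite_measure_mono) auto
    with i show "norm (prob {\<omega>\<in>space M. norm (X \<omega>) > f n} - 0) < e" by simp
  qed
qed

context coefficient_family
begin

text \<open>A countable exhaustion of \<open>D\<close> by discs, which keeps convergence on all of
  \<open>D\<close> a measurable condition.\<close>

definition radius :: "nat \<Rightarrow> real" where
  "radius j = (if D = UNIV then real j else real j / (real j + 1))"

definition converges :: "nat \<Rightarrow> (nat \<Rightarrow> complex) \<Rightarrow> bool" where
  "converges n x \<longleftrightarrow> (\<forall>j. summable (\<lambda>k. norm (x k * of_real (b n k powr \<alpha>)) * radius j ^ k))"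

lemma radius: "radius j \<ge> 0" "complex_of_real (radius j) \<in> D"
  by (auto simp: radius_def of_real_in_D_iff simp del: of_real_divide of_real_add)

lemma radius_ge: assumes "z \<in> D" shows "\<exists>j. norm z \<le> radius j"
proof (cases "D = UNIV")
  case True
  obtain j :: nat where "norm z \<le> j" using real_arch_simple by blast
  then show ?thesis unfolding radius_def using True by auto
next
  case False
  then have z: "norm z < 1" using D assms by auto
  obtain j :: nat where j: "norm z / (1 - norm z) \<le> j" using real_arch_simple by blast
  then have "norm z \<le> j * (1 - norm z)" using z by (simp add: divide_le_eq)
  then have "norm z * (real j + 1) \<le> real j" by (simp add: algebra_simps)
  then show ?thesis using False by (intro exI[of _ j]) (simp add: radius_def le_divide_eq add_nonneg_pos)
qed

lemma converges_summable:
  assumes "converges n x" "z \<in> D"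
  shows "summable (\<lambda>k. norm (x k * of_real (b n k powr \<alpha>) * z ^ k))"
proof -
  obtain j where j: "norm z \<le> radius j" using radius_ge[OF assms(2)] by blast
  have "summable (\<lambda>k. norm (x k * of_real (b n k powr \<alpha>)) * radius j ^ k)" using assms(1) by (auto simp: converges_def)
  then show ?thesis
    by (rule summable_comparison_test'[where N=0]) (use j in \<open>auto simp: norm_mult norm_power intro!: mult_left_mono power_mono\<close>)
qed

lemma converges_sums:
  assumes "converges n x" "z \<in> D"
  shows "(\<lambda>k. x k * of_real (b n k powr \<alpha>) * z ^ k) sums F n x z"
  unfolding F_def by (rule summable_sums[OF summable_norm_cancel[OF converges_summable[OF assms]]])

lemma converges_holomorphic:
  assumes "converges n x" shows "F n x holomorphic_on D"
proof -
  have *: "F n x holomorphic_on ball 0 r" if "ball 0 r \<subseteq> D" for r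
    by (rule power_series_holomorphic[where a="\<lambda>k. x k * of_real (b n k powr \<alpha>)"])
      (use that converges_sums[OF assms] in auto)
  show ?thesis
  proof (cases "D = UNIV")
    case True
    have "F n x holomorphic_on UNIV"
      unfolding holomorphic_on_open[OF open_UNIV]
    proof
      fix z :: complex
      have "F n x holomorphic_on ball 0 (norm z + 1)" using * True by simp
      then show "\<exists>f'. DERIV (F n x) z :> f'" by (subst (asm) holomorphic_on_open) auto
    qed
    with True show ?thesis by simp
  qed (use * D in auto)
qed

lemma open_D: "open D" and connected_D: "connected D"
  using D by auto

text \<open>A divergent \<^const>\<open>suminf\<close> has a fixed junk value, so the function is constant near the boundary.\<close>

lemma not_converges_constant:
  assumes "\<not> converges n x" "F n x analytic_on D"
  shows "\<exists>c. \<forall>z\<in>D. F n x z = c"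
proof -
  obtain j where j: "\<not> summable (\<lambda>k. norm (x k * of_real (b n k powr \<alpha>)) * radius j ^ k)"
    using assms(1) by (auto simp: converges_def)
  let ?c = "THE s :: complex. False"
  let ?U = "{z \<in> D. norm z > radius j}"
  have c: "F n x z = ?c" if "z \<in> ?U" for z
  proof -
    \<comment> \<open>Convergence at a point implies absolute convergence at every smaller radius,
      in particular at \<open>radius j\<close>.\<close>
    have "\<not> summable (\<lambda>k. x k * of_real (b n k powr \<alpha>) * z ^ k)"
    proof
      assume "summable (\<lambda>k. x k * of_real (b n k powr \<alpha>) * z ^ k)"
      from powser_insidea[OF this, of "of_real (radius j)"] that radius(1)[of j] j
      show False by (simp add: norm_mult norm_power)
    qed
    then have "((sums) (\<lambda>k. x k * of_real (b n k powr \<alpha>) * z ^ k)) = (\<lambda>s. False)" by (auto simp: summable_def fun_eq_iff)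
    then show ?thesis unfolding F_def suminf_def by (simp only:)
  qed
  have openU: "open ?U"
  proof -
    have "?U = D \<inter> - cball 0 (radius j)" by auto
    then show ?thesis by (simp only:) (intro open_Int open_D open_Compl closed_cball)
  qed
  obtain s where s: "s > radius j" "complex_of_real s \<in> D" using larger_in_D[OF radius] by blast
  then have ne: "?U \<noteq> {}" using radius(1)[of j] by (auto intro!: exI[of _ "complex_of_real s"])
  have "F n x z = ?c" if "z \<in> D" for z
    by (rule analytic_continuation_open[OF openU open_D ne connected_D _ analytic_imp_holomorphic[OF assms(2)] holomorphic_on_const c that]) auto
  then show ?thesis by blast
qed

lemma converges_measurable:
  assumes [measurable]: "\<And>k. \<xi> k \<in> borel_measurable M"
  shows "Measurable.pred M (\<lambda>\<omega>. converges n (\<lambda>k. \<xi> k \<omega>))"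
proof -
  \<comment> \<open>With nonnegative terms, convergence means that the partial sums are bounded by a
    natural number, so all quantifiers are countable.\<close>
  have eq: "summable f \<longleftrightarrow> (\<exists>B::nat. \<forall>m. (\<Sum>k<m. f k) \<le> B)" if f: "\<And>k. f k \<ge> 0" for f :: "nat \<Rightarrow> real"
  proof
    assume "summable f"
    obtain B :: nat where B: "suminf f \<le> B" using real_arch_simple by blast
    have "(\<Sum>k<m. f k) \<le> B" for m
      using sum_le_suminf[OF \<open>summable f\<close>, of "{..<m}"] f B by force
    then show "\<exists>B::nat. \<forall>m. (\<Sum>k<m. f k) \<le> B" by blast
  next
    assume "\<exists>B::nat. \<forall>m. (\<Sum>k<m. f k) \<le> B"
    then show "summable f" using f by (auto intro: summableI_nonneg_bounded)
  qed
  have "converges n (\<lambda>k. \<xi> k \<omega>) \<longleftrightarrow> (\<forall>j. \<exists>B::nat. \<forall>m. (\<Sum>k<m. norm (\<xi> k \<omega> * of_real (b n k powr \<alpha>)) * radius j ^ k) \<le> B)" for \<omega>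
    unfolding converges_def by (intro all_cong1 eq) (simp add: radius(1))
  then show ?thesis by simp
qed

lemma AE_converges:
  fixes M :: "'a measure"
  assumes "prob_space M" and \<xi>: "\<And>k. \<xi> k \<in> borel_measurable M" and id: "\<And>k. distr M borel (\<xi> k) = distr M borel (\<xi> 0)"
    and int: "integrable M (\<lambda>\<omega>. ln (1 + norm (\<xi> 0 \<omega>)))" and n: "n \<ge> 1"
  shows "AE \<omega> in M. converges n (\<lambda>k. \<xi> k \<omega>)"
proof -
  interpret prob_space M by fact
  have "AE \<omega> in M. summable (\<lambda>k. norm (\<xi> k \<omega> * of_real (b n k powr \<alpha>)) * radius j ^ k)" for j
  proof -
    define s where "s = norm (complex_of_real (radius j)) powr (1 / \<alpha>)"
    have s: "s \<ge> 0" "complex_of_real s \<in> D" unfolding s_def by (simp, rule powr_root_in_D[OF radius(2)])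
    obtain s' where s': "s' > s" "complex_of_real s' \<in> D" using larger_in_D[OF s] by blast
    \<comment> \<open>The growth estimate needs a slightly larger radius; openness of
      \<open>D\<close> leaves room for it.\<close>
    have "\<exists>\<epsilon>>0. complex_of_real (s * exp (2 * \<epsilon> / \<alpha>)) \<in> D"
    proof (cases "s = 0")
      case True then show ?thesis using s by (intro exI[of _ 1]) simp
    next
      case False
      then have "exp (2 * (\<alpha> * ln (s' / s) / 2) / \<alpha>) = s' / s" using s s' \<alpha> by simp
      moreover have "\<alpha> * ln (s' / s) / 2 > 0" using s s' \<alpha> False by simp
      ultimately show ?thesis using s' False by (intro exI[of _ "\<alpha> * ln (s' / s) / 2"]) (simp del: of_real_mult of_real_divide)
    qed
    then obtain \<epsilon> where \<epsilon>: "\<epsilon> > 0" "complex_of_real (s * exp (2 * \<epsilon> / \<alpha>)) \<in> D" by blast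
    from log_moment_growth[where \<xi>=\<xi>, OF \<xi> id int \<epsilon>(1)]
    show ?thesis
    proof eventually_elim
      case (elim \<omega>)
      then obtain C :: nat where "\<And>k. norm (\<xi> k \<omega>) \<le> C * exp (\<epsilon> * k)" by blast
      from growth_bound(1)[OF n this \<epsilon>(1), of "complex_of_real (radius j)"] \<epsilon>(2)
      show ?case using radius(1)[of j] by (simp add: s_def norm_mult norm_power)
    qed
  qed
  then show ?thesis unfolding converges_def by (simp add: AE_all_countable)
qed

lemma F_measurable:
  assumes [measurable]: "\<And>k. \<xi> k \<in> borel_measurable M"
  shows "(\<lambda>(\<omega>, z). F n (\<lambda>k. \<xi> k \<omega>) z) \<in> borel_measurable (M \<Otimes>\<^sub>M borel)"
    "(\<lambda>\<omega>. F n (\<lambda>k. \<xi> k \<omega>) z) \<in> borel_measurable M"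
  unfolding F_def by measurable

text \<open>\<open>N\<close> is fixed first, with \<open>q ^ N\<close> small. Then \<open>N\<close>
  terms are placed at rates \<open>\<mu>\<close> apart, and the coefficients are capped by
  \<open>K n\<close>, whose growth rate is half that of the ratio of consecutive terms: slow enough
  for domination, fast enough for the caps to hold with probability tending to 1. The origin is
  excluded because only one term survives there.\<close>

lemma F_lower_bound:
  fixes M :: "'a measure" and \<xi> :: "nat \<Rightarrow> 'a \<Rightarrow> complex"
  assumes "prob_space M" and ind: "prob_space.indep_vars M (\<lambda>_. borel) \<xi> UNIV"
    and id: "\<And>k. distr M borel (\<xi> k) = distr M borel (\<xi> 0)"
    and nd: "\<not> (\<exists>c. AE \<omega> in M. \<xi> 0 \<omega> = c)"
    and conv: "\<And>n. n \<ge> 1 \<Longrightarrow> AE \<omega> in M. converges n (\<lambda>k. \<xi> k \<omega>)"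
    and z: "z \<in> D" "z \<noteq> 0" and \<epsilon>: "\<epsilon> > 0"
  shows "(\<lambda>n. measure M {\<omega>\<in>space M. norm (F n (\<lambda>k. \<xi> k \<omega>) z) \<le> exp (n * (P z - \<epsilon>))}) \<longlonglongrightarrow> 0"
proof -
  interpret prob_space M by fact
  have \<xi>m [measurable]: "\<xi> k \<in> borel_measurable M" for k using ind by (simp add: indep_vars_def)
  have idp: "prob {\<omega>\<in>space M. Q (\<xi> k \<omega>)} = prob {\<omega>\<in>space M. Q (\<xi> 0 \<omega>)}" if [measurable]: "Measurable.pred borel Q" for k Q
  proof -
    have "prob {\<omega>\<in>space M. Q (\<xi> k \<omega>)} = measure (distr M borel (\<xi> k)) {x. Q x}" for k
      by (subst measure_distr) (auto intro!: arg_cong[where f=prob])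
    then show ?thesis using id[of k] by simp
  qed
  obtain \<delta>0 q where \<delta>0: "\<delta>0 > 0" and q1: "q < 1" and q: "\<And>c. prob {\<omega>\<in>space M. norm (\<xi> 0 \<omega> - c) \<le> \<delta>0} \<le> q"
    using nondegenerate_imp_ball_prob_less_1[OF \<xi>m nd] by blast
  have q': "prob {\<omega>\<in>space M. norm (\<xi> m \<omega> - c) \<le> \<delta>0} \<le> q" for m c
    using q[of c] idp[of "\<lambda>x. norm (x - c) \<le> \<delta>0" m] by simp
  have q0: "q \<ge> 0" using order_trans[OF measure_nonneg q] .
  define s where "s = norm z powr (1 / \<alpha>)"
  have s: "s > 0" "complex_of_real s \<in> D" using z powr_root_in_D by (auto simp: s_def)
  have Pz: "P z = \<alpha> * L s" by (simp add: P_def s_def)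
  have "eventually (\<lambda>n. prob {\<omega>\<in>space M. norm (F n (\<lambda>k. \<xi> k \<omega>) z) \<le> exp (n * (P z - \<epsilon>))} < \<eta>) sequentially" if \<eta>: "\<eta> > 0" for \<eta>
  proof -
    obtain N where N: "q ^ N < \<eta> / 2" using real_arch_pow_inv[of "\<eta>/2" q] \<eta> q1 by auto
    have half: "(real N + 1) * (m / (2 * (real N + 1))) = m / 2" for m
    proof -
      have *: "x * (m / (2 * x)) = m / 2" if "x \<noteq> 0" for x :: real using that by simp
      show ?thesis by (rule *) (simp add: add_nonneg_eq_0_iff)
    qed
    \<comment> \<open>The bound \<open>\<epsilon> / \<alpha>\<close> keeps the chosen terms above
      \<open>exp (n * (P z - \<epsilon>))\<close>, the bound \<open>L s\<close> keeps their levels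
      above 1.\<close>
    define m where "m = min (\<epsilon> / \<alpha>) (L s)"
    have m: "m > 0" "m \<le> L s" "m \<le> \<epsilon> / \<alpha>" using \<epsilon> \<alpha> L_pos[OF s] by (simp_all add: m_def)
    define \<mu> where "\<mu> = m / (2 * (real N + 1))"
    have \<mu>: "\<mu> > 0" using m by (simp add: \<mu>_def add_nonneg_pos)
    have N\<mu>: "N * \<mu> \<le> m / 2"
    proof -
      have "N * \<mu> \<le> (real N + 1) * \<mu>" using \<mu> by (simp add: algebra_simps)
      also have "\<dots> = m / 2" unfolding \<mu>_def by (rule half)
      finally show ?thesis .
    qed
    have N\<mu>L: "N * \<mu> < L s" using N\<mu> m by linarith
    have N\<mu>e: "\<alpha> * (N * \<mu>) \<le> \<epsilon> / 2"
    proof -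
      have "N * \<mu> \<le> \<epsilon> / \<alpha> / 2" 
        by (rule order_trans[OF N\<mu> divide_right_mono[OF m(3)]]) simp
      then have "\<alpha> * (N * \<mu>) \<le> \<alpha> * (\<epsilon> / \<alpha> / 2)" using \<alpha> by (intro mult_left_mono) auto
      then show ?thesis using \<alpha> by simp
    qed
    define K where "K = (\<lambda>n::nat. exp (\<alpha> * \<mu> * n / 2))"
    have Klim: "filterlim K at_top sequentially" unfolding K_def using \<alpha> \<mu> by real_asymp
    have "eventually (\<lambda>n. prob {\<omega>\<in>space M. norm (\<xi> 0 \<omega>) > K n} < \<eta> / (2 * (real N + 1))) sequentially"
      using \<eta> by (intro order_tendstoD(2)[OF tail_prob_tendsto_0[OF \<xi>m Klim]]) simp
    \<comment> \<open>The first summand is the influence of the later terms, the second that of the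
      target size \<open>t\<close>, both relative to the level of the term considered.\<close>
    moreover have "eventually (\<lambda>n::nat. N * (n * s) powr \<alpha> * exp (- (\<alpha> * \<mu> * n / 2)) + exp (- (n * \<epsilon> / 2)) < \<delta>0) sequentially"
    proof -
      have 1: "(\<lambda>n::nat. real n powr \<alpha> * exp (- (\<alpha> * \<mu> * n / 2))) \<longlonglongrightarrow> 0" using \<alpha> \<mu> by real_asymp
      have 2: "(\<lambda>n::nat. exp (- (n * \<epsilon> / 2))) \<longlonglongrightarrow> 0" using \<epsilon> by real_asymp
      have "(\<lambda>n::nat. N * s powr \<alpha> * (real n powr \<alpha> * exp (- (\<alpha> * \<mu> * n / 2))) + exp (- (n * \<epsilon> / 2))) \<longlonglongrightarrow> N * s powr \<alpha> * 0 + 0"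
        by (intro tendsto_intros 1 2)
      then have "(\<lambda>n::nat. N * (n * s) powr \<alpha> * exp (- (\<alpha> * \<mu> * n / 2)) + exp (- (n * \<epsilon> / 2))) \<longlonglongrightarrow> 0"
        using s by (simp add: powr_mult mult_ac)
      then show ?thesis using \<delta>0 by (rule order_tendstoD)
    qed
    moreover have "eventually (\<lambda>n. K n > \<delta>0) sequentially"
      using Klim by (simp add: filterlim_at_top_dense)
    ultimately show ?thesis
      using exists_separated_terms[OF s \<mu> N\<mu>L] eventually_ge_at_top[of 1]
    proof eventually_elim
      case (elim n)
      note tail = elim(1) and domn = elim(2) and Kn = elim(3) and n = elim(5)
      obtain \<kappa> :: "nat \<Rightarrow> nat" where
        \<kappa>: "\<And>j. j < N \<Longrightarrow> exp (n * (L s - (real j + 1) * \<mu>)) \<le> b n (\<kappa> j) * s ^ \<kappa> j"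
          "\<And>j. j < N \<Longrightarrow> b n (\<kappa> j) * s ^ \<kappa> j \<le> n * s * exp (n * (L s - (real j + 1) * \<mu>))"
        using elim(4) by blast
      define a where "a = (\<lambda>j. of_real (b n (\<kappa> j) powr \<alpha>) * z ^ \<kappa> j)"
      define E where "E = (\<lambda>j::nat. exp (n * \<alpha> * (L s - (real j + 1) * \<mu>)))"
      have na: "norm (a j) = (b n (\<kappa> j) * s ^ \<kappa> j) powr \<alpha>" for j
        using coefficient_powr[OF n, of "\<kappa> j" z] by (simp add: a_def s_def norm_mult norm_power)
      have Epow: "exp (n * (L s - (real j + 1) * \<mu>)) powr \<alpha> = E j" for j
        by (simp add: E_def powr_def mult_ac)
      have lo: "E j \<le> norm (a j)" if "j < N" for j
        unfolding na Epow[symmetric] using \<kappa>(1)[OF that] \<alpha> by (intro powr_mono2) auto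
      have hi: "norm (a j) \<le> (n * s) powr \<alpha> * E j" if "j < N" for j
      proof -
        have "norm (a j) \<le> (n * s * exp (n * (L s - (real j + 1) * \<mu>))) powr \<alpha>"
          unfolding na using \<kappa>(2)[OF that] \<alpha> b_nonneg[OF n] s by (intro powr_mono2) auto
        also have "\<dots> = (n * s) powr \<alpha> * E j" using s by (subst powr_mult) (auto simp: Epow)
        finally show ?thesis .
      qed
      have a0: "a j \<noteq> 0" if "j < N" for j
      proof -
        have "norm (a j) > 0" using lo[OF that] by (rule less_le_trans[rotated]) (simp add: E_def)
        then show ?thesis by auto
      qed
      define t where "t = exp (n * (P z - \<epsilon>))"
      have dom: "K n * (\<Sum>l\<in>{j<..<N}. norm (a l)) + t \<le> \<delta>0 * norm (a j)" if j: "j < N" for j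
      proof -
        have "norm (a l) \<le> (n * s) powr \<alpha> * (E j * exp (- (\<alpha> * \<mu> * n)))" if l: "l \<in> {j<..<N}" for l
        proof -
          have "(real j + 2) * \<mu> \<le> (real l + 1) * \<mu>" using l \<mu> by (intro mult_right_mono) auto
          then have "n * \<alpha> * (L s - (real l + 1) * \<mu>) \<le> n * \<alpha> * (L s - (real j + 2) * \<mu>)"
            using \<alpha> by (intro mult_left_mono) auto
          then have "E l \<le> exp (n * \<alpha> * (L s - (real j + 2) * \<mu>))" by (simp add: E_def)
          also have "\<dots> = E j * exp (- (\<alpha> * \<mu> * n))" by (simp add: E_def exp_add[symmetric] algebra_simps)
          finally have "(n * s) powr \<alpha> * E l \<le> (n * s) powr \<alpha> * (E j * exp (- (\<alpha> * \<mu> * n)))" by (intro mult_left_mono) auto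
          then show ?thesis using hi[of l] l by auto
        qed
        then have "(\<Sum>l\<in>{j<..<N}. norm (a l)) \<le> (\<Sum>l\<in>{j<..<N}. (n * s) powr \<alpha> * (E j * exp (- (\<alpha> * \<mu> * n))))"
          by (rule sum_mono)
        also have "\<dots> = real (card {j<..<N}) * ((n * s) powr \<alpha> * (E j * exp (- (\<alpha> * \<mu> * n))))" by simp
        also have "\<dots> \<le> N * ((n * s) powr \<alpha> * (E j * exp (- (\<alpha> * \<mu> * n))))"
          by (intro mult_right_mono) (auto simp: E_def)
        finally have "K n * (\<Sum>l\<in>{j<..<N}. norm (a l)) \<le> K n * (N * ((n * s) powr \<alpha> * (E j * exp (- (\<alpha> * \<mu> * n)))))"
          by (intro mult_left_mono) (auto simp: K_def)
        also have "\<dots> = N * (n * s) powr \<alpha> * (K n * exp (- (\<alpha> * \<mu> * n))) * E j" by simp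
        also have "K n * exp (- (\<alpha> * \<mu> * n)) = exp (- (\<alpha> * \<mu> * n / 2))"
          by (simp add: K_def exp_add[symmetric])
        finally have 1: "K n * (\<Sum>l\<in>{j<..<N}. norm (a l)) \<le> N * (n * s) powr \<alpha> * exp (- (\<alpha> * \<mu> * n / 2)) * E j" .
        have "(real j + 1) * \<mu> \<le> N * \<mu>" using j \<mu> by (intro mult_right_mono) auto
        then have "\<alpha> * ((real j + 1) * \<mu>) \<le> \<alpha> * (N * \<mu>)" using \<alpha> by (intro mult_left_mono) auto
        then have "\<alpha> * ((real j + 1) * \<mu>) \<le> \<epsilon> / 2" using N\<mu>e by linarith
        then have "n * (\<alpha> * ((real j + 1) * \<mu>)) \<le> n * (\<epsilon> / 2)" by (intro mult_left_mono) auto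
        then have "n * (P z - \<epsilon>) \<le> - (n * \<epsilon> / 2) + n * \<alpha> * (L s - (real j + 1) * \<mu>)"
          unfolding Pz by (simp add: algebra_simps)
        then have "t \<le> exp (- (n * \<epsilon> / 2) + n * \<alpha> * (L s - (real j + 1) * \<mu>))" by (simp only: t_def exp_le_cancel_iff)
        then have 2: "t \<le> exp (- (n * \<epsilon> / 2)) * E j" by (simp only: exp_add E_def)
        have "K n * (\<Sum>l\<in>{j<..<N}. norm (a l)) + t \<le> (N * (n * s) powr \<alpha> * exp (- (\<alpha> * \<mu> * n / 2)) + exp (- (n * \<epsilon> / 2))) * E j"
          using 1 2 by (simp only: distrib_right)
        also have "\<dots> \<le> \<delta>0 * E j" using domn by (intro mult_right_mono) (auto simp: E_def)
        also have "\<dots> \<le> \<delta>0 * norm (a j)" using lo[OF j] \<delta>0 by (intro mult_left_mono) auto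
        finally show ?thesis .
      qed
      \<comment> \<open>Equal indices would give terms of equal size, but domination with
        \<open>K n > \<delta>0\<close> makes the later term strictly smaller.\<close>
      have inj: "inj_on \<kappa> {..<N}"
      proof (rule linorder_inj_onI)
        fix i j assume ij: "i < j" "i \<in> {..<N}" "j \<in> {..<N}"
        show "\<kappa> i \<noteq> \<kappa> j"
        proof
          assume "\<kappa> i = \<kappa> j"
          then have e: "norm (a i) = norm (a j)" by (simp add: na)
          have "norm (a j) \<le> (\<Sum>l\<in>{i<..<N}. norm (a l))" using ij by (intro member_le_sum) auto
          then have "K n * norm (a j) \<le> K n * (\<Sum>l\<in>{i<..<N}. norm (a l))" by (intro mult_left_mono) (auto simp: K_def)
          also have "\<dots> \<le> \<delta>0 * norm (a i)" using dom[of i] ij by (simp add: t_def) (smt (verit) exp_gt_zero)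
          finally have "K n * norm (a j) \<le> \<delta>0 * norm (a j)" by (simp add: e)
          moreover have "norm (a j) > 0" using a0[of j] ij by simp
          ultimately show False using Kn by simp
        qed
      qed (rule linear)
      define A where "A = \<kappa> ` {..<N}"
      \<comment> \<open>The chosen terms are set to 0 inside the series, so \<open>R\<close> is
        invariant under changes of their coefficients whether or not the series converges.\<close>
      define R where "R = (\<lambda>x. \<Sum>k. if k \<in> A then 0 else x k * of_real (b n k powr \<alpha>) * z ^ k :: complex)"
      have Rm: "R \<in> borel_measurable (PiM UNIV (\<lambda>_. borel))" unfolding R_def by measurable
      have Rinv: "R (x(\<kappa> j := c)) = R x" if "j < N" for x j c
      proof -
        have "\<kappa> j \<in> A" using that by (auto simp: A_def)
        then show ?thesis unfolding R_def by (intro suminf_cong) auto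
      qed
      have split: "F n x z = R x + (\<Sum>j<N. a j * x (\<kappa> j))" if x: "converges n x" for x
      proof -
        let ?f = "\<lambda>k. x k * of_real (b n k powr \<alpha>) * z ^ k"
        have f: "?f sums F n x z" by (rule converges_sums[OF x z(1)])
        have g: "(\<lambda>k. if k \<in> A then ?f k else 0) sums (\<Sum>k\<in>A. ?f k)" by (rule sums_If_finite_set) (simp add: A_def)
        have "(\<lambda>k. ?f k - (if k \<in> A then ?f k else 0)) sums (F n x z - (\<Sum>k\<in>A. ?f k))" by (rule sums_diff[OF f g])
        also have "(\<lambda>k. ?f k - (if k \<in> A then ?f k else 0)) = (\<lambda>k. if k \<in> A then 0 else ?f k)" by auto
        finally have "R x = F n x z - (\<Sum>k\<in>A. ?f k)" unfolding R_def by (rule sums_unique[symmetric])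
        moreover have "(\<Sum>k\<in>A. ?f k) = (\<Sum>j<N. a j * x (\<kappa> j))"
          unfolding A_def by (subst sum.reindex[OF inj]) (auto simp: a_def mult_ac)
        ultimately show ?thesis by simp
      qed
      let ?B = "{\<omega>\<in>space M. norm (F n (\<lambda>k. \<xi> k \<omega>) z) \<le> t}"
      let ?G = "{\<omega>\<in>space M. norm (R (\<lambda>i. \<xi> i \<omega>) + (\<Sum>j<N. a j * \<xi> (\<kappa> j) \<omega>)) \<le> t \<and> (\<forall>j<N. norm (\<xi> (\<kappa> j) \<omega>) \<le> K n)}"
      let ?T = "\<lambda>j. {\<omega>\<in>space M. norm (\<xi> (\<kappa> j) \<omega>) > K n}"
      have \<Xi> [measurable]: "(\<lambda>\<omega> i. \<xi> i \<omega>) \<in> M \<rightarrow>\<^sub>M PiM UNIV (\<lambda>_. borel)"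
        by (rule measurable_PiM_single') auto
      note [measurable] = Rm F_measurable(2)[OF \<xi>m]
      \<comment> \<open>A small value means either a small sum with capped coefficients or a
        violated cap. The series is split only where it converges, which is almost
        everywhere.\<close>
      have "prob ?B \<le> prob (?G \<union> (\<Union>j\<in>{..<N}. ?T j))"
      proof (rule finite_measure_mono_AE)
        show "AE \<omega> in M. \<omega> \<in> ?B \<longrightarrow> \<omega> \<in> ?G \<union> (\<Union>j\<in>{..<N}. ?T j)"
          using conv[OF n]
        proof eventually_elim
          case (elim \<omega>)
          show ?case using split[OF elim] by (auto simp: not_le)
        qed
      qed measurable
      also have "\<dots> \<le> prob ?G + prob (\<Union>j\<in>{..<N}. ?T j)" by (rule measure_Un_le) measurable
      also have "\<dots> \<le> q ^ N + (\<Sum>j<N. prob (?T j))"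
      proof (rule add_mono)
        show "prob ?G \<le> q ^ N"
          by (rule dominated_sum_anticoncentration[OF ind Rm Rinv inj a0 dom q'])
        show "prob (\<Union>j\<in>{..<N}. ?T j) \<le> (\<Sum>j<N. prob (?T j))"
          by (rule finite_measure_subadditive_finite) auto
      qed
      also have "(\<Sum>j<N. prob (?T j)) = N * prob {\<omega>\<in>space M. norm (\<xi> 0 \<omega>) > K n}"
      proof -
        have "prob (?T j) = prob {\<omega>\<in>space M. norm (\<xi> 0 \<omega>) > K n}" for j
          by (rule idp) measurable
        then have "(\<Sum>j<N. prob (?T j)) = (\<Sum>j<N. prob {\<omega>\<in>space M. norm (\<xi> 0 \<omega>) > K n})" by (intro sum.cong refl)
        then show ?thesis by (simp only: sum_constant card_lessThan)
      qed
      also have "\<dots> \<le> (real N + 1) * prob {\<omega>\<in>space M. norm (\<xi> 0 \<omega>) > K n}" by (intro mult_right_mono) auto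
      also have "\<dots> \<le> (real N + 1) * (\<eta> / (2 * (real N + 1)))" using tail by (intro mult_left_mono) auto
      also have "\<dots> = \<eta> / 2" by (rule half)
      finally show ?case using N unfolding t_def by linarith
    qed
  qed
  then show ?thesis
    by (intro LIMSEQ_I) (fastforce simp: eventually_sequentially)
qed

end

section \<open>Zero measures and degenerate realisations\<close>

lemma zero_measure_locally_finite:
  assumes D: "open D" "connected D"
  shows "locally_finite_measure D (zero_measure D G)"
proof -
  have fin: "emeasure (zero_measure D G) K < \<infinity>" if K: "compact K" "K \<subseteq> D" for K
  proof (cases "G analytic_on D \<and> (\<exists>z\<in>D. G z \<noteq> 0)")
    case True
    let ?Z = "{z\<in>D. G z = 0}"
    let ?w = "\<lambda>z. of_nat (nat (zorder G z)) :: ennreal"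
    have fZ: "finite {z\<in>K. G z = 0}"
    proof (cases "G constant_on D")
      case c: True
      have "G z \<noteq> 0" if "z \<in> D" for z using c True that unfolding constant_on_def by metis
      then have "{z\<in>K. G z = 0} = {}" using K by auto
      then show ?thesis by (metis finite.emptyI)
    next
      case False
      then show ?thesis
        using True by (intro holomorphic_compact_finite_zeros[OF _ D K] analytic_imp_holomorphic) auto
    qed
    have Ks: "K \<in> sets (restrict_space borel D)"
      using K by (auto simp: sets_restrict_space borel_compact intro!: image_eqI[of _ _ K])
    have "emeasure (zero_measure D G) K = emeasure (point_measure ?Z ?w) ((\<lambda>z. z) -` K \<inter> space (point_measure ?Z ?w))"
      unfolding zero_measure_def using True Ks
      by (simp, subst emeasure_distr) (auto simp: measurable_point_measure_eq1 space_restrict_space)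
    also have "(\<lambda>z. z) -` K \<inter> space (point_measure ?Z ?w) = {z\<in>K. G z = 0}"
      using K by (auto simp: space_point_measure)
    also have "emeasure (point_measure ?Z ?w) \<dots> = (\<Sum>z\<in>{z\<in>K. G z = 0}. ?w z)"
      using K by (intro emeasure_point_measure_finite2 fZ) auto
    also have "\<dots> < \<infinity>" using fZ by (simp add: ennreal_of_nat_eq_real_of_nat)
    finally show ?thesis .
  qed (auto simp: zero_measure_def)
  then show ?thesis by (auto simp: locally_finite_measure_def zero_measure_def)
qed

lemma locally_finite_measure_scale:
  assumes "locally_finite_measure D \<mu>"
  shows "locally_finite_measure D (scale_measure (ennreal c) \<mu>)"
  using assms by (auto simp: locally_finite_measure_def ennreal_mult_less_top)

text \<open>Covers the degenerate realisations: identically zero functions, whose measure is 0 by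
  definition, and the constants left by a divergent series. \<open>f\<close> is arbitrary, since a
  non-measurable integrand has integral 0.\<close>

lemma integral_zero_measure_constant:
  fixes f :: "complex \<Rightarrow> real"
  assumes "\<And>z. z \<in> D \<Longrightarrow> G z = c"
  shows "integral\<^sup>L (zero_measure D G) f = 0"
proof (cases "c = 0 \<or> \<not> G analytic_on D")
  case True
  then have "zero_measure D G = null_measure (restrict_space borel D)" using assms by (auto simp: zero_measure_def)
  then show ?thesis by (simp add: integral_null_measure)
next
  case False
  show ?thesis
  proof (cases "D = {}")
    case True
    then show ?thesis by (simp add: zero_measure_def integral_null_measure)
  next
    case D: False
    have e: "{z\<in>D. G z = 0} = {}" using assms False by auto
    have "integral\<^sup>L (zero_measure D G) f = integral\<^sup>L (distr (point_measure {} (\<lambda>z. of_nat (nat (zorder G z)))) (restrict_space borel D) (\<lambda>z. z)) f"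
      unfolding zero_measure_def e using False D assms by auto
    also have "\<dots> = 0"
    proof (cases "f \<in> borel_measurable (restrict_space borel D)")
      case True
      have "(\<integral>z. f z \<partial>point_measure {} (\<lambda>z. of_nat (nat (zorder G z)))) = (\<integral>z. 0 \<partial>point_measure {} (\<lambda>z. of_nat (nat (zorder G z))))"
        by (intro Bochner_Integration.integral_cong refl) (simp add: space_point_measure)
      moreover have "(\<lambda>z. z) \<in> point_measure {} (\<lambda>z. of_nat (nat (zorder G z))) \<rightarrow>\<^sub>M restrict_space borel D"
        by (simp add: measurable_point_measure_eq1)
      ultimately show ?thesis using True by (simp add: integral_distr)
    next
      case False
      then show ?thesis by (intro not_integrable_integral_eq) (auto simp: integrable_iff_bounded)
    qed
    finally show ?thesis .
  qed
qed

text \<open>With radii tending to 0, sums over zeros become limits of integrals of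
  \<open>ln (norm (G z))\<close>; this is how they are seen to be measurable.\<close>

lemma regularization_tendsto:
  assumes \<phi>: "supported_in r \<phi>" and s: "\<And>i. s i > 0" "s \<longlonglongrightarrow> 0"
  shows "(\<lambda>i. regularization (s i) \<phi> a / annular_mass (s i)) \<longlonglongrightarrow> \<phi> a"
proof (rule LIMSEQ_I)
  fix e :: real assume e: "e > 0"
  have "isCont \<phi> a" using \<phi> by (simp add: supported_in_def continuous_on_eq_continuous_at)
  then obtain d where d: "d > 0" "\<And>w. dist w a < d \<Longrightarrow> dist (\<phi> w) (\<phi> a) < e / 2"
    using e unfolding continuous_at_eps_delta by (meson half_gt_zero)
  obtain n0 where n0: "\<And>i. i \<ge> n0 \<Longrightarrow> s i < d"
    using order_tendstoD(2)[OF s(2) d(1)] by (auto simp: eventually_sequentially)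
  show "\<exists>no. \<forall>n\<ge>no. norm (regularization (s n) \<phi> a / annular_mass (s n) - \<phi> a) < e"
  proof (intro exI[of _ n0] allI impI)
    fix i assume i: "i \<ge> n0"
    have m: "annular_mass (s i) > 0" by (rule annular_mass_pos[OF s(1)])
    have "\<bar>regularization (s i) \<phi> a - annular_mass (s i) * \<phi> a\<bar> \<le> annular_mass (s i) * (e / 2)"
    proof (rule regularization_approx[OF \<phi> s(1)])
      fix w assume "norm (w - a) \<le> s i"
      then have "dist w a < d" using n0[OF i] by (simp add: dist_norm)
      from d(2)[OF this] show "\<bar>\<phi> w - \<phi> a\<bar> \<le> e / 2" by (simp add: dist_real_def)
    qed
    also have "\<dots> < annular_mass (s i) * e" using m e by simp
    finally have "\<bar>regularization (s i) \<phi> a - annular_mass (s i) * \<phi> a\<bar> / annular_mass (s i) < e"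
      using m by (simp add: pos_divide_less_eq mult.commute)
    also have "\<bar>regularization (s i) \<phi> a - annular_mass (s i) * \<phi> a\<bar> / annular_mass (s i) = \<bar>regularization (s i) \<phi> a / annular_mass (s i) - \<phi> a\<bar>"
      using m by (simp add: diff_divide_distrib[symmetric] abs_divide field_simps)
    finally show "norm (regularization (s i) \<phi> a / annular_mass (s i) - \<phi> a) < e" by simp
  qed
qed

section \<open>Convergence of the zeros\<close>

locale random_zeros = coefficient_family D b L \<alpha> + limit_potential D P \<rho> + prob_space M
  for D b L \<alpha> \<rho> and M :: "'a measure" +
  fixes \<xi> :: "nat \<Rightarrow> 'a \<Rightarrow> complex"
  assumes indep: "indep_vars (\<lambda>_. borel) \<xi> UNIV"
    and ident: "\<And>k. distr M borel (\<xi> k) = distr M borel (\<xi> 0)"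
    and nondeg: "\<not> (\<exists>c. AE \<omega> in M. \<xi> 0 \<omega> = c)"
    and moment: "integrable M (\<lambda>\<omega>. ln (1 + norm (\<xi> 0 \<omega>)))"
begin

lemma \<xi>_measurable [measurable]: "\<xi> k \<in> borel_measurable M"
  using indep by (simp add: indep_vars_def)

abbreviation G :: "nat \<Rightarrow> 'a \<Rightarrow> complex \<Rightarrow> complex" where "G n \<omega> \<equiv> F n (\<lambda>k. \<xi> k \<omega>)"

text \<open>For \<open>n = 0\<close> the factor is \<open>1 / 0 = 0\<close>, so the measure is
  0.\<close>

abbreviation \<nu> :: "nat \<Rightarrow> 'a \<Rightarrow> complex measure" where
  "\<nu> n \<omega> \<equiv> scale_measure (ennreal (1 / real n)) (zero_measure D (G n \<omega>))"

text \<open>The margin \<open>5 * e\<close> is what \<open>zeros_close_to_density\<close> needs for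
  its cut-off and radii. In the unit disc it exists because the norm attains a maximum below 1 on a
  nonempty \<open>K\<close>.\<close>

lemma compact_in_D:
  assumes K: "compact K" "K \<subseteq> D"
  obtains r e where "r > 0" "e > 0" "K \<subseteq> cball 0 r" "cball 0 (r + 5 * e) \<subseteq> D"
proof (cases "D = UNIV")
  case True
  obtain B where "B > 0" "\<And>z. z \<in> K \<Longrightarrow> norm z \<le> B" using compact_imp_bounded[OF K(1)] unfolding bounded_pos by blast
  then show ?thesis using True by (intro that[of B 1]) auto
next
  case False
  then have D1: "D = ball 0 1" using D by blast
  obtain r where r: "0 < r" "r < 1" "K \<subseteq> cball 0 r"
  proof (cases "K = {}")
    case True then show ?thesis using that[of "1/2"] by simp
  next
    case False
    obtain z where z: "z \<in> K" "\<And>w. w \<in> K \<Longrightarrow> norm w \<le> norm z"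
      using continuous_attains_sup[OF K(1) False, of norm] continuous_on_norm_id by blast
    have "norm z < 1" using z(1) K(2) D1 by auto
    then show ?thesis
      by (intro that[of "max (norm z) (1/2)"]) (use z(2) in \<open>auto simp: le_max_iff_disj\<close>)
  qed
  have "r + 5 * ((1 - r) / 10) < 1" using r by (simp add: field_simps)
  then have "cball 0 (r + 5 * ((1 - r) / 10)) \<subseteq> D" 
    unfolding D1 by (intro subsetI) (metis le_less_trans mem_ball mem_cball)
  then show ?thesis using r by (intro that[of r "(1 - r) / 10"]) simp_all
qed

lemma test_function_extend:
  assumes "test_function D \<phi>"
  obtains \<phi>' r e where "supported_in r \<phi>'" "r > 0" "e > 0" "cball 0 (r + 5 * e) \<subseteq> D" "\<And>z. z \<in> D \<Longrightarrow> \<phi>' z = \<phi> z"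
proof -
  obtain K where K: "compact K" "K \<subseteq> D" "\<And>z. z \<in> D - K \<Longrightarrow> \<phi> z = 0" and \<phi>: "continuous_on D \<phi>"
    using assms by (auto simp: test_function_def)
  obtain r e where re: "r > 0" "e > 0" "K \<subseteq> cball 0 r" "cball 0 (r + 5 * e) \<subseteq> D"
    using compact_in_D[OF K(1,2)] by metis
  define \<phi>' where "\<phi>' = (\<lambda>z. if z \<in> D then \<phi> z else 0)"
  have 0: "\<phi>' z = 0" if "z \<notin> K" for z using that K(3) by (auto simp: \<phi>'_def)
  \<comment> \<open>\<open>D\<close> and \<open>- K\<close> are open and cover the plane, and the
    extension by 0 is continuous on each. Values of \<open>\<phi>\<close> outside \<open>D\<close>
    are thereby discarded.\<close>
  have "continuous_on (D \<union> - K) \<phi>'"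
  proof (rule continuous_on_open_Un)
    show "open D" using D by auto
    show "open (- K)" using compact_imp_closed[OF K(1)] by (rule open_Compl)
    show "continuous_on D \<phi>'" using \<phi> by (rule continuous_on_eq) (simp add: \<phi>'_def)
    show "continuous_on (- K) \<phi>'" by (rule continuous_on_eq[OF continuous_on_const[of _ 0]]) (simp add: 0)
  qed
  moreover have "D \<union> - K = UNIV" using K(2) by auto
  ultimately have "continuous_on UNIV \<phi>'" by simp
  moreover have "\<phi>' z = 0" if "norm z > r" for z using that re(3) by (intro 0) auto
  ultimately have "supported_in r \<phi>'" by (simp add: supported_in_def)
  then show thesis using that[of r \<phi>' e] re by (simp add: \<phi>'_def)
qed

lemma integral_zeros:
  fixes \<phi> \<phi>' :: "complex \<Rightarrow> real"
  assumes \<phi>: "test_function D \<phi>" and \<phi>': "supported_in r \<phi>'" "\<And>z. z \<in> D \<Longrightarrow> \<phi>' z = \<phi> z"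
    and R: "r \<le> R" "0 \<le> R" "R < R'" "cball 0 R' \<subseteq> D" and H: "H holomorphic_on D" "\<exists>z\<in>D. H z \<noteq> 0"
  shows "integral\<^sup>L (zero_measure D H) \<phi> = (\<Sum>a\<in>{z\<in>cball 0 R. H z = 0}. nat (zorder H a) * \<phi>' a)"
    "finite {z\<in>cball 0 R. H z = 0}" "\<exists>z\<in>ball 0 R'. H z \<noteq> 0" "H holomorphic_on ball 0 R'"
proof -
  have Hb: "H holomorphic_on ball 0 R'" by (rule holomorphic_on_subset[OF H(1)]) (use R(4) ball_subset_cball in blast)
  then show "H holomorphic_on ball 0 R'" .
  have sub: "cball 0 R \<subseteq> D" using R by auto
  show nz: "\<exists>z\<in>ball 0 R'. H z \<noteq> 0"
    by (rule nonzero_on_ball[OF H R(4)]) (use R in simp)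
  show fin: "finite {z\<in>cball 0 R. H z = 0}" by (rule holomorphic_finite_zeros_ball[OF Hb nz R(3)])
  show "integral\<^sup>L (zero_measure D H) \<phi> = (\<Sum>a\<in>{z\<in>cball 0 R. H z = 0}. nat (zorder H a) * \<phi>' a)"
  proof -
    have "integral\<^sup>L (zero_measure D H) \<phi> = (\<Sum>a\<in>{z\<in>cball 0 R. H z = 0}. nat (zorder H a) * \<phi> a)"
    proof (rule integral_zero_measure[OF _ H(2) _ _ sub fin])
      show "H analytic_on D" using H(1) open_D by (simp add: analytic_on_open)
      show "\<phi> \<in> borel_measurable (restrict_space borel D)"
        using \<phi> by (auto simp: test_function_def intro: borel_measurable_continuous_on_restrict)
      show "\<phi> z = 0" if "z \<in> D - cball 0 R" for z
        using that R(1) \<phi>'(1) \<phi>'(2)[of z] by (simp add: supported_in_def)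
    qed
    also have "\<dots> = (\<Sum>a\<in>{z\<in>cball 0 R. H z = 0}. nat (zorder H a) * \<phi>' a)"
      using \<phi>'(2) sub by (intro sum.cong) auto
    finally show ?thesis .
  qed
qed

text \<open>The zeros themselves are never parametrised. By the weak Jensen formula a regularized
  zero sum is an integral of \<open>ln (norm (G n \<omega> z))\<close>, measurable in
  \<open>\<omega>\<close> as a parameter integral, and the regularizations converge as
  \<open>s i\<close> tends to 0.\<close>

lemma integral_zero_measure_measurable:
  fixes \<phi> :: "complex \<Rightarrow> real"
  assumes \<phi>: "test_function D \<phi>"
  shows "(\<lambda>\<omega>. integral\<^sup>L (zero_measure D (G n \<omega>)) \<phi>) \<in> borel_measurable M"
proof -
  obtain \<phi>' r e where \<phi>': "supported_in r \<phi>'" "\<And>z. z \<in> D \<Longrightarrow> \<phi>' z = \<phi> z" and re: "r > 0" "e > 0" "cball 0 (r + 5 * e) \<subseteq> D"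
    using test_function_extend[OF \<phi>] by metis
  define s where "s = (\<lambda>i. e / (real i + 1))"
  have s: "s i > 0" "s i \<le> e" for i using re by (auto simp: s_def divide_le_eq add_nonneg_pos mult_le_cancel_left1)
  have s0: "s \<longlonglongrightarrow> 0" unfolding s_def by real_asymp
  define f where "f = (\<lambda>i \<omega>. if converges n (\<lambda>k. \<xi> k \<omega>) then (\<integral>z. ln (norm (G n \<omega> z)) * circle_difference (s i) \<phi>' z \<partial>lborel) / annular_mass (s i) else 0)"
  note [measurable] = converges_measurable[OF \<xi>_measurable] circle_difference_measurable[OF \<phi>'(1)] F_measurable(1)[OF \<xi>_measurable]
  have "f i \<in> borel_measurable M" for i unfolding f_def by measurable
  moreover have "(\<lambda>i. f i \<omega>) \<longlonglongrightarrow> integral\<^sup>L (zero_measure D (G n \<omega>)) \<phi>" for \<omega>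
  proof (cases "converges n (\<lambda>k. \<xi> k \<omega>)")
    case conv: True
    note H = converges_holomorphic[OF conv]
    show ?thesis
    proof (cases "\<exists>z\<in>D. G n \<omega> z \<noteq> 0")
      case True
      note Z = integral_zeros[where R = "r + 4 * e" and R' = "r + 5 * e", OF \<phi> \<phi>' _ _ _ re(3) H True]
      let ?Z = "{z\<in>cball 0 (r + 4 * e). G n \<omega> z = 0}"
      have "f i \<omega> = (\<Sum>a\<in>?Z. nat (zorder (G n \<omega>) a) * (regularization (s i) \<phi>' a / annular_mass (s i)))" for i
      proof -
        have "(\<integral>z. ln (norm (G n \<omega> z)) * circle_difference (s i) \<phi>' z \<partial>lborel) = (\<Sum>a\<in>?Z. nat (zorder (G n \<omega>) a) * regularization (s i) \<phi>' a)"
          by (rule integral_ln_circle_difference[OF Z(4,3) \<phi>'(1) s(1)]) (use re s(2)[of i] in auto)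
        then show ?thesis using conv by (simp add: f_def sum_divide_distrib)
      qed
      moreover have "(\<lambda>i. \<Sum>a\<in>?Z. nat (zorder (G n \<omega>) a) * (regularization (s i) \<phi>' a / annular_mass (s i))) \<longlonglongrightarrow> (\<Sum>a\<in>?Z. nat (zorder (G n \<omega>) a) * \<phi>' a)"
        by (intro tendsto_sum tendsto_mult tendsto_const regularization_tendsto[OF \<phi>'(1) s(1) s0])
      ultimately show ?thesis using Z(1) re by simp
    next
      case False
      then have z: "\<And>z. z \<in> D \<Longrightarrow> G n \<omega> z = 0" by blast
      \<comment> \<open>On \<open>D\<close> the value \<open>ln 0 = 0\<close> applies, outside it
        the weight vanishes; so the approximants agree with the measure 0 assigned to the zero
        function.\<close>
      have z0: "ln (norm (G n \<omega> z)) * circle_difference (s i) \<phi>' z = 0" for z i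
      proof (cases "z \<in> D")
        case False
        then have "z \<notin> cball 0 (r + 5 * e)" using re(3) by blast
        then have "norm z > r + 5 * e" by simp
        then have "norm z > r + s i" using s(2)[of i] re(2) by linarith
        then show ?thesis using circle_difference_eq_0[OF \<phi>'(1) s(1)] by simp
      qed (simp add: z)
      have "f i \<omega> = 0" for i unfolding f_def z0 by simp
      then show ?thesis using integral_zero_measure_constant[OF z] by simp
    qed
  next
    \<comment> \<open>A function from a divergent series is constant or not analytic on
      \<open>D\<close>; in both cases the integral is 0, as is \<open>f i \<omega>\<close>.\<close>
    case False
    have "integral\<^sup>L (zero_measure D (G n \<omega>)) \<phi> = 0"
    proof (cases "G n \<omega> analytic_on D")
      case True
      then obtain c where "\<And>z. z \<in> D \<Longrightarrow> G n \<omega> z = c" using not_converges_constant[OF False] by blast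
      then show ?thesis by (rule integral_zero_measure_constant)
    next
      case False
      then show ?thesis by (simp add: zero_measure_def integral_null_measure)
    qed
    then show ?thesis using False by (simp add: f_def)
  qed
  ultimately show ?thesis by (rule borel_measurable_LIMSEQ_real[rotated])
qed

lemma integral_lebesgue_density_measure:
  fixes \<phi> \<phi>' :: "complex \<Rightarrow> real"
  assumes \<phi>: "test_function D \<phi>" and \<phi>': "supported_in r \<phi>'" "\<And>z. z \<in> D \<Longrightarrow> \<phi>' z = \<phi> z" and r: "cball 0 r \<subseteq> D"
  shows "integral\<^sup>L (lebesgue_density_measure D \<rho>) \<phi> = (\<integral>z. \<phi>' z * \<rho> z \<partial>lborel)"
proof -
  have Ds [measurable]: "D \<in> sets borel" using open_D by simp
  have \<phi>m: "\<phi> \<in> borel_measurable (restrict_space lborel D)"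
    using \<phi> borel_measurable_continuous_on_restrict[of D \<phi>]
    by (subst measurable_cong_sets[OF sets_restrict_space_cong[OF sets_lborel] refl]) (auto simp: test_function_def)
  have \<rho>m: "\<rho> \<in> borel_measurable (restrict_space lborel D)" by (intro measurable_restrict_space1) simp
  have "integral\<^sup>L (lebesgue_density_measure D \<rho>) \<phi> = (\<integral>z. \<rho> z * \<phi> z \<partial>restrict_space lborel D)"
    unfolding lebesgue_density_measure_def
    using integral_density[OF \<phi>m \<rho>m] \<rho>_nonneg by simp
  also have "\<dots> = (\<integral>z. indicator D z * (\<rho> z * \<phi> z) \<partial>lborel)"
    by (subst integral_restrict_space) auto
  also have "\<dots> = (\<integral>z. \<phi>' z * \<rho> z \<partial>lborel)"
  proof (intro Bochner_Integration.integral_cong refl)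
    fix z
    show "indicator D z * (\<rho> z * \<phi> z) = \<phi>' z * \<rho> z"
    proof (cases "z \<in> D")
      case False
      then have "z \<notin> cball 0 r" using r by blast
      then show ?thesis using \<phi>'(1) False by (simp add: supported_in_def)
    qed (simp add: \<phi>'(2))
  qed
  finally show ?thesis .
qed

lemma density_measure_locally_finite: "locally_finite_measure D (lebesgue_density_measure D \<rho>)"
proof -
  have Ds [measurable]: "D \<in> sets borel" using open_D by simp
  have \<rho>m: "\<rho> \<in> borel_measurable (restrict_space lborel D)" by (intro measurable_restrict_space1) simp
  have "emeasure (lebesgue_density_measure D \<rho>) K < \<infinity>" if K: "compact K" "K \<subseteq> D" for K
  proof -
    obtain r e where "r > 0" "e > 0" "K \<subseteq> cball 0 r" "cball 0 (r + 5 * e) \<subseteq> D"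
      using compact_in_D[OF K] by metis
    then have r: "K \<subseteq> cball 0 r" "cball 0 r \<subseteq> D" by auto
    have Kb [measurable]: "K \<in> sets borel" using K(1) by (rule borel_compact)
    have Ks: "K \<in> sets (restrict_space lborel D)"
      using K Kb by (auto simp: sets_restrict_space intro!: image_eqI[of _ _ K])
    have "emeasure (lebesgue_density_measure D \<rho>) K = (\<integral>\<^sup>+z. ennreal (\<rho> z) * indicator K z \<partial>restrict_space lborel D)"
      unfolding lebesgue_density_measure_def using \<rho>m Ks by (subst emeasure_density) auto
    also have "\<dots> = (\<integral>\<^sup>+z. ennreal (\<rho> z) * indicator K z * indicator D z \<partial>lborel)"
      by (subst nn_integral_restrict_space) auto
    also have "\<dots> \<le> (\<integral>\<^sup>+z. ennreal (norm (indicator (cball 0 r) z *\<^sub>R \<rho> z)) \<partial>lborel)"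
      using r \<rho>_nonneg by (intro nn_integral_mono) (auto simp: indicator_def)
    also have "\<dots> < \<infinity>"
      using density_integrable[OF r(2)] unfolding set_integrable_def integrable_iff_bounded by blast
    finally show ?thesis .
  qed
  moreover have "sets (lebesgue_density_measure D \<rho>) = sets (restrict_space borel D)"
    unfolding lebesgue_density_measure_def sets_density by (rule sets_restrict_space_cong) simp
  ultimately show ?thesis by (auto simp: locally_finite_measure_def)
qed

text \<open>Needed at zeros of \<open>F n\<close>, where \<open>ln 0 = 0\<close> has to respect the
  upper bound. The value \<open>L 0 = 0\<close> is read off the constant term.\<close>

lemma P_nonneg: "z \<in> D \<Longrightarrow> P z \<ge> 0"
proof -
  assume z: "z \<in> D"
  have L0: "L 0 = 0"
  proof -
    have "(\<lambda>k. b 1 k * 0 ^ k) sums exp (real 1 * L 0)" using zero_in_D by (intro b_sums) auto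
    moreover have "(\<lambda>k. b 1 k * 0 ^ k) sums b 1 0" by (rule powser_sums_zero)
    ultimately have "exp (L 0) = 1" using sums_unique2 b_0[of 1] by force
    then show ?thesis by simp
  qed
  show "P z \<ge> 0"
  proof (cases "z = 0")
    case False
    then have "L (norm z powr (1 / \<alpha>)) > 0" using powr_root_in_D[OF z] by (intro L_pos) auto
    then show ?thesis using \<alpha> by (simp add: P_def)
  qed (simp add: P_def L0)
qed

text \<open>Uniform continuity of \<open>L\<close> turns the enlarged radius in
  \<open>growth_bound\<close> into an additive error \<open>\<kappa>\<close>, uniformly on the
  disc.\<close>

lemma growth_exponent:
  assumes R: "cball 0 R \<subseteq> D" "R > 0" and \<kappa>: "\<kappa> > 0"
  obtains \<epsilon> where "\<epsilon> > 0"
    "\<And>z. norm z \<le> R \<Longrightarrow> complex_of_real (norm z powr (1 / \<alpha>) * exp (2 * \<epsilon> / \<alpha>)) \<in> D \<and>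
      \<alpha> * L (norm z powr (1 / \<alpha>) * exp (2 * \<epsilon> / \<alpha>)) \<le> P z + \<kappa>"
proof -
  define s1 where "s1 = R powr (1 / \<alpha>)"
  have s1: "s1 > 0" using R by (simp add: s1_def)
  have "complex_of_real R \<in> D" using R by (intro subsetD[OF R(1)]) simp
  from powr_root_in_D[OF this] have "complex_of_real s1 \<in> D" using R by (simp add: s1_def)
  then obtain s2 where s2: "s2 > s1" "complex_of_real s2 \<in> D" using larger_in_D s1 by (metis less_imp_le)
  have inD: "complex_of_real s \<in> D" if "0 \<le> s" "s \<le> s2" for s
    using that s2 s1 of_real_in_D_iff[of s] of_real_in_D_iff[of s2] by auto
  have "continuous_on {0..s2} L" by (rule continuous_on_subset[OF L_continuous]) (use inD in auto)
  then have "uniformly_continuous_on {0..s2} L" by (rule compact_uniformly_continuous) simp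
  moreover have k: "\<kappa> / \<alpha> > 0" using \<kappa> \<alpha> by simp
  ultimately obtain d where d: "d > 0" "\<And>x y. x \<in> {0..s2} \<Longrightarrow> y \<in> {0..s2} \<Longrightarrow> dist y x < d \<Longrightarrow> dist (L y) (L x) < \<kappa> / \<alpha>"
    unfolding uniformly_continuous_on_def by metis
  \<comment> \<open>The first bound keeps the enlarged radius at most \<open>s2\<close>, hence in
    \<open>D\<close>; the second keeps the shift at most \<open>d / 2\<close>.\<close>
  define h where "h = ln (min (s2 / s1) (1 + d / (2 * s1)))"
  have m1: "min (s2 / s1) (1 + d / (2 * s1)) > 1" using s1 s2 d by simp
  then have h: "h > 0" unfolding h_def by simp
  have eh: "exp h = min (s2 / s1) (1 + d / (2 * s1))" unfolding h_def using m1 by simp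
  then have eh1: "exp h \<le> s2 / s1" "exp h \<le> 1 + d / (2 * s1)" "exp h \<ge> 1"
  proof -
    show "exp h \<le> s2 / s1" unfolding eh by (rule min.cobounded1)
    show "exp h \<le> 1 + d / (2 * s1)" unfolding eh by (rule min.cobounded2)
    show "exp h \<ge> 1" using h by simp
  qed
  have 1: "s1 * exp h \<le> s2" using eh1(1) s1 by (simp add: pos_le_divide_eq mult.commute)
  have 2: "s1 * (exp h - 1) < d"
  proof -
    have "s1 * (exp h - 1) \<le> s1 * (d / (2 * s1))" using eh1(2) s1 by (intro mult_left_mono) auto
    also have "\<dots> = d / 2" using s1 by simp
    finally show ?thesis using d by simp
  qed
  show thesis
  proof (rule that[of "\<alpha> * h / 2"])
    show "\<alpha> * h / 2 > 0" using \<alpha> h by simp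
    fix z :: complex assume z: "norm z \<le> R"
    define s where "s = norm z powr (1 / \<alpha>)"
    have s: "0 \<le> s" "s \<le> s1" unfolding s_def s1_def using z \<alpha> by (auto intro: powr_mono2)
    have e: "exp (2 * (\<alpha> * h / 2) / \<alpha>) = exp h" using \<alpha> by simp
    have a: "s * exp h \<le> s2" by (rule order_trans[OF mult_right_mono[OF s(2)] 1]) simp
    have b: "s * (exp h - 1) < d" by (rule le_less_trans[OF mult_right_mono[OF s(2)] 2]) (use eh1(3) in simp)
    have c: "s * exp h \<ge> 0" "s \<le> s2" using s s2 by auto
    have "dist (s * exp h) s < d" using b s eh1(3) by (simp add: dist_real_def right_diff_distrib abs_of_nonneg mult_le_cancel_left1)
    then have "dist (L (s * exp h)) (L s) < \<kappa> / \<alpha>" using a c s by (intro d(2)) auto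
    then have "L (s * exp h) \<le> L s + \<kappa> / \<alpha>" by (simp add: dist_real_def)
    then have "\<alpha> * L (s * exp h) \<le> \<alpha> * (L s + \<kappa> / \<alpha>)" using \<alpha> by (intro mult_left_mono) auto
    also have "\<dots> = P z + \<kappa>" using \<alpha> by (simp add: P_def s_def distrib_left)
    finally show "complex_of_real (norm z powr (1 / \<alpha>) * exp (2 * (\<alpha> * h / 2) / \<alpha>)) \<in> D \<and>
      \<alpha> * L (norm z powr (1 / \<alpha>) * exp (2 * (\<alpha> * h / 2) / \<alpha>)) \<le> P z + \<kappa>"
      unfolding e s_def[symmetric] using inD[OF c(1) a] by blast
  qed
qed

text \<open>Replaces the random constant of the growth estimate by a fixed one off an event of small
  probability; the exceptional events decrease in \<open>C\<close> to a null set.\<close>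

lemma coefficient_growth_prob:
  assumes "\<epsilon> > 0" "\<eta> > 0"
  obtains C :: nat where "C > 0" "prob {\<omega>\<in>space M. \<not> (\<forall>k. norm (\<xi> k \<omega>) \<le> C * exp (\<epsilon> * k))} < \<eta>"
proof -
  let ?A = "\<lambda>C::nat. {\<omega>\<in>space M. \<not> (\<forall>k. norm (\<xi> k \<omega>) \<le> C * exp (\<epsilon> * k))}"
  have "(\<lambda>C. prob (?A C)) \<longlonglongrightarrow> prob (\<Inter>C. ?A C)"
  proof (rule finite_Lim_measure_decseq)
    have "?A C' \<subseteq> ?A C" if "C \<le> C'" for C C'
    proof
      fix \<omega> assume w: "\<omega> \<in> ?A C'"
      have "\<not> (\<forall>k. norm (\<xi> k \<omega>) \<le> C * exp (\<epsilon> * k))"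
      proof
        assume all: "\<forall>k. norm (\<xi> k \<omega>) \<le> C * exp (\<epsilon> * k)"
        have "norm (\<xi> k \<omega>) \<le> C' * exp (\<epsilon> * k)" for k
        proof (rule order_trans[OF spec[OF all]])
          show "C * exp (\<epsilon> * k) \<le> C' * exp (\<epsilon> * k)" using that by (intro mult_right_mono) auto
        qed
        with w show False by simp
      qed
      with w show "\<omega> \<in> ?A C" by simp
    qed
    then show "decseq ?A" unfolding decseq_def by simp
    show "range ?A \<subseteq> events" by auto
  qed
  moreover have "prob (\<Inter>C. ?A C) = 0"
  proof -
    have "AE \<omega> in M. \<exists>C::nat. \<forall>k. norm (\<xi> k \<omega>) \<le> C * exp (\<epsilon> * k)"
      by (rule log_moment_growth[where \<xi>=\<xi>, OF \<xi>_measurable ident moment assms(1)])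
    then have ae: "AE \<omega> in M. \<omega> \<notin> (\<Inter>C. ?A C)" by (rule AE_mp) (rule AE_I2, blast)
    have "(\<Inter>C. ?A C) = {\<omega>\<in>space M. \<forall>C::nat. \<not> (\<forall>k. norm (\<xi> k \<omega>) \<le> C * exp (\<epsilon> * k))}" by blast
    also have "\<dots> \<in> events" by measurable
    finally have "(\<Inter>C. ?A C) \<in> events" .
    from AE_iff_null_sets[OF this] ae have "(\<Inter>C. ?A C) \<in> null_sets M" by blast
    then show ?thesis by (rule measure_eq_0_null_sets)
  qed
  ultimately have "(\<lambda>C. prob (?A C)) \<longlonglongrightarrow> 0" by simp
  then have "eventually (\<lambda>C. prob (?A C) < \<eta>) sequentially" using assms(2) by (rule order_tendstoD)
  then have "eventually (\<lambda>C. prob (?A C) < \<eta> \<and> C > 0) sequentially" using eventually_gt_at_top[of 0] by (rule eventually_conj)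
  then obtain C where "prob (?A C) < \<eta> \<and> C > 0" using eventually_happens'[OF sequentially_bot] by blast
  then show thesis by (intro that[of C]) simp_all
qed

text \<open>Order of choices: \<open>\<kappa>\<close> from the test function, \<open>\<mu>\<close>
  from \<open>\<kappa>\<close>, then the discs and the growth rate \<open>\<epsilon>'\<close>, all
  before the probability tolerance \<open>\<eta>\<close>, on which the growth constant
  \<open>A\<close> depends. Off finitely many unlikely events and a null set the argument is
  deterministic.\<close>

lemma zeros_tendsto_in_prob:
  fixes \<phi> :: "complex \<Rightarrow> real"
  assumes \<phi>: "test_function D \<phi>" and \<epsilon>: "\<epsilon> > 0"
  shows "(\<lambda>n. prob {\<omega>\<in>space M. \<bar>integral\<^sup>L (\<nu> n \<omega>) \<phi>
      - integral\<^sup>L (lebesgue_density_measure D \<rho>) \<phi>\<bar> > \<epsilon>}) \<longlonglongrightarrow> 0"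
proof -
  obtain \<phi>' r e where \<phi>': "supported_in r \<phi>'" "\<And>z. z \<in> D \<Longrightarrow> \<phi>' z = \<phi> z" and re: "r > 0" "e > 0" "cball 0 (r + 5 * e) \<subseteq> D"
    using test_function_extend[OF \<phi>] by metis
  define R where "R = r + 4 * e"
  define R' where "R' = R + e / 2"
  have R: "R > 0" "R < R'" "R' > 0" "R' < r + 5 * e" using re by (simp_all add: R_def R'_def)
  have RD: "cball 0 R' \<subseteq> D" "ball 0 (r + 5 * e) \<subseteq> D" using re(3) R by auto
  let ?I = "integral\<^sup>L (lebesgue_density_measure D \<rho>) \<phi>"
  have "cball 0 r \<subseteq> D" using re by auto
  from integral_lebesgue_density_measure[OF \<phi> \<phi>' this] have I: "?I = (\<integral>z. \<phi>' z * \<rho> z \<partial>lborel)" .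
  obtain \<kappa> where \<kappa>: "\<kappa> > 0"
    "\<And>H n. \<lbrakk>H holomorphic_on D; \<exists>z\<in>D. H z \<noteq> 0; n > (0::real);
      (LINT z:cball 0 (r + 4 * e)|lborel. \<bar>ln (norm (H z)) / n - P z\<bar>) \<le> \<kappa>\<rbrakk> \<Longrightarrow>
      \<bar>(\<Sum>a\<in>{z\<in>cball 0 (r + 4 * e). H z = 0}. nat (zorder H a) * \<phi>' a) / n - (\<integral>z. \<phi>' z * \<rho> z \<partial>lborel)\<bar> \<le> \<epsilon>"
    by (rule zeros_close_to_density[OF \<phi>'(1) re \<epsilon>]) blast
  \<comment> \<open>The constant of \<open>L1_bound_from_centres\<close> with
    \<open>K = 36 * R\<^sup>2\<close> from the disc cover.\<close>
  define Kc where "Kc = 3 * pi * (36 * R\<^sup>2) + pi * R\<^sup>2"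
  have Kc: "Kc > 0" using R by (simp add: Kc_def add_pos_pos)
  define \<mu> where "\<mu> = \<kappa> / Kc"
  have \<mu>: "\<mu> > 0" "Kc * \<mu> = \<kappa>" using \<kappa>(1) Kc by (simp_all add: \<mu>_def)
  have Pc: "continuous_on (cball 0 R') P" by (rule continuous_on_subset[OF p_continuous RD(1)])
  then have uc: "uniformly_continuous_on (cball 0 R') P" by (rule compact_uniformly_continuous) simp
  obtain d0 where d0: "d0 > 0" "\<And>x y. x \<in> cball 0 R' \<Longrightarrow> y \<in> cball 0 R' \<Longrightarrow> dist y x < d0 \<Longrightarrow> dist (P y) (P x) < \<mu>"
    using uc[unfolded uniformly_continuous_on_def, rule_format, OF \<mu>(1)] by blast
  \<comment> \<open>Below \<open>d0\<close> the potential varies by less than \<open>\<mu>\<close>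
    from the centre of a disc; below \<open>e / 4\<close> all discs stay in
    \<open>ball 0 R'\<close>, since their centres lie within \<open>R + d\<close>.\<close>
  have mn: "min d0 (e / 4) > 0" using d0 re by simp
  obtain C :: "complex set" and d :: real where
    C: "finite C" "0 < d" "d < min d0 (e / 4)" "card C * d\<^sup>2 \<le> 36 * R\<^sup>2" "0 \<notin> C" "C \<subseteq> ball 0 (R + d)" "cball 0 R \<subseteq> (\<Union>c\<in>C. ball c d)"
    by (rule finite_disc_cover[OF R(1) mn]) (rule that)
  have d: "d < d0" "2 * d < e / 2" using C(3) by auto
  have Csub: "ball c d \<subseteq> ball 0 R'" if "c \<in> C" for c
  proof
    fix z assume "z \<in> ball c d"
    then have "norm z < norm c + d" using norm_triangle_ineq2[of z c] by (simp add: dist_norm norm_minus_commute)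
    moreover have "norm c < R + d" using C(6) that by auto
    ultimately show "z \<in> ball 0 R'" using d by (simp add: R'_def)
  qed
  have CR: "c \<in> ball 0 R'" if "c \<in> C" for c using subsetD[OF Csub[OF that], of c] C(2) by simp
  have CD: "c \<in> D" if "c \<in> C" for c using CR[OF that] RD(1) ball_subset_cball by blast
  \<comment> \<open>Half of \<open>\<mu>\<close> is for the enlarged radius, half for the constant
    factor \<open>B\<close>, which contributes \<open>ln B / n\<close>.\<close>
  have \<mu>2: "\<mu> / 2 > 0" using \<mu> by simp
  obtain \<epsilon>' where \<epsilon>': "\<epsilon>' > 0"
    "\<And>z. norm z \<le> R' \<Longrightarrow> complex_of_real (norm z powr (1 / \<alpha>) * exp (2 * \<epsilon>' / \<alpha>)) \<in> D \<and>
      \<alpha> * L (norm z powr (1 / \<alpha>) * exp (2 * \<epsilon>' / \<alpha>)) \<le> P z + \<mu> / 2"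
    by (rule growth_exponent[OF RD(1) R(3) \<mu>2]) blast
  note [measurable] = F_measurable(2)[OF \<xi>_measurable]
  have "eventually (\<lambda>n. prob {\<omega>\<in>space M. \<bar>integral\<^sup>L (\<nu> n \<omega>) \<phi> - ?I\<bar> > \<epsilon>} < \<eta>) sequentially"
    if \<eta>: "\<eta> > 0" for \<eta>
  proof -
    have \<eta>2: "\<eta> / 2 > 0" using \<eta> by simp
    obtain A :: nat where A: "A > 0" "prob {\<omega>\<in>space M. \<not> (\<forall>k. norm (\<xi> k \<omega>) \<le> A * exp (\<epsilon>' * k))} < \<eta> / 2"
      by (rule coefficient_growth_prob[OF \<epsilon>'(1) \<eta>2]) (rule that)
    define B where "B = A / (1 - exp (-\<epsilon>'))"
    have B: "B > 0" using A(1) \<epsilon>'(1) by (simp add: B_def)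
    let ?L = "\<lambda>n c. {\<omega>\<in>space M. norm (G n \<omega> c) \<le> exp (n * (P c - \<mu>))}"
    have "(\<lambda>n. \<Sum>c\<in>C. prob (?L n c)) \<longlonglongrightarrow> (\<Sum>c\<in>C. 0)"
    proof (rule tendsto_sum)
      fix c assume c: "c \<in> C"
      then have "c \<noteq> 0" using C(5) by auto
      then show "(\<lambda>n. prob (?L n c)) \<longlonglongrightarrow> 0"
        by (intro F_lower_bound[where \<xi>=\<xi>, OF prob_space_axioms indep ident nondeg _ CD[OF c] _ \<mu>(1)]
            AE_converges[where \<xi>=\<xi>, OF prob_space_axioms \<xi>_measurable ident moment])
    qed
    then have "eventually (\<lambda>n. (\<Sum>c\<in>C. prob (?L n c)) < \<eta> / 2) sequentially"
      using \<eta> by (intro order_tendstoD(2)[where y="\<Sum>c\<in>C. 0"]) simp_all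
    moreover have "eventually (\<lambda>n. ln B / real n < \<mu> / 2) sequentially"
    proof -
      have "(\<lambda>n. ln B / real n) \<longlonglongrightarrow> 0" by real_asymp
      then show ?thesis using \<mu>2 by (rule order_tendstoD)
    qed
    ultimately show ?thesis using eventually_ge_at_top[of 1]
    proof eventually_elim
      case (elim n)
      note small = elim(1) and lnB = elim(2) and n = elim(3)
      have n0: "real n > 0" using n by simp
      let ?bad = "{\<omega>\<in>space M. \<bar>integral\<^sup>L (\<nu> n \<omega>) \<phi> - ?I\<bar> > \<epsilon>}"
      let ?A = "{\<omega>\<in>space M. \<not> (\<forall>k. norm (\<xi> k \<omega>) \<le> A * exp (\<epsilon>' * k))}"
      have good: "\<bar>integral\<^sup>L (\<nu> n \<omega>) \<phi> - ?I\<bar> \<le> \<epsilon>"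
        if conv: "converges n (\<lambda>k. \<xi> k \<omega>)" and gr: "\<And>k. norm (\<xi> k \<omega>) \<le> A * exp (\<epsilon>' * k)"
          and lb: "\<And>c. c \<in> C \<Longrightarrow> norm (G n \<omega> c) > exp (n * (P c - \<mu>))" for \<omega>
      proof -
        let ?H = "G n \<omega>"
        have H: "?H holomorphic_on D" by (rule converges_holomorphic[OF conv])
        have "0 \<in> cball (0::complex) R" using R by simp
        then obtain c0 where c0: "c0 \<in> C" using C(7) by blast
        have Hc: "?H c \<noteq> 0" if "c \<in> C" for c using lb[OF that] by (metis exp_gt_zero norm_zero order_less_asym)
        have nz: "\<exists>z\<in>D. ?H z \<noteq> 0" using Hc[OF c0] CD[OF c0] by blast
        have "(LINT z:cball 0 R|lborel. \<bar>ln (norm (?H z)) / n - P z\<bar>) \<le> (3 * pi * (36 * R\<^sup>2) + pi * R\<^sup>2) * \<mu>"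
        proof (rule L1_bound_from_centres[OF holomorphic_on_subset[OF H RD(2)] R(4,2,1) n0 Pc _ _ C(1,2,4,7) Csub])
          show "\<mu> \<ge> 0" using \<mu> by simp
          show "ln (norm (?H z)) / n \<le> P z + \<mu>" if z: "z \<in> ball 0 R'" for z
          proof (cases "?H z = 0")
            case True
            have "z \<in> D" using z RD(1) ball_subset_cball by blast
            then show ?thesis using True P_nonneg[of z] \<mu> by simp
          next
            case False
            have zR: "norm z \<le> R'" using z by simp
            let ?E = "\<alpha> * L (norm z powr (1 / \<alpha>) * exp (2 * \<epsilon>' / \<alpha>))"
            have "norm (?H z) \<le> B * exp (n * ?E)"
              unfolding B_def by (rule growth_bound(2)[OF n gr \<epsilon>'(1)]) (use \<epsilon>'(2)[OF zR] in blast)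
            then have "ln (norm (?H z)) \<le> ln (B * exp (n * ?E))" using False B by (subst ln_le_cancel_iff) auto
            also have "\<dots> = ln B + n * ?E" using B by (simp add: ln_mult)
            finally have "ln (norm (?H z)) / n \<le> (ln B + n * ?E) / n" using n0 by (intro divide_right_mono) auto
            also have "\<dots> = ln B / n + ?E" using n0 by (simp add: add_divide_distrib)
            also have "\<dots> \<le> \<mu> / 2 + (P z + \<mu> / 2)" using lnB \<epsilon>'(2)[OF zR] by (intro add_mono) auto
            finally show ?thesis by simp
          qed
          show "\<bar>P z - P c\<bar> \<le> \<mu>" if "c \<in> C" "z \<in> ball c d" for c z
          proof -
            have "z \<in> cball 0 R'" "c \<in> cball 0 R'" using Csub[OF that(1)] CR[OF that(1)] that(2) ball_subset_cball by blast+
            moreover have "dist z c < d0" using that(2) d(1) by (simp add: dist_commute)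
            ultimately have "dist (P z) (P c) < \<mu>" by (intro d0(2))
            then show ?thesis by (simp add: dist_real_def)
          qed
          show "?H c \<noteq> 0 \<and> P c - \<mu> \<le> ln (norm (?H c)) / n" if c: "c \<in> C" for c
          proof
            show "?H c \<noteq> 0" by (rule Hc[OF c])
            have "ln (exp (n * (P c - \<mu>))) \<le> ln (norm (?H c))" using lb[OF c] Hc[OF c] by (subst ln_le_cancel_iff) auto
            then show "P c - \<mu> \<le> ln (norm (?H c)) / n" using n0 by (simp add: pos_le_divide_eq mult.commute)
          qed
        qed
        also have "\<dots> = \<kappa>" using \<mu>(2) by (simp add: Kc_def)
        finally have L1: "(LINT z:cball 0 (r + 4 * e)|lborel. \<bar>ln (norm (?H z)) / n - P z\<bar>) \<le> \<kappa>" by (simp add: R_def)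
        have "integral\<^sup>L (scale_measure (ennreal (1 / real n)) (zero_measure D ?H)) \<phi> = integral\<^sup>L (zero_measure D ?H) \<phi> / n"
          by (simp add: integral_scale_measure)
        also have "integral\<^sup>L (zero_measure D ?H) \<phi> = (\<Sum>a\<in>{z\<in>cball 0 (r + 4 * e). ?H z = 0}. nat (zorder ?H a) * \<phi>' a)"
          by (rule integral_zeros(1)[OF \<phi> \<phi>' _ _ _ re(3) H nz]) (use re in auto)
        finally show ?thesis using \<kappa>(2)[OF H nz n0 L1] I by simp
      qed
      have conv: "AE \<omega> in M. converges n (\<lambda>k. \<xi> k \<omega>)"
        by (rule AE_converges[where \<xi>=\<xi>, OF prob_space_axioms \<xi>_measurable ident moment n])
      have "prob ?bad \<le> prob (?A \<union> (\<Union>c\<in>C. ?L n c))"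
      proof (rule finite_measure_mono_AE)
        show "AE \<omega> in M. \<omega> \<in> ?bad \<longrightarrow> \<omega> \<in> ?A \<union> (\<Union>c\<in>C. ?L n c)"
          using conv
        proof eventually_elim
          case (elim \<omega>)
          show ?case
          proof (rule impI, rule ccontr)
            assume b: "\<omega> \<in> ?bad" and nb: "\<omega> \<notin> ?A \<union> (\<Union>c\<in>C. ?L n c)"
            have "\<bar>integral\<^sup>L (\<nu> n \<omega>) \<phi> - ?I\<bar> \<le> \<epsilon>"
            proof (rule good[OF elim])
              show "norm (\<xi> k \<omega>) \<le> A * exp (\<epsilon>' * k)" for k using b nb by blast
              show "norm (G n \<omega> c) > exp (n * (P c - \<mu>))" if "c \<in> C" for c using b nb that by (auto simp: not_le)
            qed
            then show False using b by simp
          qed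
        qed
        show "?A \<union> (\<Union>c\<in>C. ?L n c) \<in> events" using C(1) by (intro sets.Un sets.finite_UN) auto
      qed
      also have "\<dots> \<le> prob ?A + prob (\<Union>c\<in>C. ?L n c)" using C(1) by (intro measure_Un_le sets.finite_UN) auto
      also have "prob (\<Union>c\<in>C. ?L n c) \<le> (\<Sum>c\<in>C. prob (?L n c))"
        using C(1) by (intro finite_measure_subadditive_finite) auto
      finally show ?case using A(2) small by linarith
    qed
  qed
  then show ?thesis
    by (intro LIMSEQ_I) (fastforce simp: eventually_sequentially)
qed

theorem zeros_converge:
  "random_measures_tendsto_in_prob M D (\<lambda>n \<omega>. \<nu> n \<omega>)
    (\<lambda>_. lebesgue_density_measure D \<rho>)"
  unfolding random_measures_tendsto_in_prob_def random_measure_def tendsto_in_prob_def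
proof (intro conjI allI ballI impI)
  show "locally_finite_measure D (\<nu> n \<omega>)" for n \<omega>
    by (intro locally_finite_measure_scale zero_measure_locally_finite open_D connected_D)
  show m: "(\<lambda>\<omega>. integral\<^sup>L (\<nu> n \<omega>) \<phi>) \<in> borel_measurable M"
    if "test_function D \<phi>" for n \<phi>
    using integral_zero_measure_measurable[OF that, of n] by (simp add: integral_scale_measure)
  then show "(\<lambda>\<omega>. integral\<^sup>L (\<nu> n \<omega>) \<phi>) \<in> borel_measurable M"
    if "test_function D \<phi>" for n \<phi>
    using that .
qed (simp_all add: density_measure_locally_finite zeros_tendsto_in_prob)

end

text \<open>Jensen's formula for a radial potential: the mass of the disc of radius \<open>t\<close>
  is \<open>t\<close> times the derivative of \<open>?q\<close>, here
  \<open>s / (1 - \<sigma> * s)\<close> with \<open>s = t powr (1 / \<alpha>)\<close>; its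
  derivative in \<open>t\<close> is the radial density \<open>?d\<close>.\<close>

lemma (in coefficient_family) limit_potential_curvature:
  assumes L': "\<And>s. s > 0 \<Longrightarrow> complex_of_real s \<in> D \<Longrightarrow> (L has_real_derivative 1 / (1 - \<sigma> * s)) (at s)"
    and pos: "\<And>s. s > 0 \<Longrightarrow> complex_of_real s \<in> D \<Longrightarrow> 1 - \<sigma> * s > 0"
    and \<rho>: "\<And>z. \<rho> z = 1 / (2 * pi * \<alpha>) * norm z powr (1 / \<alpha> - 2) / (1 - \<sigma> * norm z powr (1 / \<alpha>)) ^ 2"
  shows "limit_potential D P \<rho>"
proof (rule limit_potential_radial[OF D])
  let ?s = "\<lambda>t::real. t powr (1 / \<alpha>)"
  let ?q = "\<lambda>t. \<alpha> * L (?s t)" and ?m = "\<lambda>t. ?s t / (1 - \<sigma> * ?s t)"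
    and ?d = "\<lambda>t. (1 / \<alpha>) * t powr (1 / \<alpha> - 1) / (1 - \<sigma> * ?s t) ^ 2"
  have s': "(?s has_real_derivative (1 / \<alpha>) * t powr (1 / \<alpha> - 1)) (at t)" if "t > 0" for t
    using that by (auto intro!: derivative_eq_intros)
  have sD: "?s t > 0" "complex_of_real (?s t) \<in> D" if "t > 0" "complex_of_real t \<in> D" for t
    using powr_root_in_D[OF that(2)] that(1) by auto
  have ts: "t powr (1 / \<alpha> - 1) = ?s t / t" if "t > 0" for t using that by (simp add: powr_diff)
  show "(?q has_real_derivative ?m t / t) (at t)" if t: "0 < t" "complex_of_real t \<in> D" for t
  proof -
    have "(?q has_real_derivative \<alpha> * (1 / (1 - \<sigma> * ?s t) * ((1 / \<alpha>) * t powr (1 / \<alpha> - 1)))) (at t)"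
      by (intro DERIV_cmult DERIV_chain2[OF L'[OF sD[OF t]] s'[OF t(1)]])
    also have "\<alpha> * (1 / (1 - \<sigma> * ?s t) * ((1 / \<alpha>) * t powr (1 / \<alpha> - 1))) = ?m t / t"
      using \<alpha> ts[OF t(1)] by simp
    finally show ?thesis .
  qed
  show "(?m has_real_derivative ?d t) (at t)" if t: "0 < t" "complex_of_real t \<in> D" for t
  proof -
    have nz: "1 - \<sigma> * ?s t \<noteq> 0" using pos[OF sD[OF t]] by simp
    let ?s1 = "(1 / \<alpha>) * t powr (1 / \<alpha> - 1)"
    have "(?m has_real_derivative (?s1 * (1 - \<sigma> * ?s t) - ?s t * (0 - \<sigma> * ?s1)) / ((1 - \<sigma> * ?s t) * (1 - \<sigma> * ?s t))) (at t)"
      by (intro DERIV_divide DERIV_diff DERIV_const DERIV_cmult s'[OF t(1)] nz)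
    also have "(?s1 * (1 - \<sigma> * ?s t) - ?s t * (0 - \<sigma> * ?s1)) / ((1 - \<sigma> * ?s t) * (1 - \<sigma> * ?s t)) = ?d t"
    proof -
      have "x * (1 - \<sigma> * y) - y * (0 - \<sigma> * x) = x" for x y :: real by (simp add: algebra_simps)
      then show ?thesis by (simp only: power2_eq_square)
    qed
    finally show ?thesis .
  qed
  show "isCont ?d t" if t: "0 < t" "complex_of_real t \<in> D" for t
  proof -
    have nz: "1 - \<sigma> * ?s t \<noteq> 0" using pos[OF sD[OF t]] by simp
    show ?thesis using t(1) nz by (intro continuous_intros) auto
  qed
  show "?d t \<ge> 0" for t using \<alpha> by simp
  have "(?s \<longlongrightarrow> 0) (at_right 0)" using \<alpha> by real_asymp
  then have "(?m \<longlongrightarrow> 0 / (1 - \<sigma> * 0)) (at_right 0)" by (intro tendsto_intros) auto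
  then show "(?m \<longlongrightarrow> 0) (at_right 0)" by simp
  show "?d \<in> borel_measurable borel" by measurable
  show "P z = ?q (norm z)" for z by (simp add: P_def)
  have "continuous_on D (\<lambda>z. L (norm z powr (1 / \<alpha>)))"
  proof (rule continuous_on_compose2[OF L_continuous])
    show "continuous_on D (\<lambda>z. norm z powr (1 / \<alpha>))"
      using \<alpha> by (intro continuous_on_powr' continuous_intros) auto
    show "(\<lambda>z. norm z powr (1 / \<alpha>)) ` D \<subseteq> {s. s \<ge> 0 \<and> complex_of_real s \<in> D}"
      using powr_root_in_D by auto
  qed
  then show "continuous_on D P" unfolding P_def by (intro continuous_intros)
  show "\<rho> z = ?d (norm z) / (2 * pi * norm z)" for z
  proof (cases "z = 0")
    case False
    have "norm z powr (1 / \<alpha> - 2) = norm z powr (1 / \<alpha> - 1) / norm z"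
      using powr_diff[of "norm z" "1 / \<alpha> - 1" 1] False by simp
    then show ?thesis by (simp add: \<rho>)
  qed (simp add: \<rho>)
qed

section \<open>The elliptic, flat and hyperbolic cases\<close>

text \<open>For \<open>\<sigma> = -1\<close> factors with \<open>i > n\<close> are negative, but
  then the factor with \<open>i = n\<close> is 0; the quotient is a binomial coefficient.\<close>

lemma rising_product_nonneg:
  fixes \<sigma> :: real
  assumes "\<sigma> \<in> {-1, 0, 1}"
  shows "(\<Prod>i<k. real n + \<sigma> * real i) / fact k \<ge> 0"
proof (cases "\<sigma> = -1")
  case True
  have "(\<Prod>i<k. real n - real i) / fact k = real (n choose k)"
    by (simp add: binomial_gbinomial gbinomial_prod_rev atLeast0LessThan)
  then show ?thesis using True by simp
next
  case False
  then show ?thesis using assms by (auto intro!: divide_nonneg_nonneg prod_nonneg)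
qed

text \<open>The binomial theorem, the exponential series and the binomial series with exponent
  \<open>- n\<close>, for \<open>\<sigma> = -1, 0, 1\<close> in this order.\<close>

lemma rising_product_sums:
  fixes \<sigma> s :: real
  assumes \<sigma>: "\<sigma> \<in> {-1, 0, 1}" and s: "0 \<le> s" "\<sigma> = 1 \<Longrightarrow> s < 1"
  shows "(\<lambda>k. (\<Prod>i<k. real n + \<sigma> * real i) / fact k * s ^ k) sums
    exp (n * (if \<sigma> = 0 then s else - ln (1 - \<sigma> * s) / \<sigma>))"
proof -
  consider "\<sigma> = -1" | "\<sigma> = 0" | "\<sigma> = 1" using \<sigma> by auto
  then show ?thesis
  proof cases
    case 1
    have eq: "(\<Prod>i<k. real n - real i) / fact k = real (n choose k)" for k
      by (simp add: binomial_gbinomial gbinomial_prod_rev atLeast0LessThan)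
    have "(\<lambda>k. real (n choose k) * s ^ k) sums (\<Sum>k\<le>n. real (n choose k) * s ^ k)"
      by (intro sums_finite) (auto simp: binomial_eq_0)
    also have "(\<Sum>k\<le>n. real (n choose k) * s ^ k) = (1 + s) ^ n"
      using binomial_ring[of s 1 n] by (simp add: add.commute)
    also have "\<dots> = exp (n * ln (1 + s))" using s(1) by (simp add: exp_of_nat_mult)
    finally show ?thesis using 1 by (simp add: eq)
  next
    case 2
    have "(\<lambda>k. (real n * s) ^ k /\<^sub>R fact k) sums exp (real n * s)" by (rule exp_converges)
    then show ?thesis using 2 by (simp add: power_mult_distrib divide_simps mult_ac)
  next
    case 3
    \<comment> \<open>The signs of the falling factorial at \<open>- n\<close> and of
      \<open>(- s) ^ k\<close> cancel.\<close>
    have eq: "(- real n gchoose k) * (- s) ^ k = (\<Prod>i<k. real n + real i) / fact k * s ^ k" for k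
    proof -
      have "(\<Prod>i<k. - real n - real i) = (\<Prod>i<k. (-1) * (real n + real i))" by (intro prod.cong) auto
      also have "\<dots> = (-1) ^ k * (\<Prod>i<k. real n + real i)" by (simp only: prod.distrib prod_constant card_lessThan)
      finally have "(\<Prod>i<k. - real n - real i) = (-1) ^ k * (\<Prod>i<k. real n + real i)" .
      moreover have "(- s) ^ k = (-1) ^ k * s ^ k" by (rule power_minus)
      moreover have "(-1) ^ k * (-1) ^ k = (1::real)" by (simp flip: power_mult_distrib)
      ultimately show ?thesis by (simp add: gbinomial_prod_rev atLeast0LessThan)
    qed
    have "(\<lambda>k. (- real n gchoose k) * (- s) ^ k) sums (1 + - s) powr (- real n)"
      using s 3 by (intro gen_binomial_real) auto
    moreover have "(1 + - s) powr (- real n) = exp (n * (- ln (1 - s)))" using s 3 by (simp add: powr_def)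
    ultimately show ?thesis using 3 by (simp add: eq)
  qed
qed

lemma coefficient_family_rising_product:
  fixes \<sigma> \<alpha> :: real
  assumes \<sigma>: "\<sigma> \<in> {-1, 0, 1}" and \<alpha>: "\<alpha> > 0"
  shows "coefficient_family (if \<sigma> = 1 then ball 0 1 else UNIV) (\<lambda>n k. (\<Prod>i<k. real n + \<sigma> * real i) / fact k)
    (\<lambda>s. if \<sigma> = 0 then s else - ln (1 - \<sigma> * s) / \<sigma>) \<alpha>"
proof
  let ?D = "if \<sigma> = 1 then ball 0 1 else UNIV :: complex set"
  let ?b = "\<lambda>n k. (\<Prod>i<k. real n + \<sigma> * real i) / fact k"
  show "?D = UNIV \<or> ?D = ball 0 1" by simp
  show "\<alpha> > 0" by fact
  show "?b n k \<ge> 0" for n k by (rule rising_product_nonneg[OF \<sigma>])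
  show "?b n 0 = 1" for n by simp
  show "?b n (Suc k) \<le> n * ?b n k" if n: "n \<ge> 1" for n k
  proof -
    \<comment> \<open>Consecutive coefficients have ratio
      \<open>(n + \<sigma> * k) / (k + 1)\<close>, and \<open>n + k \<le> n * (k + 1)\<close> for
      \<open>n \<ge> 1\<close>.\<close>
    have "?b n (Suc k) = ?b n k * ((real n + \<sigma> * real k) / (real k + 1))"
      by (simp add: field_simps)
    also have "\<dots> \<le> ?b n k * n"
    proof (rule mult_left_mono[OF _ rising_product_nonneg[OF \<sigma>]])
      have "\<sigma> * real k \<le> 1 * real k" using \<sigma> by (intro mult_right_mono) auto
      also have "\<dots> \<le> real n * real k" using n by (intro mult_right_mono) auto
      finally show "(real n + \<sigma> * real k) / (real k + 1) \<le> n" by (simp add: pos_divide_le_eq add_nonneg_pos distrib_left)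
    qed
    finally show ?thesis by (simp add: mult.commute)
  qed
  show "(\<lambda>k. ?b n k * s ^ k) sums exp (n * (if \<sigma> = 0 then s else - ln (1 - \<sigma> * s) / \<sigma>))"
    if "s \<ge> 0" "complex_of_real s \<in> ?D" for n s
    using that by (intro rising_product_sums[OF \<sigma>]) auto
  show "continuous_on {s. s \<ge> 0 \<and> complex_of_real s \<in> ?D} (\<lambda>s. if \<sigma> = 0 then s else - ln (1 - \<sigma> * s) / \<sigma>)"
    using \<sigma> by (auto intro!: continuous_intros)
  show "(if \<sigma> = 0 then s else - ln (1 - \<sigma> * s) / \<sigma>) > 0" if "s > 0" "complex_of_real s \<in> ?D" for s
    using \<sigma> that by (auto simp: ln_less_zero)
qed

text \<open>\<open>\<sigma>\<close> is the opposite of the sign of the curvature: sphere, plane and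
  hyperbolic disc for -1, 0, 1. As a parameter it lets one instance of the general convergence
  theorem serve all three cases.\<close>

theorem rising_product_zeros_converge:
  fixes M :: "'a measure" and \<xi> :: "nat \<Rightarrow> 'a \<Rightarrow> complex" and \<alpha> \<sigma> :: real
  assumes \<alpha>: "\<alpha> > 0" and \<sigma>: "\<sigma> \<in> {-1, 0, 1}"
    and M: "prob_space M"
    and indep: "prob_space.indep_vars M (\<lambda>_. borel) \<xi> UNIV"
    and ident: "\<And>k. distr M borel (\<xi> k) = distr M borel (\<xi> 0)"
    and nondeg: "\<not> (\<exists>c. AE \<omega> in M. \<xi> 0 \<omega> = c)"
    and moment: "integrable M (\<lambda>\<omega>. ln (1 + norm (\<xi> 0 \<omega>)))"
  defines "D \<equiv> if \<sigma> = 1 then ball 0 1 else UNIV"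
  shows "random_measures_tendsto_in_prob M D
     (\<lambda>n \<omega>. scale_measure (ennreal (1 / real n)) (zero_measure D
       (\<lambda>z. \<Sum>k. \<xi> k \<omega> * of_real (((\<Prod>i<k. real n + \<sigma> * real i) / fact k) powr \<alpha>) * z ^ k)))
     (\<lambda>_. lebesgue_density_measure D
       (\<lambda>z. 1 / (2 * pi * \<alpha>) * norm z powr (1 / \<alpha> - 2) / (1 - \<sigma> * norm z powr (1 / \<alpha>)) ^ 2))"
proof -
  define b where "b = (\<lambda>n k. (\<Prod>i<k. real n + \<sigma> * real i) / fact k)"
  define L where "L = (\<lambda>s. if \<sigma> = 0 then s else - ln (1 - \<sigma> * s) / \<sigma>)"
  define \<rho> where "\<rho> = (\<lambda>z. 1 / (2 * pi * \<alpha>) * norm (z::complex) powr (1 / \<alpha> - 2) / (1 - \<sigma> * norm z powr (1 / \<alpha>)) ^ 2)"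
  interpret coefficient_family D b L \<alpha>
    unfolding D_def b_def L_def by (rule coefficient_family_rising_product[OF \<sigma> \<alpha>])
  have pos: "1 - \<sigma> * s > 0" if "s > 0" "complex_of_real s \<in> D" for s
    using that \<sigma> by (auto simp: D_def)
  have "limit_potential D P \<rho>"
  proof (rule limit_potential_curvature[OF _ pos])
    show "(L has_real_derivative 1 / (1 - \<sigma> * s)) (at s)" if "s > 0" "complex_of_real s \<in> D" for s
      using pos[OF that] by (cases "\<sigma> = 0") (auto simp: L_def intro!: derivative_eq_intros)
  qed (simp_all add: \<rho>_def)
  then interpret limit_potential D P \<rho> .
  interpret prob_space M by fact
  interpret random_zeros D b L \<alpha> \<rho> M \<xi>
    by unfold_locales (use indep ident nondeg moment in blast)+
  have "F n x = (\<lambda>z. \<Sum>k. x k * of_real (((\<Prod>i<k. real n + \<sigma> * real i) / fact k) powr \<alpha>) * z ^ k)" for n x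
    unfolding fun_eq_iff F_def by (simp add: b_def)
  with zeros_converge show ?thesis by (simp add: \<rho>_def)
qed

theorem theorem2p1:
  fixes M :: "'a measure" and \<xi> :: "nat \<Rightarrow> 'a \<Rightarrow> complex" and \<alpha> :: real
  assumes "\<alpha> > 0"
    and "prob_space M"
    and "prob_space.indep_vars M (\<lambda>_. borel) \<xi> UNIV"
    and "\<And>k. distr M borel (\<xi> k) = distr M borel (\<xi> 0)"
    and "\<not> (\<exists>c. AE \<omega> in M. \<xi> 0 \<omega> = c)"
    and "integrable M (\<lambda>\<omega>. ln (1 + norm (\<xi> 0 \<omega>)))"
  shows
    "random_measures_tendsto_in_prob M UNIV
       (\<lambda>n \<omega>. scale_measure (ennreal (1 / real n))
                (zero_measure UNIV (elliptic_fun \<alpha> n (\<lambda>k. \<xi> k \<omega>))))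
       (\<lambda>_. lebesgue_density_measure UNIV (elliptic_density \<alpha>))
     \<and> random_measures_tendsto_in_prob M UNIV
       (\<lambda>n \<omega>. scale_measure (ennreal (1 / real n))
                (zero_measure UNIV (flat_fun \<alpha> n (\<lambda>k. \<xi> k \<omega>))))
       (\<lambda>_. lebesgue_density_measure UNIV (flat_density \<alpha>))
     \<and> random_measures_tendsto_in_prob M (ball 0 1)
       (\<lambda>n \<omega>. scale_measure (ennreal (1 / real n))
                (zero_measure (ball 0 1) (hyperbolic_fun \<alpha> n (\<lambda>k. \<xi> k \<omega>))))
       (\<lambda>_. lebesgue_density_measure (ball 0 1) (hyperbolic_density \<alpha>))"
proof -
  have elliptic: "elliptic_fun \<alpha> n x = (\<lambda>z. \<Sum>k. x k * of_real (((\<Prod>i<k. real n + -1 * real i) / fact k) powr \<alpha>) * z ^ k)" for n x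
  proof
    fix z
    \<comment> \<open>Beyond \<open>n\<close> the product contains the factor \<open>n - n\<close>,
      and \<open>0 powr \<alpha> = 0\<close>, so the polynomial is a power series of the common
      form.\<close>
    have "(\<Prod>i<k. real n - real i) = 0" if "k \<notin> {..n}" for k
      using that by (intro prod_zero) auto
    then show "elliptic_fun \<alpha> n x z = (\<Sum>k. x k * of_real (((\<Prod>i<k. real n + -1 * real i) / fact k) powr \<alpha>) * z ^ k)"
      unfolding elliptic_fun_def by (subst suminf_finite[of "{..n}"]) auto
  qed
  have flat: "flat_fun \<alpha> n x = (\<lambda>z. \<Sum>k. x k * of_real (((\<Prod>i<k. real n + 0 * real i) / fact k) powr \<alpha>) * z ^ k)" for n x
    by (simp add: flat_fun_def fun_eq_iff)
  have hyperbolic: "hyperbolic_fun \<alpha> n x = (\<lambda>z. \<Sum>k. x k * of_real (((\<Prod>i<k. real n + 1 * real i) / fact k) powr \<alpha>) * z ^ k)" for n x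
    by (simp add: hyperbolic_fun_def fun_eq_iff)
  have densities: "elliptic_density \<alpha> = (\<lambda>z. 1 / (2 * pi * \<alpha>) * norm z powr (1 / \<alpha> - 2) / (1 - -1 * norm z powr (1 / \<alpha>)) ^ 2)"
    "flat_density \<alpha> = (\<lambda>z. 1 / (2 * pi * \<alpha>) * norm z powr (1 / \<alpha> - 2) / (1 - 0 * norm z powr (1 / \<alpha>)) ^ 2)"
    "hyperbolic_density \<alpha> = (\<lambda>z. 1 / (2 * pi * \<alpha>) * norm z powr (1 / \<alpha> - 2) / (1 - 1 * norm z powr (1 / \<alpha>)) ^ 2)"
    by (simp_all add: elliptic_density_def flat_density_def hyperbolic_density_def fun_eq_iff)
  have zeros: "random_measures_tendsto_in_prob M (if \<sigma> = 1 then ball 0 1 else UNIV)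
     (\<lambda>n \<omega>. scale_measure (ennreal (1 / real n)) (zero_measure (if \<sigma> = 1 then ball 0 1 else UNIV)
       (\<lambda>z. \<Sum>k. \<xi> k \<omega> * of_real (((\<Prod>i<k. real n + \<sigma> * real i) / fact k) powr \<alpha>) * z ^ k)))
     (\<lambda>_. lebesgue_density_measure (if \<sigma> = 1 then ball 0 1 else UNIV)
       (\<lambda>z. 1 / (2 * pi * \<alpha>) * norm z powr (1 / \<alpha> - 2) / (1 - \<sigma> * norm z powr (1 / \<alpha>)) ^ 2))"
    if "\<sigma> \<in> {-1, 0, 1}" for \<sigma> :: real
    by (rule rising_product_zeros_converge[OF assms(1) that assms(2-6)])
  show ?thesis
    unfolding elliptic flat hyperbolic densities
    using zeros[of "-1"] zeros[of 0] zeros[of 1] by simp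
qed

end
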